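(* Let $m\in\{0,1\}$, let $p>1+(3+m)/n$, let $f$ satisfy the assumptions in the context, and let $\varepsilon_0>0$ be a constant with the property that for every $\psi\in L^1(\mathbb{R}^n)\cap L^\infty(\mathbb{R}^n)$ with $\|\psi\|_1+\|\psi\|_\infty\le\varepsilon_0$ the Cauchy problem (P) with initial data $\psi$ has a unique global solution $v\in X$, and this solution satisfies $\sup_{q\in[1,+\infty]}\sup_{t\ge0}(1+t)^{\frac n2(1-\frac1q)}\|v(t)\|_q<+\infty$. Let $\varphi\in L^1_{m+1}(\mathbb{R}^n)\cap L^\infty(\mathbb{R}^n)$ satisfy $\|\varphi\|_1+\|\varphi\|_\infty\le\varepsilon_0$, and let $u\in X$ be the global solution to (P) with initial data $\varphi$. Put $$\varphi_1:=\varphi+\int_0^{+\infty}f(u(s))\,ds,\qquad c_0:=\int_{\mathbb{R}^n}\varphi_1(y)\,dy,\qquad c_j:=\int_{\mathbb{R}^n}y_j\varphi_1(y)\,dy\quad(j=1,\dots,n).$$ Then for any $q\in[1,+\infty]$ there exists $C_q>0$ such that, for all $t>1$, $$t^{\frac n2(1-\frac1q)}\|u(t)-c_0\,\delta_tG_1\|_q\le C_q\,t^{-\frac12}\qquad\text{if }m=0,$$ $$t^{\frac n2(1-\frac1q)}\Bigl\|u(t)-c_0\,\delta_tG_1-\frac12t^{-\frac12}\sum_{j=1}^nc_j\,\delta_t(x_jG_1)\Bigr\|_q\le C_q\,t^{-1}\qquad\text{if }m=1.$$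
   Context: $n\ge1$ is an integer; $\|\cdot\|_q$ is the norm of $L^q(\mathbb{R}^n)$, all functions being real-valued. The nonlinearity $f:\mathbb{R}\to\mathbb{R}$ satisfies $f(0)=0$ and, for some constants $K>0$ and $p\in(1,+\infty)$, $|f(\xi)-f(\eta)|\le K(|\xi|^{p-1}+|\eta|^{p-1})|\xi-\eta|$ for all $\xi,\eta\in\mathbb{R}$. The Cauchy problem (P) is $\partial_t u-\Delta u=f(u)$ in $(0,+\infty)\times\mathbb{R}^n$, $u(0)=\varphi$. Heat semigroup: $e^{t\Delta}\varphi=G_t*\varphi$ for $t>0$ and $e^{0\Delta}\varphi=\varphi$, where $G_t(x)=(4\pi t)^{-n/2}\exp(-|x|^2/(4t))$. $X=(C\cap L^\infty)([0,+\infty);L^1(\mathbb{R}^n))\cap(C\cap L^\infty)((0,+\infty);L^\infty(\mathbb{R}^n))$ (bounded continuous functions of time in both senses). A global solution to (P) in $X$ means $u\in X$ satisfying the integral equation $u(t)=e^{t\Delta}\varphi+\int_0^te^{(t-s)\Delta}f(u(s))\,ds$ for all $t\ge0$. $L^1_m(\mathbb{R}^n)=\{\varphi\in L^1(\mathbb{R}^n): x^\alpha\varphi\in L^1(\mathbb{R}^n)\text{ for all }\alpha\in\mathbb{Z}_{\ge0}^n\text{ with }|\alpha|\le m\}$, where $x^\alpha\varphi$ denotes the function $x\mapsto x^\alpha\varphi(x)$; likewise $x_jG_1$ is the function $x\mapsto x_jG_1(x)$. The dilation $\delta_t$ ($t>0$) is $(\delta_t\psi)(x)=t^{-n/2}\psi(t^{-1/2}x)$.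 A constant $\varepsilon_0$ with the stated property exists whenever $p>1+2/n$. *)

theory Defs
  imports "HOL-Analysis.Analysis" "HOL-Probability.Essential_Supremum"
begin

text \<open>Elements of \<open>L\<^sup>q\<close> are represented by functions; equality in \<open>L\<^sup>q\<close> is equality
  almost everywhere with respect to Lebesgue measure.\<close>

text \<open>The \<open>L\<^sup>q\<close> norm for an exponent in \<open>[1, \<infinity>]\<close>. Following the convention of
  \<^const>\<open>esssup\<close>, it is infinite on non-measurable functions, so that finiteness of the norm
  is the same as membership in \<open>L\<^sup>q\<close>.\<close>

definition Lnorm :: "ennreal \<Rightarrow> (real ^ 'n \<Rightarrow> real) \<Rightarrow> ennreal" where
  "Lnorm q g =
    (if g \<notin> borel_measurable lebesgue then \<infinity>
     else if q = \<infinity> then esssup lebesgue (\<lambda>x. ennreal \<bar>g x\<bar>)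
     else let I = (\<integral>\<^sup>+ x. ennreal (\<bar>g x\<bar> powr enn2real q) \<partial>lebesgue)
          in if I = \<infinity> then \<infinity> else ennreal (enn2real I powr (1 / enn2real q)))"

definition Lspace :: "ennreal \<Rightarrow> (real ^ 'n \<Rightarrow> real) set" where
  "Lspace q = {g \<in> borel_measurable lebesgue. Lnorm q g < \<infinity>}"

definition L1_moment :: "nat \<Rightarrow> (real ^ 'n \<Rightarrow> real) set" where
  "L1_moment m = {\<phi> \<in> Lspace 1. \<forall>\<alpha> :: 'n \<Rightarrow> nat. (\<Sum>i\<in>UNIV. \<alpha> i) \<le> m \<longrightarrow>
     (\<lambda>x. (\<Prod>i\<in>UNIV. (x $ i) ^ \<alpha> i) * \<phi> x) \<in> Lspace 1}"

definition gauss :: "real \<Rightarrow> real ^ 'n \<Rightarrow> real" where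
  "gauss t x = (4 * pi * t) powr (- real CARD('n) / 2) * exp (- (norm x)\<^sup>2 / (4 * t))"

text \<open>Only times \<open>t \<ge> 0\<close> are meaningful.\<close>

definition heat :: "real \<Rightarrow> (real ^ 'n \<Rightarrow> real) \<Rightarrow> real ^ 'n \<Rightarrow> real" where
  "heat t \<phi> x = (if t > 0 then (\<integral> y. gauss t (x - y) * \<phi> y \<partial>lebesgue) else \<phi> x)"

definition dilation :: "real \<Rightarrow> (real ^ 'n \<Rightarrow> real) \<Rightarrow> real ^ 'n \<Rightarrow> real" where
  "dilation t \<psi> x = t powr (- real CARD('n) / 2) * \<psi> (t powr (- 1 / 2) *\<^sub>R x)"

definition bounded_continuous_in :: "real set \<Rightarrow> ennreal \<Rightarrow> (real \<Rightarrow> real ^ 'n \<Rightarrow> real) \<Rightarrow> bool" where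
  "bounded_continuous_in J q u \<longleftrightarrow>
    (\<forall>t\<in>J. u t \<in> Lspace q) \<and>
    (\<forall>t\<in>J. ((\<lambda>s. Lnorm q (\<lambda>x. u s x - u t x)) \<longlongrightarrow> 0) (at t within J)) \<and>
    (SUP t\<in>J. Lnorm q (u t)) < \<infinity>"

definition space_X :: "(real \<Rightarrow> real ^ 'n \<Rightarrow> real) set" where
  "space_X = {u. bounded_continuous_in {0..} 1 u \<and> bounded_continuous_in {0<..} \<infinity> u}"

text \<open>The Bochner integral over a time set \<open>J\<close> of a function with values in \<open>L\<^sup>1\<close>,
  defined as in \<^const>\<open>has_bochner_integral\<close>: \<open>g\<close> is approximated, in the sense that the integral
  of \<open>\<parallel>g(s) - S\<^sub>i(s)\<parallel>\<^sub>1\<close> tends to \<open>0\<close>, by the integrable simple functions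
  \<open>S\<^sub>i = (\<Sum>k<N i. indicator (A i k) h i k)\<close>, and the integrals of the \<open>S\<^sub>i\<close> converge to \<open>\<Psi>\<close>
  in \<open>L\<^sup>1\<close>. (The library constant is not applicable because the values are not elements of a
  normed vector space type.) Measurability of \<open>\<parallel>g(s) - S\<^sub>i(s)\<parallel>\<^sub>1\<close> in \<open>s\<close>, together with its
  convergence, makes \<open>g\<close> strongly measurable.\<close>

definition has_L1_integral ::
  "real set \<Rightarrow> (real \<Rightarrow> real ^ 'n \<Rightarrow> real) \<Rightarrow> (real ^ 'n \<Rightarrow> real) \<Rightarrow> bool" where
  "has_L1_integral J g \<Psi> \<longleftrightarrow> \<Psi> \<in> Lspace 1 \<and>
    (\<exists>(N :: nat \<Rightarrow> nat) (A :: nat \<Rightarrow> nat \<Rightarrow> real set) (h :: nat \<Rightarrow> nat \<Rightarrow> real ^ 'n \<Rightarrow> real).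
      (\<forall>i k. A i k \<in> lmeasurable \<and> A i k \<subseteq> J \<and> h i k \<in> Lspace 1) \<and>
      (\<forall>i. (\<lambda>s. Lnorm 1 (\<lambda>x. g s x - (\<Sum>k<N i. indicator (A i k) s * h i k x)))
              \<in> borel_measurable (lebesgue_on J)) \<and>
      (\<lambda>i. \<integral>\<^sup>+ s. Lnorm 1 (\<lambda>x. g s x - (\<Sum>k<N i. indicator (A i k) s * h i k x))
              \<partial>lebesgue_on J) \<longlonglongrightarrow> 0 \<and>
      (\<lambda>i. Lnorm 1 (\<lambda>x. \<Psi> x - (\<Sum>k<N i. measure lebesgue (A i k) * h i k x))) \<longlonglongrightarrow> 0)"

definition L1_integrable :: "real set \<Rightarrow> (real \<Rightarrow> real ^ 'n \<Rightarrow> real) \<Rightarrow> bool" where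
  "L1_integrable J g \<longleftrightarrow> (\<exists>\<Psi>. has_L1_integral J g \<Psi>)"

text \<open>A representative of the integral, which is unique only up to equality almost everywhere.\<close>

definition L1_integral :: "real set \<Rightarrow> (real \<Rightarrow> real ^ 'n \<Rightarrow> real) \<Rightarrow> real ^ 'n \<Rightarrow> real" where
  "L1_integral J g = (SOME \<Psi>. has_L1_integral J g \<Psi>)"

definition global_solution ::
  "(real \<Rightarrow> real) \<Rightarrow> (real ^ 'n \<Rightarrow> real) \<Rightarrow> (real \<Rightarrow> real ^ 'n \<Rightarrow> real) \<Rightarrow> bool" where
  "global_solution f \<phi> u \<longleftrightarrow> u \<in> space_X \<and>
    (\<forall>t\<ge>0. L1_integrable {0..t} (\<lambda>s. heat (t - s) (\<lambda>x. f (u s x))) \<and>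
       (AE x in lebesgue.
          u t x = heat t \<phi> x + L1_integral {0..t} (\<lambda>s. heat (t - s) (\<lambda>x. f (u s x))) x))"

end

theory Submission
  imports Defs "HOL-Probability.Distributions"
begin

text \<open>
  With \<open>k = m + 1\<close> and \<open>\<beta> = n (p - 1) / 2 > 1 + k / 2\<close>, the decay of \<open>u\<close> gives
  \<open>\<parallel>f (u s)\<parallel>\<^sub>1 \<le> C (1 + s)\<^sup>-\<^sup>\<beta>\<close>, and Duhamel's formula together with Gronwall's inequality gives
  \<open>\<parallel>\<bar>x\<bar>\<^sup>k u(t)\<parallel>\<^sub>1 \<le> C (1 + t)\<^sup>k\<^sup>/\<^sup>2\<close>. Hence \<open>\<phi>\<^sub>1\<close> has a finite moment of order \<open>k\<close>, and Taylor's formula for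
  the Gauss kernel expands \<open>e\<^sup>t\<^sup>\<Delta> \<phi>\<^sub>1\<close> up to an error of relative size \<open>t\<^sup>-\<^sup>k\<^sup>/\<^sup>2\<close>. The difference
  \<open>u(t) - e\<^sup>t\<^sup>\<Delta> \<phi>\<^sub>1\<close> is the integral of \<open>(e\<^sup>(\<^sup>t\<^sup>-\<^sup>s\<^sup>)\<^sup>\<Delta> - e\<^sup>t\<^sup>\<Delta>) f(u(s))\<close> over \<open>s \<le> t\<close> minus that of
  \<open>e\<^sup>t\<^sup>\<Delta> f(u(s))\<close> over \<open>s > t\<close>; its integrand is at most \<open>C t\<^sup>-\<^sup>k\<^sup>/\<^sup>2 (1 + s)\<^sup>k\<^sup>/\<^sup>2\<^sup>-\<^sup>\<beta>\<close>, by the time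
  regularity of the kernel if \<open>s \<le> t / 2\<close> and by the decay of \<open>f(u(s))\<close> otherwise. Only the
  exponents \<open>1\<close> and \<open>\<infinity>\<close> need to be treated, the others follow by interpolation. Both norms are
  computed by duality, which turns an \<open>L\<^sup>1\<close>-valued Bochner integral into integrals of real
  functions of time and moves the heat semigroup to the test function.
\<close>

section \<open>The Gauss kernel\<close>

text \<open>The hypothesis on \<open>p\<close> says exactly that (1 + s)^(k/2 - \<beta>) is
  integrable in time, and this one majorant serves twice: for the moment of
  \<open>\<phi>\<^sub>1\<close> and for the Duhamel remainder. The restriction m \<le> 1 enters as k
  \<le> 2: the kernel estimate gains one factor s/t, and s/t \<le> (s/t)^(k/2) requires k \<le> 2.
  For s close to t the kernel at time t - s offers no uniform regularity, so there the factor
  t^(-k/2) has to come from the decay of f(u(s)), in L^1 as well as in the supremum norm. A second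
  obstacle is that moments of u(t) are not known to be finite, whereas absorbing a supremum into the
  left-hand side needs finiteness. Weights are therefore cut off at a radius R, all bounds are kept
  independent of R, and Fatou's lemma removes the cut-off. Polynomial and exponential factors in |x|
  / sqrt t are always absorbed by passing from the kernel at time t to the kernel at time 2t, whose
  mass is again one. Smallness of the data enters through the decaying solution that it provides,
  which agrees with u by uniqueness.\<close>

lemma sigma_finite_lebesgue: "sigma_finite_measure (lebesgue :: 'a::euclidean_space measure)"
proof
  obtain A :: "'a set set" where "countable A" "A \<subseteq> sets lborel" "\<Union>A = space lborel"
      "\<forall>a\<in>A. emeasure lborel a \<noteq> \<infinity>"
    using lborel.sigma_finite_countable by blast
  then show "\<exists>A::'a set set. countable A \<and> A \<subseteq> sets lebesgue \<and> \<Union>A = space lebesgue \<and>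
      (\<forall>a\<in>A. emeasure lebesgue a \<noteq> \<infinity>)"
    by (intro exI[of _ A]) (auto simp: subset_iff)
qed

lemma borel_measurable_lebesgueI: "g \<in> borel_measurable borel \<Longrightarrow> g \<in> borel_measurable lebesgue"
  by (rule measurable_completion) simp

section \<open>Mass and integrability of the kernel\<close>

lemma gauss_nonneg [simp]: "0 \<le> gauss t x"
  by (simp add: gauss_def)

lemma gauss_minus_commute: "gauss t (x - y) = gauss t (y - x)"
  by (simp add: gauss_def norm_minus_commute)

lemma borel_measurable_gauss [measurable]: "gauss t \<in> borel_measurable borel"
  unfolding gauss_def[abs_def] by measurable

lemma gauss_le:
  fixes x :: "real ^ 'n"
  shows "t > 0 \<Longrightarrow> gauss t x \<le> (4 * pi * t) powr (- real CARD('n) / 2)"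
  unfolding gauss_def by (intro mult_left_le) (auto simp: divide_nonpos_pos)

lemma powr_minus_half_power:
  fixes z :: real assumes "z > 0"
  shows "z powr (- real n / 2) = (1 / sqrt z) ^ n"
proof -
  have "z powr (- real n / 2) = (z powr (- 1 / 2)) powr real n"
    by (simp add: powr_powr)
  also have "z powr (- 1 / 2) = 1 / sqrt z"
    using assms by (simp add: powr_minus_divide powr_half_sqrt)
  finally show ?thesis using assms by (simp add: powr_realpow)
qed

text \<open>Variance \<open>2 * t\<close> matches the denominator \<open>4 * t\<close> in the
  exponent: the kernel is a tensor product of one-dimensional normal densities, so its mass can be
  computed one coordinate at a time.\<close>

lemma gauss_eq_prod:
  fixes x :: "real ^ 'n" assumes "t > 0"
  shows "gauss t x = (\<Prod>b\<in>Basis. normal_density 0 (sqrt (2 * t)) (x \<bullet> b))"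
proof -
  have *: "normal_density 0 (sqrt (2 * t)) y = (1 / sqrt (4 * pi * t)) * exp (- y\<^sup>2 / (4 * t))" for y
    using assms by (simp add: normal_density_def mult_ac)
  have "(\<Prod>b\<in>(Basis::(real^'n) set). normal_density 0 (sqrt (2 * t)) (x \<bullet> b))
      = (1 / sqrt (4 * pi * t)) ^ CARD('n) * exp (\<Sum>b\<in>Basis. - (x \<bullet> b)\<^sup>2 / (4 * t))"
    unfolding * prod.distrib by (simp add: exp_sum)
  also have "(\<Sum>b\<in>Basis. - (x \<bullet> b)\<^sup>2 / (4 * t)) = - (norm x)\<^sup>2 / (4 * t)"
    by (simp add: sum_divide_distrib[symmetric] sum_negf power2_norm_eq_inner
        euclidean_inner[of x x]) (simp add: power2_eq_square)
  finally show ?thesis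
    unfolding gauss_def using assms by (subst powr_minus_half_power) auto
qed

lemma nn_integral_gauss:
  assumes "t > 0"
  shows "(\<integral>\<^sup>+ x. ennreal (gauss t (x :: real ^ 'n)) \<partial>lebesgue) = 1"
proof -
  have 1: "(\<integral>\<^sup>+ y. ennreal (normal_density 0 (sqrt (2 * t)) y) \<partial>lborel) = 1"
    using assms by (subst nn_integral_eq_integral) auto
  have "(\<integral>\<^sup>+ x. ennreal (gauss t (x :: real ^ 'n)) \<partial>lebesgue)
      = (\<integral>\<^sup>+ x. (\<Prod>b\<in>Basis. ennreal (normal_density 0 (sqrt (2 * t)) ((x :: real ^ 'n) \<bullet> b))) \<partial>lborel)"
    using assms by (simp add: nn_integral_completion gauss_eq_prod prod_ennreal)
  also have "\<dots> = 1"
    using assms by (subst nn_integral_lborel_prod) (auto simp: 1)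
  finally show ?thesis .
qed

lemma nn_integral_gauss_shift:
  fixes y :: "real ^ 'n" assumes "t > 0"
  shows "(\<integral>\<^sup>+ x. ennreal (gauss t (x - y)) \<partial>lebesgue) = 1"
proof -
  have "(\<integral>\<^sup>+ x. ennreal (gauss t x) \<partial>distr lborel borel ((+) (- y))) =
      (\<integral>\<^sup>+ x. ennreal (gauss t (- y + x)) \<partial>lborel)"
    by (subst nn_integral_distr) auto
  then show ?thesis
    using nn_integral_gauss[OF assms, where 'n='n]
    by (simp add: nn_integral_completion lborel_distr_plus)
qed

lemma integrable_gauss_shift:
  fixes y :: "real ^ 'n" assumes "t > 0"
  shows "integrable lebesgue (\<lambda>x. gauss t (x - y))" "(\<integral>x. gauss t (x - y) \<partial>lebesgue) = 1"
proof -
  have m: "(\<lambda>x. gauss t (x - y)) \<in> borel_measurable lebesgue"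
    by (intro borel_measurable_lebesgueI) measurable
  show "integrable lebesgue (\<lambda>x. gauss t (x - y))"
    using nn_integral_gauss_shift[OF assms, of y] m by (intro integrableI_nonneg) auto
  show "(\<integral>x. gauss t (x - y) \<partial>lebesgue) = 1"
    using nn_integral_gauss_shift[OF assms, of y] m by (subst integral_eq_nn_integral) auto
qed

section \<open>Pointwise kernel estimates up to a doubling of time\<close>

text \<open>Completing the square: the exponents differ by \<open>(a - 12)\<^sup>2 / 8\<close>,
  whence \<open>19 = 18 + 1\<close>. The growth \<open>exp (3 * a + 1)\<close> is the largest factor
  that the Taylor estimate of the kernel produces.\<close>

lemma exp_quadratic_le:
  fixes a :: real
  shows "exp (3 * a + 1) * exp (- a\<^sup>2 / 4) \<le> exp 19 * exp (- a\<^sup>2 / 8)"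
proof -
  have "0 \<le> (a - 12)\<^sup>2" by simp
  then have "(3 * a + 1) + (- a\<^sup>2 / 4) \<le> 19 + (- a\<^sup>2 / 8)"
    by (simp add: power2_eq_square field_simps)
  then show ?thesis by (simp only: exp_add[symmetric] exp_le_cancel_iff)
qed

text \<open>All kernels are compared in the scaled variable \<open>norm x / sqrt t\<close>. The
  cases that occur are \<open>c = 1\<close>, \<open>c = 2\<close> and
  \<open>c = 1 - s / t\<close>.\<close>

lemma gauss_rescale:
  fixes x :: "real ^ 'n" assumes "t > 0" "c > 0"
  shows "gauss (c * t) x = c powr (- real CARD('n) / 2) * (4 * pi * t) powr (- real CARD('n) / 2)
           * exp (- (norm x / sqrt t)\<^sup>2 / (4 * c))"
  using assms unfolding gauss_def
  by (simp add: powr_mult[symmetric] power_divide mult_ac)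

lemma gauss_eq_scaled:
  fixes x :: "real ^ 'n" assumes "t > 0"
  shows "gauss t x = (4 * pi * t) powr (- real CARD('n) / 2) * exp (- (norm x / sqrt t)\<^sup>2 / 4)"
  using gauss_rescale[of t 1 x] assms by simp

text \<open>At time \<open>2 * t\<close> the Gaussian decays half as fast in the exponent, which
  leaves room for an exponential factor; 2^(n/2) is the quotient of the normalising factors.\<close>

lemma exp_gauss_le:
  fixes x :: "real ^ 'n" assumes "t > 0"
  shows "exp (3 * (norm x / sqrt t) + 1) * gauss t x
           \<le> exp 19 * 2 powr (real CARD('n) / 2) * gauss (2 * t) x"
proof -
  have "exp (3 * (norm x / sqrt t) + 1) * gauss t x
      \<le> (4 * pi * t) powr (- real CARD('n) / 2) * (exp 19 * exp (- (norm x / sqrt t)\<^sup>2 / 8))"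
    unfolding gauss_eq_scaled[OF assms]
    using mult_left_mono[OF exp_quadratic_le[of "norm x / sqrt t"],
        of "(4 * pi * t) powr (- real CARD('n) / 2)"] by (simp add: mult_ac)
  also have "\<dots> = exp 19 * 2 powr (real CARD('n) / 2) * gauss (2 * t) x"
    using gauss_rescale[of t 2 x] assms by (simp add: powr_minus field_simps)
  finally show ?thesis .
qed

lemma one_plus_power_le_exp:
  fixes a :: real assumes "0 \<le> a" "k \<le> 2"
  shows "(1 + a) ^ k \<le> exp (2 * a)"
proof -
  have "(1 + a) ^ k \<le> (1 + a) ^ 2" using assms by (intro power_increasing) auto
  also have "\<dots> \<le> exp a ^ 2" using assms by (intro power_mono) auto
  finally show ?thesis by (simp add: exp_double)
qed

lemma polynomial_gauss_le:
  fixes x :: "real ^ 'n" assumes "t > 0" "k \<le> 2"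
  shows "(1 + norm x / sqrt t) ^ k * gauss t x
           \<le> exp 19 * 2 powr (real CARD('n) / 2) * gauss (2 * t) x"
proof -
  have "(1 + norm x / sqrt t) ^ k \<le> exp (2 * (norm x / sqrt t))"
    using assms by (intro one_plus_power_le_exp) auto
  also have "\<dots> \<le> exp (3 * (norm x / sqrt t) + 1)"
  proof -
    have "0 \<le> norm x / sqrt t" using assms by simp
    then show ?thesis by (subst exp_le_cancel_iff) linarith
  qed
  finally show ?thesis
    by (intro order_trans[OF mult_right_mono exp_gauss_le]) (use assms in auto)
qed

text \<open>The quotient of the two kernels differs from one by at most a multiple of
  \<open>s / t\<close> times a quadratic polynomial in \<open>norm x / sqrt t\<close>, which the
  kernel at time \<open>2 * t\<close> absorbs. The restriction \<open>s \<le> t / 2\<close> keeps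
  \<open>1 - s / t\<close> away from zero.\<close>

lemma gauss_time_diff_le:
  "\<exists>C>0. \<forall>t>0. \<forall>s\<in>{0..t / 2}. \<forall>x :: real ^ 'n.
     \<bar>gauss (t - s) x - gauss t x\<bar> \<le> C * (s / t) * gauss (2 * t) x"
proof -
  define n where "n = real CARD('n)"
  define C where "C = exp n * (n + 1) * (exp 19 * 2 powr (n / 2))"
  have n0: "n > 0" by (simp add: n_def)
  have "\<bar>gauss (t - s) x - gauss t x\<bar> \<le> C * (s / t) * gauss (2 * t) x"
    if t: "t > 0" and s: "s \<in> {0..t/2}" for t s and x :: "real ^ 'n"
  proof -
    define r where "r = s / t"
    define a where "a = norm x / sqrt t"
    \<comment> \<open>\<open>A\<close> is the quotient of the normalising factors at times
      \<open>t - s\<close> and \<open>t\<close>, and \<open>z\<close> is the difference of the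
      exponents, so the kernels have quotient \<open>A * exp (- z)\<close>.\<close>
    define A where "A = (1 - r) powr (- n / 2)"
    define z where "z = a\<^sup>2 / (4 * (1 - r)) - a\<^sup>2 / 4"
    have r: "0 \<le> r" "r \<le> 1 / 2" using t s by (auto simp: r_def field_simps)
    have a0: "0 \<le> a" using t by (simp add: a_def)
    have z0: "0 \<le> z" unfolding z_def using r
      by (auto simp: field_simps intro!: mult_right_mono)
    have "z = a\<^sup>2 * r / (4 * (1 - r))" unfolding z_def using r by (simp add: field_simps)
    also have "\<dots> \<le> a\<^sup>2 * r / 2" using r by (intro divide_left_mono) auto
    finally have z1: "z \<le> a\<^sup>2 * r / 2" .
    \<comment> \<open>This is ln y \<le> y - 1 at y = 1 / (1 - r); with \<open>r \<le> 1 / 2\<close>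
      it bounds the exponent of \<open>A\<close> linearly in \<open>r\<close>.\<close>
    have "ln (1 - r) \<ge> 1 - 1 / (1 - r)"
      using ln_le_minus_one[of "1 / (1 - r)"] r by (simp add: ln_div)
    moreover have "1 - 1 / (1 - r) \<ge> - 2 * r"
      using r by (simp add: field_simps) (use mult_left_mono[of r "1/2" r] in simp)
    ultimately have l: "- ln (1 - r) \<le> 2 * r" by simp
    have "A = exp (n / 2 * (- ln (1 - r)))" using r by (simp add: A_def powr_def)
    also have "\<dots> \<le> exp (n / 2 * (2 * r))" using l n0
      by (subst exp_le_cancel_iff, intro mult_left_mono) auto
    finally have A1: "A \<le> exp (n * r)" by simp
    have nr: "exp (n * r) \<le> exp n" using r n0 by (simp add: mult_left_le)
    \<comment> \<open>The tangent of exp at zero supplies the factor \<open>r\<close>;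
      multiplication by \<open>exp (n * r)\<close> turns this into a linear bound for
      \<open>exp (n * r) - 1\<close>, hence for \<open>A - 1\<close>.\<close>
    have "1 - exp (- (n * r)) \<le> n * r" using exp_ge_add_one_self[of "- (n * r)"] by linarith
    then have "exp (n * r) * (1 - exp (- (n * r))) \<le> exp (n * r) * (n * r)"
      by (intro mult_left_mono) auto
    then have "exp (n * r) - 1 \<le> exp (n * r) * (n * r)"
      by (simp add: right_diff_distrib exp_minus)
    also have "\<dots> \<le> exp n * (n * r)" using nr r n0 by (intro mult_right_mono) auto
    finally have A2: "A - 1 \<le> exp n * (n * r)" using A1 by linarith
    have A3: "1 \<le> A" unfolding A_def using r n0
      by (simp add: powr_def) (simp add: mult_nonneg_nonpos)
    have ez: "1 - exp (- z) \<le> a\<^sup>2 * r / 2" "exp (- z) \<le> 1"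
      using exp_ge_add_one_self[of "- z"] z0 z1 by (auto simp del: exp_ge_add_one_self)
    have "\<bar>A * exp (- z) - 1\<bar> \<le> A * (1 - exp (- z)) + (A - 1)"
    proof -
      have "A * exp (- z) - 1 = - (A * (1 - exp (- z))) + (A - 1)" by (simp add: algebra_simps)
      moreover have "0 \<le> A * (1 - exp (- z))" using A3 ez by simp
      ultimately show ?thesis using A3 by linarith
    qed
    also have "\<dots> \<le> exp n * (a\<^sup>2 * r / 2) + exp n * (n * r)"
      using order_trans[OF A1 nr] ez A2 A3 z0 by (intro add_mono mult_mono) auto
    also have "\<dots> = exp n * r * (a\<^sup>2 / 2 + n)" by (simp add: algebra_simps)
    also have "\<dots> \<le> exp n * r * ((n + 1) * (1 + a)\<^sup>2)"
    proof -
      have "a\<^sup>2 / 2 + n \<le> (1 + a)\<^sup>2 + n * (1 + a)\<^sup>2"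
        using a0 n0 by (intro add_mono) (auto simp: power2_eq_square algebra_simps)
      then show ?thesis using r by (intro mult_left_mono) (auto simp: algebra_simps)
    qed
    finally have m: "\<bar>A * exp (- z) - 1\<bar> \<le> exp n * (n + 1) * r * (1 + a)\<^sup>2" by (simp add: mult_ac)
    have ts: "t - s = (1 - r) * t" using t by (simp add: r_def field_simps)
    have "exp (- a\<^sup>2 / (4 * (1 - r))) = exp (- a\<^sup>2 / 4) * exp (- z)"
      unfolding z_def by (simp add: exp_add[symmetric])
    then have "gauss (t - s) x = A * exp (- z) * gauss t x"
      unfolding ts using gauss_rescale[of t "1 - r" x] gauss_eq_scaled[OF t, of x] r t
      by (simp add: A_def a_def n_def mult_ac)
    then have "\<bar>gauss (t - s) x - gauss t x\<bar> = \<bar>A * exp (- z) - 1\<bar> * gauss t x"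
      by (metis abs_mult abs_of_nonneg gauss_nonneg left_diff_distrib mult_1)
    also have "\<dots> \<le> exp n * (n + 1) * r * ((1 + a)\<^sup>2 * gauss t x)"
      using mult_right_mono[OF m, of "gauss t x"] by (simp add: mult_ac)
    also have "\<dots> \<le> exp n * (n + 1) * r * (exp 19 * 2 powr (n / 2) * gauss (2 * t) x)"
      using polynomial_gauss_le[of t 2 x] t r n0 unfolding a_def n_def by (intro mult_left_mono) auto
    finally show ?thesis by (simp add: C_def r_def mult_ac)
  qed
  moreover have "C > 0" using n0 by (simp add: C_def)
  ultimately show ?thesis by blast
qed

lemma exp_remainder_le:
  fixes z :: real
  shows "\<bar>exp z - 1\<bar> \<le> \<bar>z\<bar> * exp \<bar>z\<bar>" "\<bar>exp z - 1 - z\<bar> \<le> z\<^sup>2 * exp \<bar>z\<bar>"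
proof -
  obtain s where "\<bar>s\<bar> \<le> \<bar>z\<bar>" "exp z = (\<Sum>m<1. z ^ m / fact m) + exp s / fact 1 * z ^ 1"
    using Maclaurin_exp_le[of z 1] by blast
  then have "exp z - 1 = exp s * z" "\<bar>s\<bar> \<le> \<bar>z\<bar>" by auto
  then show "\<bar>exp z - 1\<bar> \<le> \<bar>z\<bar> * exp \<bar>z\<bar>"
    by (auto simp: abs_mult mult.commute intro!: mult_left_mono)
  obtain s where "\<bar>s\<bar> \<le> \<bar>z\<bar>" "exp z = (\<Sum>m<2. z ^ m / fact m) + exp s / fact 2 * z ^ 2"
    using Maclaurin_exp_le[of z 2] by blast
  then have s: "exp z - 1 - z = exp s / 2 * z\<^sup>2" "\<bar>s\<bar> \<le> \<bar>z\<bar>" by (auto simp: numeral_2_eq_2)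
  have "\<bar>exp z - 1 - z\<bar> = exp s / 2 * z\<^sup>2" unfolding s by (simp add: abs_mult)
  also have "\<dots> \<le> exp \<bar>z\<bar> * z\<^sup>2"
  proof (intro mult_right_mono)
    have "exp s / 2 \<le> exp s" by simp
    also have "\<dots> \<le> exp \<bar>z\<bar>" using s by auto
    finally show "exp s / 2 \<le> exp \<bar>z\<bar>" .
  qed simp
  finally show "\<bar>exp z - 1 - z\<bar> \<le> z\<^sup>2 * exp \<bar>z\<bar>" by (simp add: mult.commute)
qed

text \<open>The term with \<open>gauss t (x - y)\<close> on the right-hand side takes care of \<open>\<bar>y\<bar> > \<surd>t\<close>, where the
  left-hand side is estimated term by term; it makes an integral remainder unnecessary.\<close>

lemma gauss_taylor_le:
  assumes k: "k = 1 \<or> k = 2"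
  shows "\<exists>C>0. \<forall>t>0. \<forall>x y :: real ^ 'n.
     \<bar>gauss t (x - y) - gauss t x - (if k = 2 then (x \<bullet> y) / (2 * t) * gauss t x else 0)\<bar>
       \<le> C * (norm y / sqrt t) ^ k * (gauss (2 * t) x + gauss t (x - y))"
proof -
  define D where "D = exp 19 * 2 powr (real CARD('n) / 2)"
  have D1: "1 \<le> D"
    unfolding D_def using mult_mono[of 1 "exp 19" 1 "2 powr (real CARD('n) / 2)"]
    by (simp add: ge_one_powr_ge_zero)
  have "\<bar>gauss t (x - y) - gauss t x - (if k = 2 then (x \<bullet> y) / (2 * t) * gauss t x else 0)\<bar>
       \<le> 2 * D * (norm y / sqrt t) ^ k * (gauss (2 * t) x + gauss t (x - y))"
    if t: "t > 0" for t and x y :: "real ^ 'n"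
  proof -
    define a where "a = norm x / sqrt t"
    define b where "b = norm y / sqrt t"
    define d where "d = (x \<bullet> y) / t"
    \<comment> \<open>Expanding the square of \<open>norm (x - y)\<close> gives
      \<open>gauss t (x - y) = gauss t x * exp z\<close>. The part of \<open>z\<close> linear in
      \<open>y\<close> is \<open>d / 2\<close>, and \<open>l\<close> retains it only for
      \<open>k = 2\<close>.\<close>
    define z where "z = d / 2 - b\<^sup>2 / 4"
    define l where "l = (if k = 2 then d / 2 else 0)"
    have ab: "0 \<le> a" "0 \<le> b" using t by (auto simp: a_def b_def)
    have "\<bar>x \<bullet> y\<bar> \<le> norm x * norm y" by (rule Cauchy_Schwarz_ineq2)
    then have d: "\<bar>d\<bar> \<le> a * b" using t
      by (simp add: d_def a_def b_def divide_right_mono)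
    have g0: "0 \<le> gauss t x" by simp
    have lk: "(if k = 2 then (x \<bullet> y) / (2 * t) * gauss t x else 0) = l * gauss t x"
      by (simp add: l_def d_def)
    show ?thesis
    proof (cases "b \<le> 1")
      case True
      have "(norm (x - y))\<^sup>2 = (norm x)\<^sup>2 + (norm y)\<^sup>2 - 2 * (x \<bullet> y)"
        by (simp add: power2_norm_eq_inner algebra_simps inner_commute)
      then have "- (norm (x - y))\<^sup>2 / (4 * t) = - (norm x)\<^sup>2 / (4 * t) + z"
        using t by (simp add: z_def d_def b_def power_divide) (simp add: field_simps)
      then have e: "gauss t (x - y) = gauss t x * exp z"
        by (simp only: gauss_def exp_add mult.assoc)
      \<comment> \<open>Two bounds on \<open>z\<close> are extracted for \<open>b \<le> 1\<close>:
        \<open>b * (1 + a)\<close>, which supplies the powers of \<open>b\<close>, and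
        \<open>1 + a\<close>, which is free of \<open>y\<close> and controls the exponential in the
        remainder.\<close>
      have b2: "b\<^sup>2 \<le> b" using True ab by (simp add: power2_eq_square mult_left_le)
      have "\<bar>z\<bar> \<le> \<bar>d\<bar> / 2 + b\<^sup>2 / 4"
        using abs_triangle_ineq4[of "d / 2" "b\<^sup>2 / 4"] by (simp add: z_def)
      also have "\<dots> \<le> a * b / 2 + b / 4" using d b2 by simp
      also have "\<dots> \<le> b * (1 + a)" 
      proof -
        have "0 \<le> a * b" using ab by simp
        moreover have "b * (1 + a) = b + a * b" by (simp add: algebra_simps)
        ultimately show ?thesis using ab by linarith
      qed
      finally have z1: "\<bar>z\<bar> \<le> b * (1 + a)" .
      have "b * (1 + a) \<le> 1 * (1 + a)" using True ab by (intro mult_right_mono) auto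
      then have z2: "\<bar>z\<bar> \<le> 1 + a" using z1 by simp
      have "\<bar>exp z - 1 - l\<bar> \<le> 2 * b ^ k * exp (3 * a + 1)"
        using k
      proof
        assume "k = 1"
        then have "\<bar>exp z - 1 - l\<bar> \<le> \<bar>z\<bar> * exp \<bar>z\<bar>" using exp_remainder_le(1)[of z] by (simp add: l_def)
        also have "\<dots> \<le> (b * (1 + a)) * exp (1 + a)"
          using z1 z2 ab by (intro mult_mono) auto
        also have "\<dots> \<le> (b * exp a) * exp (1 + a)"
          using ab by (intro mult_right_mono mult_left_mono) auto
        also have "\<dots> = b * exp (2 * a + 1)" by (simp add: exp_add[symmetric] mult.assoc)
        also have "\<dots> \<le> (2 * b) * exp (3 * a + 1)" using ab by (intro mult_mono) auto
        finally show ?thesis using \<open>k = 1\<close> by simp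
      next
        assume "k = 2"
        \<comment> \<open>Replacing \<open>l\<close> by \<open>z\<close> costs only the quadratic
          term \<open>b\<^sup>2 / 4\<close>, which is already of the admissible order.\<close>
        have "\<bar>exp z - 1 - l\<bar> \<le> \<bar>exp z - 1 - z\<bar> + b\<^sup>2 / 4"
          using abs_triangle_ineq4[of "exp z - 1 - z" "b\<^sup>2 / 4"] \<open>k = 2\<close> by (simp add: l_def z_def)
        also have "\<dots> \<le> z\<^sup>2 * exp \<bar>z\<bar> + b\<^sup>2 / 4" using exp_remainder_le(2)[of z] by simp
        also have "\<dots> \<le> (b * (1 + a))\<^sup>2 * exp (1 + a) + b\<^sup>2 / 4"
          using z1 z2 ab by (intro add_mono mult_mono) (auto simp: abs_le_square_iff[symmetric])
        also have "\<dots> \<le> (b * exp a)\<^sup>2 * exp (1 + a) + b\<^sup>2 * exp (3 * a + 1)"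
        proof (intro add_mono mult_right_mono power_mono mult_left_mono)
          have "b\<^sup>2 / 4 \<le> b\<^sup>2 * 1" by simp
          also have "\<dots> \<le> b\<^sup>2 * exp (3 * a + 1)" using ab by (intro mult_left_mono) auto
          finally show "b\<^sup>2 / 4 \<le> b\<^sup>2 * exp (3 * a + 1)" .
        qed (use ab in auto)
        also have "(b * exp a)\<^sup>2 * exp (1 + a) = b\<^sup>2 * (exp (2 * a) * exp (1 + a))"
          by (simp add: power_mult_distrib exp_double)
        also have "exp (2 * a) * exp (1 + a) = exp (3 * a + 1)" by (simp add: exp_add[symmetric])
        finally show ?thesis using \<open>k = 2\<close> by simp
      qed
      then have "\<bar>exp z - 1 - l\<bar> * gauss t x \<le> 2 * b ^ k * exp (3 * a + 1) * gauss t x"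
        by (rule mult_right_mono) simp
      also have "\<dots> = 2 * b ^ k * (exp (3 * a + 1) * gauss t x)" by (simp add: mult_ac)
      also have "\<dots> \<le> 2 * b ^ k * (D * gauss (2 * t) x)"
        unfolding a_def D_def using ab exp_gauss_le[OF t, of x]
        by (intro mult_left_mono) auto
      also have "\<dots> \<le> 2 * D * b ^ k * (gauss (2 * t) x + gauss t (x - y))"
        using ab D1 by (simp add: algebra_simps)
      finally have "\<bar>exp z - 1 - l\<bar> * gauss t x \<le> 2 * D * b ^ k * (gauss (2 * t) x + gauss t (x - y))" .
      moreover have "gauss t (x - y) - gauss t x - l * gauss t x = (exp z - 1 - l) * gauss t x"
        unfolding e by (simp add: algebra_simps)
      ultimately show ?thesis
        unfolding lk b_def by (simp add: abs_mult)
    next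
      case False
      then have b1: "1 \<le> b" by simp
      then have bk: "1 \<le> b ^ k" "b \<le> b ^ 2" by (auto simp: one_le_power power2_eq_square)
      have "1 + \<bar>l\<bar> \<le> b ^ k * (1 + a)"
      proof (cases "k = 2")
        case True
        have "\<bar>l\<bar> \<le> a * b" using d True by (simp add: l_def)
        also have "\<dots> \<le> a * b ^ 2" using ab bk by (intro mult_left_mono) auto
        finally show ?thesis using True bk by (simp add: algebra_simps)
      next
        case False
        then show ?thesis using ab bk mult_mono[of 1 "b ^ k" 1 "1 + a"] by (simp add: l_def)
      qed
      then have "(1 + \<bar>l\<bar>) * gauss t x \<le> b ^ k * ((1 + a) ^ 1 * gauss t x)"
        by (metis g0 mult.assoc mult_right_mono power_one_right)
      also have "\<dots> \<le> b ^ k * (D * gauss (2 * t) x)"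
        unfolding a_def D_def using ab polynomial_gauss_le[OF t, of 1 x] by (intro mult_left_mono) auto
      finally have 1: "(1 + \<bar>l\<bar>) * gauss t x \<le> b ^ k * (D * gauss (2 * t) x)" .
      have "gauss t (x - y) \<le> b ^ k * gauss t (x - y)"
        using mult_right_mono[OF bk(1), of "gauss t (x - y)"] by simp
      also have "\<dots> \<le> b ^ k * (D * gauss t (x - y))"
        using ab D1 mult_right_mono[of 1 D "gauss t (x - y)"] by (intro mult_left_mono) auto
      finally have 2: "gauss t (x - y) \<le> b ^ k * (D * gauss t (x - y))" .
      have "\<bar>gauss t (x - y) - gauss t x - l * gauss t x\<bar> \<le> gauss t (x - y) + (gauss t x + \<bar>l * gauss t x\<bar>)"
        using gauss_nonneg[of t x] gauss_nonneg[of t "x - y"] by linarith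
      also have "\<dots> = gauss t (x - y) + (1 + \<bar>l\<bar>) * gauss t x" by (simp add: abs_mult algebra_simps)
      also have "\<dots> \<le> b ^ k * (D * gauss t (x - y)) + b ^ k * (D * gauss (2 * t) x)"
        using 1 2 by (rule add_mono[rotated])
      also have "\<dots> \<le> 2 * D * b ^ k * (gauss (2 * t) x + gauss t (x - y))"
        using ab D1 by (simp add: algebra_simps)
      finally show ?thesis unfolding lk by (simp add: b_def)
    qed
  qed
  then show ?thesis using D1 by (intro exI[of _ "2 * D"]) auto
qed

section \<open>Norms and the heat semigroup\<close>

lemma Lnorm_1: "g \<in> borel_measurable lebesgue \<Longrightarrow> Lnorm 1 g = (\<integral>\<^sup>+ x. ennreal \<bar>g x\<bar> \<partial>lebesgue)"
  by (auto simp: Lnorm_def Let_def less_top[symmetric])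

lemma Lspace_1_iff: "g \<in> Lspace 1 \<longleftrightarrow> integrable lebesgue g"
  by (auto simp: Lspace_def Lnorm_1 integrable_iff_bounded)

lemma Lnorm_1_integrable:
  "integrable lebesgue g \<Longrightarrow> Lnorm 1 g = ennreal (\<integral> x. \<bar>g x\<bar> \<partial>lebesgue)"
  by (subst Lnorm_1) (auto intro: nn_integral_eq_integral)

lemma Lnorm_top_leI:
  assumes "g \<in> borel_measurable lebesgue" "AE x in lebesgue. \<bar>g x\<bar> \<le> B"
  shows "Lnorm \<infinity> g \<le> ennreal B"
proof -
  have "esssup lebesgue (\<lambda>x. ennreal \<bar>g x\<bar>) \<le> ennreal B"
    using assms by (intro esssup_I) (auto intro: ennreal_leI)
  with assms(1) show ?thesis by (simp add: Lnorm_def)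
qed

lemma Lnorm_top_leD:
  assumes "Lnorm \<infinity> g \<le> ennreal B" "0 \<le> B"
  shows "g \<in> borel_measurable lebesgue" "AE x in lebesgue. \<bar>g x\<bar> \<le> B"
proof -
  show m: "g \<in> borel_measurable lebesgue"
    using assms by (auto simp: Lnorm_def top_unique split: if_splits)
  then have "esssup lebesgue (\<lambda>x. ennreal \<bar>g x\<bar>) \<le> ennreal B"
    using assms by (simp add: Lnorm_def)
  with esssup_AE[where M=lebesgue and f="\<lambda>x. ennreal \<bar>g x\<bar>"] show "AE x in lebesgue. \<bar>g x\<bar> \<le> B"
    using assms(2) by (auto elim!: eventually_mono simp: ennreal_le_iff[symmetric] simp del: ennreal_le_iff)
qed

text \<open>For finite \<open>q\<close>, integrate |g|^q \<le> B^(q-1) |g|. Since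
  \<open>1 / \<infinity> = 0\<close>, the same formula covers \<open>q = \<infinity>\<close>, where
  it reads \<open>B\<close>; there \<open>0 < A\<close> ensures \<open>A powr 0 = 1\<close>.\<close>

lemma Lnorm_interpolation:
  assumes q: "1 \<le> q" and g: "integrable lebesgue g" and A: "(\<integral> x. \<bar>g x\<bar> \<partial>lebesgue) \<le> A" "0 < A"
    and B: "AE x in lebesgue. \<bar>g x\<bar> \<le> B" "0 < B"
  shows "Lnorm q g \<le> ennreal (A powr enn2real (1 / q) * B powr (1 - enn2real (1 / q)))"
proof (cases "q = \<infinity>")
  case True
  then show ?thesis using Lnorm_top_leI[OF _ B(1)] g A B by auto
next
  case False
  then obtain r where r: "q = ennreal r" "0 \<le> r" by (cases q) auto
  then have r1: "1 \<le> r" using q by (simp add: ennreal_1[symmetric] del: ennreal_1)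
  have "1 / q = ennreal (1 / r)" using r r1
    by (simp add: ennreal_1[symmetric] divide_ennreal del: ennreal_1)
  then have e: "enn2real (1 / q) = 1 / r" using r1 by simp
  let ?I = "\<integral>\<^sup>+ x. ennreal (\<bar>g x\<bar> powr r) \<partial>lebesgue"
  have "?I \<le> (\<integral>\<^sup>+ x. ennreal (B powr (r - 1)) * ennreal \<bar>g x\<bar> \<partial>lebesgue)"
  proof (intro nn_integral_mono_AE, use B(1) in \<open>elim eventually_mono\<close>)
    fix x assume "\<bar>g x\<bar> \<le> B"
    then have "\<bar>g x\<bar> powr (r - 1) * \<bar>g x\<bar> \<le> B powr (r - 1) * \<bar>g x\<bar>"
      using r1 by (intro mult_right_mono powr_mono2) auto
    moreover have "\<bar>g x\<bar> powr (r - 1) * \<bar>g x\<bar> = \<bar>g x\<bar> powr r"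
      by (cases "g x = 0") (auto simp: powr_diff)
    ultimately show "ennreal (\<bar>g x\<bar> powr r) \<le> ennreal (B powr (r - 1)) * ennreal \<bar>g x\<bar>"
      by (simp add: ennreal_mult[symmetric] ennreal_leI)
  qed
  also have "\<dots> = ennreal (B powr (r - 1)) * ennreal (\<integral> x. \<bar>g x\<bar> \<partial>lebesgue)"
    using g by (subst nn_integral_cmult) (auto simp: nn_integral_eq_integral)
  also have "\<dots> \<le> ennreal (B powr (r - 1) * A)"
    using A by (simp add: ennreal_mult[symmetric] ennreal_leI mult_left_mono)
  finally have I: "?I \<le> ennreal (B powr (r - 1) * A)" .
  then have fin: "?I \<noteq> \<infinity>" by (auto simp: top_unique)
  have "enn2real ?I \<le> B powr (r - 1) * A"
    using I A by (simp add: enn2real_leI)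
  then have "enn2real ?I powr (1 / r) \<le> (B powr (r - 1) * A) powr (1 / r)"
    using r1 by (intro powr_mono2) auto
  also have "\<dots> = A powr (1 / r) * B powr (1 - 1 / r)"
    using A B r1 by (simp add: powr_mult powr_powr diff_divide_distrib)
  finally show ?thesis
    using g fin r e by (simp add: Lnorm_def Let_def False ennreal_leI)
qed

section \<open>Fubini, duality and contraction for the heat semigroup\<close>

lemma pair_sigma_finite_lebesgue:
  "pair_sigma_finite (lebesgue :: 'a::euclidean_space measure) (lebesgue :: 'b::euclidean_space measure)"
  by (intro pair_sigma_finite.intro sigma_finite_lebesgue)

lemma measurable_gauss_pair [measurable]:
  "(\<lambda>p. gauss t (fst p - snd p)) \<in> borel_measurable (lebesgue \<Otimes>\<^sub>M lebesgue)"
proof -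
  have i: "(\<lambda>x. x) \<in> measurable lebesgue borel" by (rule borel_measurable_lebesgueI) simp
  have [measurable]: "fst \<in> measurable (lebesgue \<Otimes>\<^sub>M lebesgue) borel"
    "snd \<in> measurable (lebesgue \<Otimes>\<^sub>M lebesgue) borel"
    using measurable_compose[OF measurable_fst i] measurable_compose[OF measurable_snd i] by auto
  show ?thesis by measurable
qed

lemma integrable_bounded_mult:
  fixes w g :: "'a \<Rightarrow> real"
  assumes "integrable M g" "w \<in> borel_measurable M" "\<And>x. \<bar>w x\<bar> \<le> B"
  shows "integrable M (\<lambda>x. w x * g x)"
proof (rule Bochner_Integration.integrable_bound)
  show "integrable M (\<lambda>x. B * g x)" using assms(1) by simp
  show "AE x in M. norm (w x * g x) \<le> norm (B * g x)"
    using order_trans[OF assms(3) abs_ge_self] by (intro AE_I2) (auto simp: abs_mult intro!: mult_right_mono)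
qed (use assms in measurable)

lemma integral_bounded_mult_le:
  fixes w g :: "'a \<Rightarrow> real"
  assumes "integrable M g" "\<And>x. \<bar>w x\<bar> \<le> B"
  shows "\<bar>\<integral> x. w x * g x \<partial>M\<bar> \<le> B * (\<integral> x. \<bar>g x\<bar> \<partial>M)"
proof -
  have "\<bar>\<integral> x. w x * g x \<partial>M\<bar> \<le> (\<integral> x. B * \<bar>g x\<bar> \<partial>M)"
    using assms order_trans[OF abs_ge_zero assms(2)]
    by (intro order_trans[OF integral_abs_bound] integral_mono')
      (auto simp: abs_mult intro!: mult_right_mono)
  then show ?thesis by simp
qed

lemma gauss_mult_integrable:
  fixes g :: "real ^ 'n \<Rightarrow> real"
  assumes t: "t > 0" and g: "integrable lebesgue g"
  shows "integrable lebesgue (\<lambda>y. gauss t (x - y) * g y)"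
  using g gauss_le[OF t]
  by (intro integrable_bounded_mult[where B="(4 * pi * t) powr (- real CARD('n) / 2)"]
      borel_measurable_lebesgueI) auto

lemma gauss_mult_integrable_bounded:
  fixes w :: "real ^ 'n \<Rightarrow> real"
  assumes t: "t > 0" and w: "w \<in> borel_measurable lebesgue" "\<And>x. \<bar>w x\<bar> \<le> B"
  shows "integrable lebesgue (\<lambda>y. gauss t (x - y) * w y)"
  using integrable_bounded_mult[OF integrable_gauss_shift(1)[OF t, of x] w]
  by (simp add: gauss_minus_commute mult.commute)

text \<open>Tonelli's theorem with the \<open>x\<close> integral inside: there the kernel has mass
  one, which leaves \<open>B * \<bar>g y\<bar>\<close>. This is the licence for Fubini's theorem in
  \<open>heat_pairing\<close>; with \<open>w = 1\<close> it gives integrability of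
  \<open>heat t g\<close>.\<close>

lemma heat_pair_integrable:
  fixes w g :: "real ^ 'n \<Rightarrow> real"
  assumes t: "t > 0" and g: "integrable lebesgue g"
    and w: "w \<in> borel_measurable lebesgue" "\<And>x. \<bar>w x\<bar> \<le> B"
  shows "integrable (lebesgue \<Otimes>\<^sub>M lebesgue) (\<lambda>(x, y). w x * (gauss t (x - y) * g y))"
proof -
  interpret pair_sigma_finite "lebesgue :: (real^'n) measure" "lebesgue :: (real^'n) measure"
    by (rule pair_sigma_finite_lebesgue)
  have [measurable]: "w \<in> borel_measurable lebesgue" "g \<in> borel_measurable lebesgue" using w g by auto
  have B0: "0 \<le> B" using w(2)[of 0] by linarith
  show ?thesis
  proof (rule integrableI_bounded)
    have "(\<integral>\<^sup>+ p. ennreal (norm (case p of (x, y) \<Rightarrow> w x * (gauss t (x - y) * g y))) \<partial>(lebesgue \<Otimes>\<^sub>M lebesgue))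
       \<le> (\<integral>\<^sup>+ p. ennreal (B * \<bar>g (snd p)\<bar> ) * ennreal (gauss t (fst p - snd p)) \<partial>(lebesgue \<Otimes>\<^sub>M lebesgue))"
    proof (intro nn_integral_mono, unfold split_beta ennreal_mult''[symmetric, OF gauss_nonneg] real_norm_def, intro ennreal_leI, goal_cases)
      case (1 p)
      have "\<bar>w (fst p)\<bar> * (gauss t (fst p - snd p) * \<bar>g (snd p)\<bar>) \<le> B * (gauss t (fst p - snd p) * \<bar>g (snd p)\<bar>)"
        using w(2) by (intro mult_right_mono) auto
      then show ?case
        by (simp add: abs_mult mult_ac)
    qed
    also have "\<dots> = (\<integral>\<^sup>+ y. (\<integral>\<^sup>+ x. ennreal (B * \<bar>g y\<bar> ) * ennreal (gauss t (x - y)) \<partial>lebesgue) \<partial>lebesgue)"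
      by (subst nn_integral_snd[symmetric]) (simp_all add: split_beta)
    also have "\<dots> = (\<integral>\<^sup>+ y. ennreal (B * \<bar>g y\<bar> ) \<partial>lebesgue)"
      by (subst nn_integral_cmult) (auto simp: nn_integral_gauss_shift[OF t] intro!: borel_measurable_lebesgueI)
    also have "\<dots> < \<infinity>"
      using g B0 by (subst nn_integral_eq_integral) auto
    finally show "(\<integral>\<^sup>+ p. ennreal (norm (case p of (x, y) \<Rightarrow> w x * (gauss t (x - y) * g y))) \<partial>(lebesgue \<Otimes>\<^sub>M lebesgue)) < \<infinity>" .
  qed (simp add: split_beta)
qed

lemma heat_0 [simp]: "heat 0 g = g"
  by (simp add: heat_def fun_eq_iff)

lemma integrable_heat [simp]:
  fixes g :: "real ^ 'n \<Rightarrow> real"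
  assumes g: "integrable lebesgue g"
  shows "integrable lebesgue (heat t g)"
proof (cases "t > 0")
  case True
  interpret pair_sigma_finite "lebesgue :: (real^'n) measure" "lebesgue :: (real^'n) measure"
    by (rule pair_sigma_finite_lebesgue)
  have "integrable lebesgue (\<lambda>x. \<integral> y. 1 * (gauss t (x - y) * g y) \<partial>lebesgue)"
    using heat_pair_integrable[OF True g, of "\<lambda>_. 1" 1]
    by (intro integrable_fst) (auto simp: split_beta)
  then show ?thesis using True by (simp add: heat_def[abs_def])
qed (use g in \<open>simp add: heat_def[abs_def]\<close>)

lemma borel_measurable_heat:
  fixes w :: "real ^ 'n \<Rightarrow> real"
  assumes [measurable]: "w \<in> borel_measurable lebesgue"
  shows "heat t w \<in> borel_measurable lebesgue"
proof -
  interpret pair_sigma_finite "lebesgue :: (real^'n) measure" "lebesgue :: (real^'n) measure"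
    by (rule pair_sigma_finite_lebesgue)
  have "(\<lambda>x. \<integral> y. gauss t (x - y) * w y \<partial>lebesgue) \<in> borel_measurable lebesgue"
    by (rule sigma_finite_measure.borel_measurable_lebesgue_integral[OF sigma_finite_lebesgue]) (simp add: split_beta)
  then show ?thesis by (simp add: heat_def[abs_def])
qed

lemma abs_heat_le:
  fixes w :: "real ^ 'n \<Rightarrow> real"
  assumes "\<And>x. \<bar>w x\<bar> \<le> B"
  shows "\<bar>heat t w y\<bar> \<le> B"
proof (cases "t > 0")
  case True
  have "\<bar>\<integral> x. w x * gauss t (x - y) \<partial>lebesgue\<bar> \<le> B * (\<integral> x. \<bar>gauss t (x - y)\<bar> \<partial>lebesgue)"
    using integrable_gauss_shift(1)[OF True] assms by (rule integral_bounded_mult_le)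
  then show ?thesis using True integrable_gauss_shift(2)[OF True, of y]
    by (simp add: heat_def gauss_minus_commute[of t y] mult.commute)
qed (use assms in \<open>simp add: heat_def\<close>)

text \<open>The kernel is symmetric, so by Fubini's theorem the semigroup is self-adjoint between
  L^1 and bounded functions. For \<open>t \<le> 0\<close> the operator is the identity.\<close>

lemma heat_pairing:
  fixes w g :: "real ^ 'n \<Rightarrow> real"
  assumes g: "integrable lebesgue g" and w: "w \<in> borel_measurable lebesgue" "\<And>x. \<bar>w x\<bar> \<le> B"
  shows "(\<integral> x. w x * heat t g x \<partial>lebesgue) = (\<integral> x. heat t w x * g x \<partial>lebesgue)"
proof (cases "t > 0")
  case True
  interpret pair_sigma_finite "lebesgue :: (real^'n) measure" "lebesgue :: (real^'n) measure"
    by (rule pair_sigma_finite_lebesgue)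
  have "(\<integral> x. w x * heat t g x \<partial>lebesgue)
      = (\<integral> x. (\<integral> y. w x * (gauss t (x - y) * g y) \<partial>lebesgue) \<partial>lebesgue)"
    using True by (simp add: heat_def)
  also have "\<dots> = (\<integral> y. (\<integral> x. w x * (gauss t (x - y) * g y) \<partial>lebesgue) \<partial>lebesgue)"
    using heat_pair_integrable[OF True g w] by (rule Fubini_integral[symmetric])
  also have "\<dots> = (\<integral> y. (\<integral> x. gauss t (y - x) * w x \<partial>lebesgue) * g y \<partial>lebesgue)"
    by (intro Bochner_Integration.integral_cong refl, subst integral_mult_left_zero[symmetric])
      (simp add: gauss_minus_commute mult_ac)
  finally show ?thesis using True by (simp add: heat_def)
qed (simp add: heat_def)

text \<open>Duality with the sign of \<open>heat t g\<close>: once moved to the sign function, the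
  semigroup preserves the bound \<open>1\<close>.\<close>

lemma integral_abs_heat_le:
  fixes g :: "real ^ 'n \<Rightarrow> real"
  assumes g: "integrable lebesgue g"
  shows "(\<integral> x. \<bar>heat t g x\<bar> \<partial>lebesgue) \<le> (\<integral> x. \<bar>g x\<bar> \<partial>lebesgue)"
proof -
  define w where "w = (\<lambda>x. sgn (heat t g x))"
  have w: "w \<in> borel_measurable lebesgue" "\<And>x. \<bar>w x\<bar> \<le> 1"
    using borel_measurable_integrable[OF integrable_heat[OF g, of t]] by (auto simp: w_def sgn_if)
  have "(\<integral> x. \<bar>heat t g x\<bar> \<partial>lebesgue) = (\<integral> x. w x * heat t g x \<partial>lebesgue)"
    by (simp add: w_def abs_sgn mult.commute)
  also have "\<dots> = (\<integral> x. heat t w x * g x \<partial>lebesgue)" by (rule heat_pairing[OF g w])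
  also have "\<dots> \<le> 1 * (\<integral> x. \<bar>g x\<bar> \<partial>lebesgue)"
    using integral_bounded_mult_le[OF g, of "heat t w" 1] abs_heat_le[of w 1 t, OF w(2)] by force
  finally show ?thesis by simp
qed

lemma abs_heat_le_integral:
  fixes g :: "real ^ 'n \<Rightarrow> real"
  assumes t: "t > 0" and g: "integrable lebesgue g"
  shows "\<bar>heat t g y\<bar> \<le> (4 * pi * t) powr (- real CARD('n) / 2) * (\<integral> x. \<bar>g x\<bar> \<partial>lebesgue)"
  unfolding heat_def using t gauss_le[OF t] by (auto intro!: integral_bounded_mult_le[OF g])

section \<open>Bochner integrals with values in \<open>L\<^sup>1\<close>\<close>

text \<open>The Riesz-Fischer argument: a subsequence with errors below 2^(-k) has summable
  increments almost everywhere, and Fatou's lemma upgrades its pointwise limit to a limit in mean of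
  the whole sequence. It produces the value of a Bochner integral from simple approximants.\<close>

lemma L1_complete:
  fixes F :: "nat \<Rightarrow> 'a \<Rightarrow> real"
  assumes F: "\<And>i. integrable M (F i)"
    and cauchy: "\<And>e. e > 0 \<Longrightarrow> \<exists>n. \<forall>i\<ge>n. \<forall>j\<ge>n. (\<integral> x. \<bar>F i x - F j x\<bar> \<partial>M) < e"
  obtains \<Psi> where "integrable M \<Psi>" "(\<lambda>i. \<integral> x. \<bar>F i x - \<Psi> x\<bar> \<partial>M) \<longlonglongrightarrow> 0"
proof -
  have [measurable]: "F i \<in> borel_measurable M" for i using F by auto
  have ex: "\<exists>n\<ge>m. \<forall>i\<ge>n. \<forall>j\<ge>n. (\<integral> x. \<bar>F i x - F j x\<bar> \<partial>M) < (1 / 2) ^ k" for m k :: nat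
  proof -
    obtain n where "\<forall>i\<ge>n. \<forall>j\<ge>n. (\<integral> x. \<bar>F i x - F j x\<bar> \<partial>M) < (1 / 2) ^ k"
      using cauchy[of "(1 / 2) ^ k"] by auto
    then show ?thesis by (intro exI[of _ "max m n"]) auto
  qed
  have "\<exists>r. \<forall>k. (\<forall>i\<ge>r k. \<forall>j\<ge>r k. (\<integral> x. \<bar>F i x - F j x\<bar> \<partial>M) < (1 / 2) ^ k) \<and> r k < r (Suc k)"
  proof (intro dependent_nat_choice)
    fix m k
    show "\<exists>n. (\<forall>i\<ge>n. \<forall>j\<ge>n. (\<integral> x. \<bar>F i x - F j x\<bar> \<partial>M) < (1 / 2) ^ Suc k) \<and> m < n"
      using ex[of "Suc m" "Suc k"] by (auto simp: Suc_le_eq)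
  qed (use ex[of 0 0] in blast)
  then obtain r where r: "\<And>k i j. i \<ge> r k \<Longrightarrow> j \<ge> r k \<Longrightarrow> (\<integral> x. \<bar>F i x - F j x\<bar> \<partial>M) < (1 / 2) ^ k"
    and rs: "\<And>k. r k < r (Suc k)" by blast
  have mono: "strict_mono r" using rs by (simp add: strict_mono_Suc_iff)
  define \<Psi> where "\<Psi> = (\<lambda>x. lim (\<lambda>k. F (r k) x))"
  have [measurable]: "\<Psi> \<in> borel_measurable M" unfolding \<Psi>_def by measurable
  define d where "d = (\<lambda>k x. F (r (Suc k)) x - F (r k) x)"
  have dint: "(\<integral>\<^sup>+ x. ennreal \<bar>d k x\<bar> \<partial>M) \<le> ennreal ((1 / 2) ^ k)" for k
  proof -
    have "(\<integral>\<^sup>+ x. ennreal \<bar>d k x\<bar> \<partial>M) = ennreal (\<integral> x. \<bar>d k x\<bar> \<partial>M)"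
      unfolding d_def using F by (intro nn_integral_eq_integral) auto
    also have "\<dots> \<le> ennreal ((1 / 2) ^ k)"
      unfolding d_def using r[of k "r (Suc k)" "r k"] rs[of k] by (intro ennreal_leI) auto
    finally show ?thesis .
  qed
  have "(\<integral>\<^sup>+ x. (\<Sum>k. ennreal \<bar>d k x\<bar>) \<partial>M) = (\<Sum>k. \<integral>\<^sup>+ x. ennreal \<bar>d k x\<bar> \<partial>M)"
    unfolding d_def by (intro nn_integral_suminf) auto
  also have "\<dots> \<le> (\<Sum>k. ennreal ((1 / 2) ^ k))" by (intro suminf_le dint) auto
  also have "\<dots> = ennreal (\<Sum>k. (1 / 2) ^ k)" by (intro suminf_ennreal_eq) auto
  finally have "(\<integral>\<^sup>+ x. (\<Sum>k. ennreal \<bar>d k x\<bar>) \<partial>M) \<noteq> \<infinity>" by (auto simp: top_unique)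
  then have "AE x in M. (\<Sum>k. ennreal \<bar>d k x\<bar>) \<noteq> \<infinity>"
    unfolding d_def by (intro nn_integral_noteq_infinite) auto
  then have conv: "AE x in M. (\<lambda>k. F (r k) x) \<longlonglongrightarrow> \<Psi> x"
  proof eventually_elim
    fix x assume "(\<Sum>k. ennreal \<bar>d k x\<bar>) \<noteq> \<infinity>"
    then have "summable (\<lambda>k. \<bar>d k x\<bar>)" by (intro summable_suminf_not_top) auto
    then have "summable (\<lambda>k. d k x)" by (rule summable_rabs_cancel)
    then have "(\<lambda>n. \<Sum>k<n. d k x) \<longlonglongrightarrow> (\<Sum>k. d k x)" by (rule summable_LIMSEQ)
    moreover have "(\<Sum>k<n. d k x) = F (r n) x - F (r 0) x" for n
      unfolding d_def by (rule sum_lessThan_telescope)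
    ultimately have "(\<lambda>n. F (r n) x - F (r 0) x) \<longlonglongrightarrow> (\<Sum>k. d k x)" by simp
    then have "(\<lambda>n. (F (r n) x - F (r 0) x) + F (r 0) x) \<longlonglongrightarrow> (\<Sum>k. d k x) + F (r 0) x"
      by (intro tendsto_intros)
    then show "(\<lambda>k. F (r k) x) \<longlonglongrightarrow> \<Psi> x"
      unfolding \<Psi>_def using convergentI convergent_LIMSEQ_iff by auto
  qed
  \<comment> \<open>Fatou's lemma along the subsequence: \<open>i\<close> is fixed and
    \<open>n\<close> tends to infinity in the distance between \<open>F i\<close> and
    \<open>F (r n)\<close>.\<close>
  have le: "(\<integral>\<^sup>+ x. ennreal \<bar>F i x - \<Psi> x\<bar> \<partial>M) \<le> ennreal ((1 / 2) ^ k)" if "i \<ge> r k" for i k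
  proof -
    have "(\<integral>\<^sup>+ x. ennreal \<bar>F i x - \<Psi> x\<bar> \<partial>M)
        = (\<integral>\<^sup>+ x. liminf (\<lambda>n. ennreal \<bar>F i x - F (r n) x\<bar>) \<partial>M)"
    proof (intro nn_integral_cong_AE, use conv in eventually_elim)
      fix x assume "(\<lambda>k. F (r k) x) \<longlonglongrightarrow> \<Psi> x"
      then have "(\<lambda>n. ennreal \<bar>F i x - F (r n) x\<bar>) \<longlonglongrightarrow> ennreal \<bar>F i x - \<Psi> x\<bar>"
        by (intro tendsto_intros) auto
      then show "ennreal \<bar>F i x - \<Psi> x\<bar> = liminf (\<lambda>n. ennreal \<bar>F i x - F (r n) x\<bar>)"
        by (intro lim_imp_Liminf[symmetric]) simp_all
    qed
    also have "\<dots> \<le> liminf (\<lambda>n. \<integral>\<^sup>+ x. ennreal \<bar>F i x - F (r n) x\<bar> \<partial>M)"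
      by (intro nn_integral_liminf) auto
    also have "\<dots> \<le> limsup (\<lambda>n. \<integral>\<^sup>+ x. ennreal \<bar>F i x - F (r n) x\<bar> \<partial>M)"
      by (intro Liminf_le_Limsup) auto
    also have "\<dots> \<le> ennreal ((1 / 2) ^ k)"
    proof (intro Limsup_bounded eventually_sequentiallyI[of k])
      fix n assume "k \<le> n"
      then have "r k \<le> r n" using mono by (simp add: strict_mono_less_eq)
      have "(\<integral>\<^sup>+ x. ennreal \<bar>F i x - F (r n) x\<bar> \<partial>M) = ennreal (\<integral> x. \<bar>F i x - F (r n) x\<bar> \<partial>M)"
        using F by (intro nn_integral_eq_integral) auto
      also have "\<dots> \<le> ennreal ((1 / 2) ^ k)"
        using r[OF that \<open>r k \<le> r n\<close>] by (intro ennreal_leI) auto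
      finally show "(\<integral>\<^sup>+ x. ennreal \<bar>F i x - F (r n) x\<bar> \<partial>M) \<le> ennreal ((1 / 2) ^ k)" .
    qed
    finally show ?thesis .
  qed
  have "integrable M (\<lambda>x. F (r 0) x - \<Psi> x)"
    using le[of 0 "r 0"] by (intro integrableI_bounded) (auto simp: less_top[symmetric] top_unique)
  from Bochner_Integration.integrable_diff[OF F[of "r 0"] this] have \<Psi>: "integrable M \<Psi>" by simp
  have le': "(\<integral> x. \<bar>F i x - \<Psi> x\<bar> \<partial>M) \<le> (1 / 2) ^ k" if "i \<ge> r k" for i k
  proof -
    have "ennreal (\<integral> x. \<bar>F i x - \<Psi> x\<bar> \<partial>M) = (\<integral>\<^sup>+ x. ennreal \<bar>F i x - \<Psi> x\<bar> \<partial>M)"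
      using F \<Psi> by (intro nn_integral_eq_integral[symmetric]) auto
    with le[OF that] have "ennreal (\<integral> x. \<bar>F i x - \<Psi> x\<bar> \<partial>M) \<le> ennreal ((1 / 2) ^ k)" by metis
    then show ?thesis by (subst (asm) ennreal_le_iff) auto
  qed
  have "(\<lambda>i. \<integral> x. \<bar>F i x - \<Psi> x\<bar> \<partial>M) \<longlonglongrightarrow> 0"
  proof (rule LIMSEQ_I)
    fix e :: real assume "e > 0"
    then obtain k where k: "(1 / 2) ^ k < e" using real_arch_pow_inv[of e "1/2"] by auto
    show "\<exists>no. \<forall>n\<ge>no. norm ((\<integral> x. \<bar>F n x - \<Psi> x\<bar> \<partial>M) - 0) < e"
      using le'[of k] k by (intro exI[of _ "r k"]) (auto intro: le_less_trans)
  qed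
  with \<Psi> show thesis by (rule that)
qed

section \<open>Pairing a Bochner integral with a bounded function\<close>

lemma indicator_lebesgue_on:
  assumes "J \<in> sets lebesgue" "A \<in> lmeasurable" "A \<subseteq> J"
  shows "integrable (lebesgue_on J) (indicator A :: _ \<Rightarrow> real)"
    "(\<integral> s. indicator A s \<partial>lebesgue_on J) = measure lebesgue A"
proof -
  have A: "A \<in> sets (lebesgue_on J)"
    using assms by (auto simp: sets_restrict_space_iff fmeasurable_def)
  moreover have "emeasure (lebesgue_on J) A < \<infinity>"
    using assms by (subst emeasure_restrict_space) (auto simp: fmeasurable_def)
  ultimately show "integrable (lebesgue_on J) (indicator A :: _ \<Rightarrow> real)"
    by (intro integrable_real_indicator)
  show "(\<integral> s. indicator A s \<partial>lebesgue_on J) = measure lebesgue A"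
    using assms A by (simp add: measure_restrict_space Int_absorb2)
qed

text \<open>For simple functions the exchange of integrals is linearity over a finite sum, as the
  time integral of \<open>indicator (A k)\<close> is the measure of \<open>A k\<close>. Both the
  pairing formula and the existence criterion for Bochner integrals rest on it.\<close>

lemma simple_pairing:
  fixes h :: "nat \<Rightarrow> real ^ 'n \<Rightarrow> real"
  assumes J: "J \<in> sets lebesgue" and A: "\<And>k. A k \<in> lmeasurable" "\<And>k. A k \<subseteq> J"
    and h: "\<And>k. integrable lebesgue (h k)"
    and w: "w \<in> borel_measurable lebesgue" "\<And>x. \<bar>w x\<bar> \<le> B"
  shows "integrable (lebesgue_on J) (\<lambda>s. \<integral> x. w x * (\<Sum>k<N. indicator (A k) s * h k x) \<partial>lebesgue)" (is ?I)
    "(\<integral> s. (\<integral> x. w x * (\<Sum>k<N. indicator (A k) s * h k x) \<partial>lebesgue) \<partial>lebesgue_on J)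
       = (\<integral> x. w x * (\<Sum>k<N. measure lebesgue (A k) * h k x) \<partial>lebesgue)" (is ?E)
proof -
  have wh: "integrable lebesgue (\<lambda>x. w x * h k x)" for k
    using integrable_bounded_mult[OF h w] .
  have lin: "(\<integral> x. w x * (\<Sum>k<N. c k * h k x) \<partial>lebesgue) = (\<Sum>k<N. c k * (\<integral> x. w x * h k x \<partial>lebesgue))"
    for c :: "nat \<Rightarrow> real"
  proof -
    have "(\<lambda>x. w x * (\<Sum>k<N. c k * h k x)) = (\<lambda>x. \<Sum>k<N. c k * (w x * h k x))"
      by (auto simp: sum_distrib_left mult_ac)
    then show ?thesis using wh by simp
  qed
  show ?I
    unfolding lin by (intro Bochner_Integration.integrable_sum integrable_mult_left indicator_lebesgue_on(1)[OF J A])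
  show ?E
    unfolding lin
    by (subst Bochner_Integration.integral_sum)
      (simp_all only: integral_mult_left_zero indicator_lebesgue_on[OF J A] integrable_mult_left)
qed

lemma borel_measurable_lebesgue_on_AE:
  fixes f g :: "'a::euclidean_space \<Rightarrow> real"
  assumes J: "J \<in> sets lebesgue" and f: "f \<in> borel_measurable (lebesgue_on J)"
    and ae: "AE s in lebesgue_on J. f s = g s"
  shows "g \<in> borel_measurable (lebesgue_on J)"
proof -
  have "(\<lambda>s. indicator J s *\<^sub>R f s) \<in> borel_measurable lebesgue"
    using J f by (subst (asm) borel_measurable_restrict_space_iff) auto
  moreover have "AE s in lebesgue. indicator J s *\<^sub>R f s = indicator J s *\<^sub>R g s"
    using ae J by (simp add: AE_restrict_space_iff) (auto elim!: eventually_mono simp: indicator_def)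
  ultimately have "(\<lambda>s. indicator J s *\<^sub>R g s) \<in> borel_measurable lebesgue"
    by (rule borel_measurable_AE)
  then show ?thesis using J by (subst borel_measurable_restrict_space_iff) auto
qed

text \<open>Integration against a bounded \<open>w\<close> is a continuous linear functional on L^1
  and so commutes with the Bochner integral: it does for the simple approximants, and the error at
  time \<open>s\<close> is at most \<open>B\<close> times their L^1 error. Measurability of the
  paired function is obtained on the way, as an almost everywhere limit.\<close>

lemma has_L1_integral_pairing:
  fixes g :: "real \<Rightarrow> real ^ 'n \<Rightarrow> real"
  assumes J: "J \<in> sets lebesgue" and has: "has_L1_integral J g \<Psi>"
    and g: "\<And>s. s \<in> J \<Longrightarrow> integrable lebesgue (g s)"
    and w: "w \<in> borel_measurable lebesgue" "\<And>x. \<bar>w x\<bar> \<le> B"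
  shows "integrable (lebesgue_on J) (\<lambda>s. \<integral> x. w x * g s x \<partial>lebesgue)"
    "(\<integral> s. (\<integral> x. w x * g s x \<partial>lebesgue) \<partial>lebesgue_on J) = (\<integral> x. w x * \<Psi> x \<partial>lebesgue)"
proof -
  from has obtain N :: "nat \<Rightarrow> nat" and A :: "nat \<Rightarrow> nat \<Rightarrow> real set" and h :: "nat \<Rightarrow> nat \<Rightarrow> real ^ 'n \<Rightarrow> real"
    where Ah: "\<And>i k. A i k \<in> lmeasurable" "\<And>i k. A i k \<subseteq> J" "\<And>i k. integrable lebesgue (h i k)"
    and em: "\<And>i. (\<lambda>s. Lnorm 1 (\<lambda>x. g s x - (\<Sum>k<N i. indicator (A i k) s * h i k x)))
              \<in> borel_measurable (lebesgue_on J)"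
    and e0: "(\<lambda>i. \<integral>\<^sup>+ s. Lnorm 1 (\<lambda>x. g s x - (\<Sum>k<N i. indicator (A i k) s * h i k x))
              \<partial>lebesgue_on J) \<longlonglongrightarrow> 0"
    and \<Psi>0: "(\<lambda>i. Lnorm 1 (\<lambda>x. \<Psi> x - (\<Sum>k<N i. measure lebesgue (A i k) * h i k x))) \<longlonglongrightarrow> 0"
    unfolding has_L1_integral_def Lspace_1_iff by blast
  have \<Psi>: "integrable lebesgue \<Psi>" using has by (simp add: has_L1_integral_def Lspace_1_iff)
  have B0: "0 \<le> B" using w(2)[of 0] by linarith
  define S where "S = (\<lambda>i s x. \<Sum>k<N i. indicator (A i k) s * h i k x)"
  define er where "er = (\<lambda>i s. \<integral> x. \<bar>g s x - S i s x\<bar> \<partial>lebesgue)"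
  define p where "p = (\<lambda>i s. \<integral> x. w x * S i s x \<partial>lebesgue)"
  define P where "P = (\<lambda>s. \<integral> x. w x * g s x \<partial>lebesgue)"
  have Sint: "integrable lebesgue (S i s)" for i s
    unfolding S_def using Ah by auto
  have e_eq: "Lnorm 1 (\<lambda>x. g s x - S i s x) = ennreal (er i s)" if "s \<in> J" for i s
    unfolding er_def using g[OF that] Sint by (intro Lnorm_1_integrable) auto
  have er0: "0 \<le> er i s" for i s by (simp add: er_def)
  have erm [measurable]: "er i \<in> borel_measurable (lebesgue_on J)" for i
  proof -
    have "(\<lambda>s. enn2real (Lnorm 1 (\<lambda>x. g s x - S i s x))) \<in> borel_measurable (lebesgue_on J)"
      using em[of i] unfolding S_def by measurable
    then show ?thesis by (subst (asm) measurable_cong[where g="er i"]) (auto simp: e_eq er0)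
  qed
  have pP: "\<bar>P s - p i s\<bar> \<le> B * er i s" if "s \<in> J" for i s
  proof -
    have "P s - p i s = (\<integral> x. w x * (g s x - S i s x) \<partial>lebesgue)"
      unfolding P_def p_def using integrable_bounded_mult[OF g[OF that] w] integrable_bounded_mult[OF Sint w]
      by (simp add: right_diff_distrib)
    then show ?thesis unfolding er_def using g[OF that] Sint w
      by (simp add: integral_bounded_mult_le)
  qed
  have pint: "integrable (lebesgue_on J) (p i)" for i
    unfolding p_def S_def by (rule simple_pairing(1)[OF J Ah w])
  have pI: "(\<integral> s. p i s \<partial>lebesgue_on J) = (\<integral> x. w x * (\<Sum>k<N i. measure lebesgue (A i k) * h i k x) \<partial>lebesgue)" for i
    unfolding p_def S_def by (rule simple_pairing(2)[OF J Ah w])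
  have e0': "(\<lambda>i. \<integral>\<^sup>+ s. ennreal (er i s) \<partial>lebesgue_on J) \<longlonglongrightarrow> 0"
  proof -
    have "(\<integral>\<^sup>+ s. Lnorm 1 (\<lambda>x. g s x - S i s x) \<partial>lebesgue_on J) = (\<integral>\<^sup>+ s. ennreal (er i s) \<partial>lebesgue_on J)" for i
      by (intro nn_integral_cong) (auto simp: e_eq)
    with e0 show ?thesis by (simp add: S_def)
  qed
  \<comment> \<open>Convergence to \<open>0\<close> in \<open>ennreal\<close> allows finitely many
    infinite terms; from index \<open>n0\<close> on the errors are integrable and real integrals can
    be used.\<close>
  have "eventually (\<lambda>i. (\<integral>\<^sup>+ s. ennreal (er i s) \<partial>lebesgue_on J) < 1) sequentially"
    using e0' by (rule order_tendstoD) simp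
  then obtain n0 where n0: "\<And>i. i \<ge> n0 \<Longrightarrow> (\<integral>\<^sup>+ s. ennreal (er i s) \<partial>lebesgue_on J) < 1"
    by (auto simp: eventually_sequentially)
  have eri: "integrable (lebesgue_on J) (er i)" if "i \<ge> n0" for i
    using n0[OF that] er0 by (intro integrableI_nonneg) (auto intro: less_trans)
  have I0: "(\<lambda>n. \<integral> s. er (n + n0) s \<partial>lebesgue_on J) \<longlonglongrightarrow> 0"
  proof -
    have "(\<lambda>n. \<integral>\<^sup>+ s. ennreal (er (n + n0) s) \<partial>lebesgue_on J) \<longlonglongrightarrow> 0"
      using LIMSEQ_ignore_initial_segment[OF e0'] .
    moreover have "(\<integral>\<^sup>+ s. ennreal (er (n + n0) s) \<partial>lebesgue_on J) = ennreal (\<integral> s. er (n + n0) s \<partial>lebesgue_on J)" for n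
      using eri er0 by (intro nn_integral_eq_integral) auto
    ultimately have "(\<lambda>n. ennreal (\<integral> s. er (n + n0) s \<partial>lebesgue_on J)) \<longlonglongrightarrow> ennreal 0" by simp
    then show ?thesis by (subst (asm) tendsto_ennreal_iff) (auto simp: er0)
  qed
  \<comment> \<open>Convergence in mean gives convergence almost everywhere only along a
    subsequence, which is enough for the measurability of \<open>P\<close>.\<close>
  obtain r where ae: "AE s in lebesgue_on J. (\<lambda>n. er (r n + n0) s) \<longlonglongrightarrow> 0"
    using tendsto_L1_AE_subseq[of "lebesgue_on J" "\<lambda>n. er (n + n0)"] eri I0 er0 by auto
  have "AE s in lebesgue_on J. lim (\<lambda>n. p (r n + n0) s) = P s"
  proof (rule AE_mp[OF ae], rule AE_I2, rule impI)
    fix s assume "s \<in> space (lebesgue_on J)" and l: "(\<lambda>n. er (r n + n0) s) \<longlonglongrightarrow> 0"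
    then have s: "s \<in> J" by simp
    have "(\<lambda>n. p (r n + n0) s - P s) \<longlonglongrightarrow> 0"
      using pP[OF s] by (intro Lim_null_comparison[OF _ tendsto_mult_right_zero[OF l, of B]])
        (auto simp: abs_minus_commute)
    then show "lim (\<lambda>n. p (r n + n0) s) = P s" by (intro limI) (simp add: LIM_zero_iff)
  qed
  moreover have "(\<lambda>s. lim (\<lambda>n. p (r n + n0) s)) \<in> borel_measurable (lebesgue_on J)"
    using borel_measurable_integrable[OF pint] by (rule borel_measurable_lim_metric)
  ultimately have Pm: "P \<in> borel_measurable (lebesgue_on J)"
    by (rule borel_measurable_lebesgue_on_AE[OF J, rotated])
  \<comment> \<open>The difference is dominated by the integrable error; adding back
    \<open>p n0\<close> then gives integrability of \<open>P\<close> itself.\<close>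
  have Pp: "integrable (lebesgue_on J) (\<lambda>s. P s - p i s)" if "i \<ge> n0" for i
    using Pm pint[of i] pP er0
    by (intro Bochner_Integration.integrable_bound[OF integrable_mult_right[OF eri[OF that], of B]] AE_I2)
      (auto intro: order_trans[OF _ abs_ge_self])
  then have Pint: "integrable (lebesgue_on J) P"
    using Bochner_Integration.integrable_add[OF Pp[of n0] pint[of n0]] by simp
  then show "integrable (lebesgue_on J) (\<lambda>s. \<integral> x. w x * g s x \<partial>lebesgue)"
    by (simp add: P_def)
  have "(\<lambda>n. (\<integral> s. p (n + n0) s \<partial>lebesgue_on J) - (\<integral> s. P s \<partial>lebesgue_on J)) \<longlonglongrightarrow> 0"
  proof (rule Lim_null_comparison[OF _ tendsto_mult_right_zero[OF I0, of B]], rule always_eventually, rule allI)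
    fix n
    have "norm ((\<integral> s. p (n + n0) s \<partial>lebesgue_on J) - (\<integral> s. P s \<partial>lebesgue_on J))
        = \<bar>\<integral> s. P s - p (n + n0) s \<partial>lebesgue_on J\<bar>"
      using Pint pint by simp
    also have "\<dots> \<le> (\<integral> s. B * er (n + n0) s \<partial>lebesgue_on J)"
      using pP eri B0 er0 by (intro order_trans[OF integral_abs_bound] integral_mono') auto
    finally show "norm ((\<integral> s. p (n + n0) s \<partial>lebesgue_on J) - (\<integral> s. P s \<partial>lebesgue_on J))
        \<le> B * (\<integral> s. er (n + n0) s \<partial>lebesgue_on J)" by simp
  qed
  then have 1: "(\<lambda>n. \<integral> s. p (n + n0) s \<partial>lebesgue_on J) \<longlonglongrightarrow> (\<integral> s. P s \<partial>lebesgue_on J)"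
    by (simp add: LIM_zero_iff)
  define T where "T = (\<lambda>i x. \<Sum>k<N i. measure lebesgue (A i k) * h i k x)"
  have TT: "(\<Sum>k<N i. measure lebesgue (A i k) * h i k x) = T i x" for i x
    by (simp add: T_def)
  have T: "integrable lebesgue (T i)" for i unfolding T_def using Ah by auto
  have "(\<lambda>i. Lnorm 1 (\<lambda>x. \<Psi> x - T i x)) \<longlonglongrightarrow> 0"
    using \<Psi>0 unfolding T_def .
  then have "(\<lambda>i. ennreal (\<integral> x. \<bar>\<Psi> x - T i x\<bar> \<partial>lebesgue)) \<longlonglongrightarrow> ennreal 0"
    using \<Psi> T Lnorm_1_integrable[of "\<lambda>x. \<Psi> x - T i x" for i] by simp
  then have T0: "(\<lambda>i. \<integral> x. \<bar>\<Psi> x - T i x\<bar> \<partial>lebesgue) \<longlonglongrightarrow> 0"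
    by (subst (asm) tendsto_ennreal_iff) auto
  have "(\<lambda>i. (\<integral> x. w x * \<Psi> x \<partial>lebesgue) - (\<integral> s. p i s \<partial>lebesgue_on J)) \<longlonglongrightarrow> 0"
  proof (rule Lim_null_comparison[OF _ tendsto_mult_right_zero[OF T0, of B]], rule always_eventually, rule allI)
    fix i
    have "(\<integral> x. w x * \<Psi> x \<partial>lebesgue) - (\<integral> s. p i s \<partial>lebesgue_on J) = (\<integral> x. w x * (\<Psi> x - T i x) \<partial>lebesgue)"
      unfolding pI TT using integrable_bounded_mult[OF \<Psi> w] integrable_bounded_mult[OF T w]
      by (simp add: right_diff_distrib)
    then show "norm ((\<integral> x. w x * \<Psi> x \<partial>lebesgue) - (\<integral> s. p i s \<partial>lebesgue_on J))
        \<le> B * (\<integral> x. \<bar>\<Psi> x - T i x\<bar> \<partial>lebesgue)"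
      using integral_bounded_mult_le[of lebesgue "\<lambda>x. \<Psi> x - T i x" w B] \<Psi> T w by simp
  qed
  then have "(\<lambda>i. (\<integral> x. w x * \<Psi> x \<partial>lebesgue) - ((\<integral> x. w x * \<Psi> x \<partial>lebesgue) - (\<integral> s. p i s \<partial>lebesgue_on J)))
      \<longlonglongrightarrow> (\<integral> x. w x * \<Psi> x \<partial>lebesgue) - 0"
    by (intro tendsto_intros)
  then have "(\<lambda>i. \<integral> s. p i s \<partial>lebesgue_on J) \<longlonglongrightarrow> (\<integral> x. w x * \<Psi> x \<partial>lebesgue)" by simp
  from LIMSEQ_unique[OF 1 LIMSEQ_ignore_initial_segment[OF this]]
  show "(\<integral> s. (\<integral> x. w x * g s x \<partial>lebesgue) \<partial>lebesgue_on J) = (\<integral> x. w x * \<Psi> x \<partial>lebesgue)"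
    by (simp add: P_def)
qed

section \<open>Existence of Bochner integrals\<close>

text \<open>Approximation in mean suffices, without knowing the value in advance: the integrals of
  the simple functions form a Cauchy sequence in L^1, and completeness supplies the limit.\<close>

lemma L1_integrableI:
  fixes g :: "real \<Rightarrow> real ^ 'n \<Rightarrow> real" and N :: "nat \<Rightarrow> nat"
  assumes J: "J \<in> sets lebesgue" and g: "\<And>s. s \<in> J \<Longrightarrow> integrable lebesgue (g s)"
    and Ah: "\<And>i k. A i k \<in> lmeasurable" "\<And>i k. A i k \<subseteq> J" "\<And>i k. integrable lebesgue (h i k)"
    and er: "\<And>i. integrable (lebesgue_on J)
      (\<lambda>s. \<integral> x. \<bar>g s x - (\<Sum>k<N i. indicator (A i k) s * h i k x)\<bar> \<partial>lebesgue)"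
    and er_lim: "(\<lambda>i. \<integral> s. (\<integral> x. \<bar>g s x - (\<Sum>k<N i. indicator (A i k) s * h i k x)\<bar> \<partial>lebesgue)
      \<partial>lebesgue_on J) \<longlonglongrightarrow> 0"
  shows "L1_integrable J g"
proof -
  define S where "S = (\<lambda>i s x. \<Sum>k<N i. indicator (A i k) s * h i k x)"
  define T where "T = (\<lambda>i x. \<Sum>k<N i. measure lebesgue (A i k) * h i k x)"
  define e where "e = (\<lambda>i s. \<integral> x. \<bar>g s x - S i s x\<bar> \<partial>lebesgue)"
  have Sint: "integrable lebesgue (S i s)" for i s unfolding S_def using Ah by auto
  have T: "integrable lebesgue (T i)" for i unfolding T_def using Ah by auto
  have e_int: "integrable (lebesgue_on J) (e i)" for i using er[of i] by (simp add: e_def S_def)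
  have e_lim: "(\<lambda>i. \<integral> s. e i s \<partial>lebesgue_on J) \<longlonglongrightarrow> 0" using er_lim by (simp add: e_def S_def)
  have e0: "0 \<le> e i s" for i s by (simp add: e_def)
  have e_eq: "Lnorm 1 (\<lambda>x. g s x - S i s x) = ennreal (e i s)" if "s \<in> J" for i s
    unfolding e_def using g[OF that] Sint by (intro Lnorm_1_integrable) auto
  have T_diff: "(\<integral> x. \<bar>T i x - T j x\<bar> \<partial>lebesgue) \<le> (\<integral> s. e i s \<partial>lebesgue_on J) + (\<integral> s. e j s \<partial>lebesgue_on J)" for i j
  proof -
    \<comment> \<open>Testing \<open>T i - T j\<close> with its own sign turns the L^1 distance into
      a time integral, where the triangle inequality through \<open>g s\<close> applies.\<close>
    define w where "w = (\<lambda>x. sgn (T i x - T j x))"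
    have w: "w \<in> borel_measurable lebesgue" "\<And>x. \<bar>w x\<bar> \<le> 1"
      using borel_measurable_integrable[OF T] by (auto simp: w_def sgn_if)
    have p1: "integrable (lebesgue_on J) (\<lambda>s. \<integral> x. w x * S i s x \<partial>lebesgue)" for i
      unfolding S_def by (rule simple_pairing(1)[OF J Ah w])
    have p2: "(\<integral> x. w x * T i x \<partial>lebesgue) = (\<integral> s. (\<integral> x. w x * S i s x \<partial>lebesgue) \<partial>lebesgue_on J)" for i
      unfolding S_def T_def by (rule simple_pairing(2)[OF J Ah w, symmetric])
    have "(\<integral> x. \<bar>T i x - T j x\<bar> \<partial>lebesgue) = (\<integral> x. w x * T i x - w x * T j x \<partial>lebesgue)"
      by (intro Bochner_Integration.integral_cong) (auto simp: w_def abs_sgn algebra_simps)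
    also have "\<dots> = (\<integral> x. w x * T i x \<partial>lebesgue) - (\<integral> x. w x * T j x \<partial>lebesgue)"
      using integrable_bounded_mult[OF T w] by simp
    also have "\<dots> = (\<integral> s. (\<integral> x. w x * S i s x \<partial>lebesgue) - (\<integral> x. w x * S j s x \<partial>lebesgue) \<partial>lebesgue_on J)"
      unfolding p2 by (intro Bochner_Integration.integral_diff[symmetric] p1)
    also have "\<dots> \<le> (\<integral> s. e i s + e j s \<partial>lebesgue_on J)"
    proof (rule integral_mono)
      show "integrable (lebesgue_on J)
          (\<lambda>s. (\<integral> x. w x * S i s x \<partial>lebesgue) - (\<integral> x. w x * S j s x \<partial>lebesgue))"
        by (intro Bochner_Integration.integrable_diff p1)
      fix s assume "s \<in> space (lebesgue_on J)"
      then have s: "s \<in> J" by simp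
      have "(\<integral> x. w x * S i s x \<partial>lebesgue) - (\<integral> x. w x * S j s x \<partial>lebesgue)
          = (\<integral> x. w x * (S i s x - S j s x) \<partial>lebesgue)"
        using integrable_bounded_mult[OF Sint w] by (simp add: right_diff_distrib)
      also have "\<dots> \<le> 1 * (\<integral> x. \<bar>S i s x - S j s x\<bar> \<partial>lebesgue)"
        using integral_bounded_mult_le[of lebesgue "\<lambda>x. S i s x - S j s x" w 1] Sint w(2) by auto
      also have "\<dots> \<le> 1 * (\<integral> x. \<bar>g s x - S i s x\<bar> + \<bar>g s x - S j s x\<bar> \<partial>lebesgue)"
        using Sint g[OF s] by (intro mult_left_mono integral_mono) auto
      also have "\<dots> = e i s + e j s"
        unfolding e_def using Sint g[OF s] by simp
      finally show "(\<integral> x. w x * S i s x \<partial>lebesgue) - (\<integral> x. w x * S j s x \<partial>lebesgue) \<le> e i s + e j s" .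
    qed (use e_int in auto)
    also have "\<dots> = (\<integral> s. e i s \<partial>lebesgue_on J) + (\<integral> s. e j s \<partial>lebesgue_on J)"
      using e_int by simp
    finally show ?thesis .
  qed
  have "\<exists>n. \<forall>i\<ge>n. \<forall>j\<ge>n. (\<integral> x. \<bar>T i x - T j x\<bar> \<partial>lebesgue) < \<epsilon>" if \<epsilon>: "\<epsilon> > 0" for \<epsilon>
  proof -
    have "\<forall>\<^sub>F i in sequentially. (\<integral> s. e i s \<partial>lebesgue_on J) < \<epsilon> / 2"
      using e_lim by (rule order_tendstoD) (use \<epsilon> in simp)
    then obtain n where n: "\<And>i. i \<ge> n \<Longrightarrow> (\<integral> s. e i s \<partial>lebesgue_on J) < \<epsilon> / 2"
      unfolding eventually_sequentially by blast
    have "(\<integral> x. \<bar>T i x - T j x\<bar> \<partial>lebesgue) < \<epsilon>" if "i \<ge> n" "j \<ge> n" for i j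
      using T_diff[of i j] n[OF that(1)] n[OF that(2)] by linarith
    then show ?thesis by blast
  qed
  from L1_complete[OF T this] obtain \<Psi> where \<Psi>: "integrable lebesgue \<Psi>"
    "(\<lambda>i. \<integral> x. \<bar>T i x - \<Psi> x\<bar> \<partial>lebesgue) \<longlonglongrightarrow> 0" by blast
  have 1: "(\<lambda>s. Lnorm 1 (\<lambda>x. g s x - S i s x)) \<in> borel_measurable (lebesgue_on J)" for i
    using borel_measurable_integrable[OF e_int[of i]]
    by (subst measurable_cong[where g="\<lambda>s. ennreal (e i s)"]) (auto simp: e_eq)
  have "(\<integral>\<^sup>+ s. Lnorm 1 (\<lambda>x. g s x - S i s x) \<partial>lebesgue_on J) = ennreal (\<integral> s. e i s \<partial>lebesgue_on J)" for i
  proof -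
    have "(\<integral>\<^sup>+ s. Lnorm 1 (\<lambda>x. g s x - S i s x) \<partial>lebesgue_on J) = (\<integral>\<^sup>+ s. ennreal (e i s) \<partial>lebesgue_on J)"
      by (intro nn_integral_cong) (auto simp: e_eq)
    also have "\<dots> = ennreal (\<integral> s. e i s \<partial>lebesgue_on J)"
      using e_int e0 by (intro nn_integral_eq_integral) auto
    finally show ?thesis .
  qed
  then have 2: "(\<lambda>i. \<integral>\<^sup>+ s. Lnorm 1 (\<lambda>x. g s x - S i s x) \<partial>lebesgue_on J) \<longlonglongrightarrow> 0"
    using tendsto_ennrealI[OF e_lim] by simp
  have "Lnorm 1 (\<lambda>x. \<Psi> x - T i x) = ennreal (\<integral> x. \<bar>T i x - \<Psi> x\<bar> \<partial>lebesgue)" for i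
    using T \<Psi>(1) by (subst Lnorm_1_integrable) (auto simp: abs_minus_commute)
  then have 3: "(\<lambda>i. Lnorm 1 (\<lambda>x. \<Psi> x - T i x)) \<longlonglongrightarrow> 0"
    using tendsto_ennrealI[OF \<Psi>(2)] by simp
  have "has_L1_integral J g \<Psi>"
    unfolding has_L1_integral_def Lspace_1_iff
    by (intro conjI \<Psi>(1), rule exI[of _ N], rule exI[of _ A], rule exI[of _ h])
      (use Ah 1 2 3 in \<open>simp add: S_def T_def\<close>)
  then show ?thesis unfolding L1_integrable_def by blast
qed

text \<open>The dyadic intervals of length 2^(-i) partition the times from \<open>0\<close> up to
  \<open>i\<close>, and \<open>s\<close> lies in the one with index
  \<open>\<lfloor>s * 2 ^ i\<rfloor>\<close>; the sum selects that coefficient.\<close>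

lemma sum_dyadic_indicator:
  fixes s :: real and c :: "nat \<Rightarrow> real"
  assumes "0 \<le> s"
  shows "(\<Sum>k<i * 2 ^ i. indicator {real k / 2 ^ i..<(real k + 1) / 2 ^ i} s * c k)
       = (if s < real i then c (nat \<lfloor>s * 2 ^ i\<rfloor>) else 0)"
proof -
  have ind: "indicator {real k / 2 ^ i..<(real k + 1) / 2 ^ i} s = (if k = nat \<lfloor>s * 2 ^ i\<rfloor> then 1 else (0::real))" for k
  proof -
    have "s \<in> {real k / 2 ^ i..<(real k + 1) / 2 ^ i} \<longleftrightarrow> real k \<le> s * 2 ^ i \<and> s * 2 ^ i < real k + 1"
      by (simp add: field_simps)
    also have "\<dots> \<longleftrightarrow> \<lfloor>s * 2 ^ i\<rfloor> = int k" by (simp add: floor_eq_iff)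
    also have "\<dots> \<longleftrightarrow> k = nat \<lfloor>s * 2 ^ i\<rfloor>" using assms by auto
    finally show ?thesis by (simp add: indicator_def)
  qed
  have "nat \<lfloor>s * 2 ^ i\<rfloor> < i * 2 ^ i \<longleftrightarrow> \<lfloor>s * 2 ^ i\<rfloor> < int (i * 2 ^ i)"
    using assms by (subst nat_less_iff) auto
  also have "\<dots> \<longleftrightarrow> s < real i" by (simp add: floor_less_iff)
  finally have *: "nat \<lfloor>s * 2 ^ i\<rfloor> < i * 2 ^ i \<longleftrightarrow> s < real i" .
  have "(\<Sum>k<i * 2 ^ i. indicator {real k / 2 ^ i..<(real k + 1) / 2 ^ i} s * c k)
      = (\<Sum>k<i * 2 ^ i. if k = nat \<lfloor>s * 2 ^ i\<rfloor> then c k else 0)"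
    unfolding ind by (intro sum.cong) auto
  also have "\<dots> = (if s < real i then c (nat \<lfloor>s * 2 ^ i\<rfloor>) else 0)"
    using * by (subst sum.delta) auto
  finally show ?thesis .
qed

text \<open>The approximants freeze \<open>g\<close> at the left end points of dyadic intervals and
  stop at time \<open>i\<close>. Continuity makes the errors tend to zero pointwise, and
  \<open>2 * b\<close> dominates them. In \<open>dom\<close>, \<open>g\<close> at one time is
  bounded by \<open>b\<close> at any time up to one unit later, because a left end point precedes
  the current time by up to 2^(-i).\<close>

lemma L1_integrable_continuous:
  fixes g :: "real \<Rightarrow> real ^ 'n \<Rightarrow> real"
  assumes g: "\<And>s. 0 \<le> s \<Longrightarrow> integrable lebesgue (g s)"
    and cont: "\<And>t. 0 \<le> t \<Longrightarrow> ((\<lambda>s. \<integral> x. \<bar>g s x - g t x\<bar> \<partial>lebesgue) \<longlongrightarrow> 0) (at t within {0..})"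
    and dom: "\<And>s s'. 0 \<le> s \<Longrightarrow> s \<le> s' \<Longrightarrow> s' \<le> s + 1 \<Longrightarrow> (\<integral> x. \<bar>g s x\<bar> \<partial>lebesgue) \<le> b s'"
    and b: "integrable (lebesgue_on {0..}) b"
  shows "L1_integrable {0..} g"
proof -
  define A where "A = (\<lambda>i k::nat. {real k / 2 ^ i..<(real k + 1) / 2 ^ i})"
  define h where "h = (\<lambda>(i::nat) (k::nat). g (real k / 2 ^ i))"
  define \<sigma> where "\<sigma> = (\<lambda>(i::nat) (s::real). real (nat \<lfloor>s * 2 ^ i\<rfloor>) / 2 ^ i)"
  define D where "D = (\<lambda>(c::real) s. \<integral> x. \<bar>g s x - g c x\<bar> \<partial>lebesgue)"
  define n where "n = (\<lambda>s. \<integral> x. \<bar>g s x\<bar> \<partial>lebesgue)"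
  define e where "e = (\<lambda>(i::nat) s. if s < real i then D (\<sigma> i s) s else n s)"
  have J: "{0::real..} \<in> sets lebesgue" by simp
  have \<sigma>: "0 \<le> \<sigma> i s" "\<sigma> i s \<le> s" "s \<le> \<sigma> i s + (1 / 2) ^ i" if "0 \<le> s" for i s
  proof -
    have "real (nat \<lfloor>s * 2 ^ i\<rfloor>) = of_int \<lfloor>s * 2 ^ i\<rfloor>" using that by simp
    moreover have "of_int \<lfloor>s * 2 ^ i\<rfloor> \<le> s * 2 ^ i" "s * 2 ^ i < of_int \<lfloor>s * 2 ^ i\<rfloor> + 1" by linarith+
    ultimately show "\<sigma> i s \<le> s" "s \<le> \<sigma> i s + (1 / 2) ^ i"
      unfolding \<sigma>_def by (auto simp: field_simps power_divide)
  qed (simp add: \<sigma>_def)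
  have e_eq: "(\<integral> x. \<bar>g s x - (\<Sum>k<i * 2 ^ i. indicator (A i k) s * h i k x)\<bar> \<partial>lebesgue) = e i s"
    if "0 \<le> s" for i s
    unfolding A_def sum_dyadic_indicator[OF that] by (simp add: e_def D_def n_def h_def \<sigma>_def)
  have D_tri: "\<bar>D c s - D c t\<bar> \<le> D t s" if "0 \<le> c" "0 \<le> s" "0 \<le> t" for c s t
  proof -
    have "D c s \<le> (\<integral> x. \<bar>g s x - g t x\<bar> + \<bar>g t x - g c x\<bar> \<partial>lebesgue)"
      unfolding D_def using g that by (intro integral_mono) auto
    moreover have "D c t \<le> (\<integral> x. \<bar>g s x - g t x\<bar> + \<bar>g s x - g c x\<bar> \<partial>lebesgue)"
      unfolding D_def using g that by (intro integral_mono) auto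
    ultimately show ?thesis using g that by (simp add: D_def)
  qed
  have D_cont: "continuous_on {0..} (D c)" if "0 \<le> c" for c
    unfolding continuous_on_def
  proof safe
    fix t :: real assume "0 \<le> t"
    have "((\<lambda>s. D c s - D c t) \<longlongrightarrow> 0) (at t within {0..})"
      using cont[OF \<open>0 \<le> t\<close>] D_tri[OF that _ \<open>0 \<le> t\<close>]
      by (intro Lim_null_comparison[OF _ cont[OF \<open>0 \<le> t\<close>]])
        (auto simp: eventually_at_topological D_def)
    then show "(D c \<longlongrightarrow> D c t) (at t within {0..})" by (simp add: LIM_zero_iff)
  qed
  have n_tri: "\<bar>n s - n t\<bar> \<le> D t s" if "0 \<le> s" "0 \<le> t" for s t
  proof -
    have "n s \<le> (\<integral> x. \<bar>g s x - g t x\<bar> + \<bar>g t x\<bar> \<partial>lebesgue)"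
      unfolding n_def using g that by (intro integral_mono) auto
    moreover have "n t \<le> (\<integral> x. \<bar>g s x - g t x\<bar> + \<bar>g s x\<bar> \<partial>lebesgue)"
      unfolding n_def using g that by (intro integral_mono) auto
    ultimately show ?thesis using g that by (simp add: D_def n_def)
  qed
  have n_cont: "continuous_on {0..} n"
    unfolding continuous_on_def
  proof safe
    fix t :: real assume "0 \<le> t"
    have "((\<lambda>s. n s - n t) \<longlongrightarrow> 0) (at t within {0..})"
      using n_tri[OF _ \<open>0 \<le> t\<close>]
      by (intro Lim_null_comparison[OF _ cont[OF \<open>0 \<le> t\<close>]])
        (auto simp: eventually_at_topological D_def)
    then show "(n \<longlongrightarrow> n t) (at t within {0..})" by (simp add: LIM_zero_iff)
  qed
  \<comment> \<open>As a finite sum of indicators times continuous functions the error is measurable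
    in time; the last summand is the part that was cut off.\<close>
  have e_sum: "e i s = (\<Sum>k<i * 2 ^ i. indicator (A i k) s * D (real k / 2 ^ i) s) + indicator {real i..} s * n s"
    if "0 \<le> s" for i s
    unfolding A_def sum_dyadic_indicator[OF that] by (simp add: e_def \<sigma>_def indicator_def)
  have [measurable]: "D (real k / 2 ^ i) \<in> borel_measurable (lebesgue_on {0..})"
    "n \<in> borel_measurable (lebesgue_on {0..})" for k i
    using D_cont n_cont J by (auto intro!: continuous_imp_measurable_on_sets_lebesgue)
  have ind: "indicator B \<in> borel_measurable (lebesgue_on {0..})" if "B \<in> sets lborel" for B :: "real set"
    using that by (intro measurable_restrict_space1 borel_measurable_indicator) auto
  have e_meas: "e i \<in> borel_measurable (lebesgue_on {0..})" for i
  proof (subst measurable_cong[OF e_sum])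
    show "(\<lambda>s. (\<Sum>k<i * 2 ^ i. indicator (A i k) s * D (real k / 2 ^ i) s) + indicator {real i..} s * n s)
        \<in> borel_measurable (lebesgue_on {0..})"
      unfolding A_def
      by (intro borel_measurable_add borel_measurable_sum borel_measurable_times ind) auto
  qed simp
  have nb: "n s \<le> b s" if "0 \<le> s" for s unfolding n_def using that by (intro dom) auto
  have half: "(1 / 2 :: real) ^ i \<le> 1" for i by (simp add: power_le_one)
  have e_le: "\<bar>e i s\<bar> \<le> 2 * b s" if "0 \<le> s" for i s
  proof -
    have n0: "0 \<le> n s" by (simp add: n_def)
    have "D (\<sigma> i s) s \<le> (\<integral> x. \<bar>g s x\<bar> + \<bar>g (\<sigma> i s) x\<bar> \<partial>lebesgue)"
      unfolding D_def using g that \<sigma>(1)[OF that] by (intro integral_mono) auto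
    also have "\<dots> = n s + n (\<sigma> i s)" using g that \<sigma>(1)[OF that] by (simp add: n_def)
    also have "\<dots> \<le> b s + b s"
      unfolding n_def using \<sigma>[OF that, of i] half[of i] that by (intro add_mono dom) auto
    finally have "D (\<sigma> i s) s \<le> 2 * b s" by simp
    moreover have "0 \<le> D (\<sigma> i s) s" by (simp add: D_def)
    ultimately show ?thesis using nb[OF that] n0 by (auto simp: e_def)
  qed
  have e_lim: "(\<lambda>i. e i s) \<longlonglongrightarrow> 0" if s: "0 \<le> s" for s
  proof -
    have "(\<lambda>i. s - (1 / 2) ^ i) \<longlonglongrightarrow> s - 0" by (intro tendsto_intros) auto
    then have \<sigma>l: "(\<lambda>i. \<sigma> i s) \<longlonglongrightarrow> s"
    proof (intro tendsto_sandwich[of "\<lambda>i. s - (1 / 2) ^ i" "\<lambda>i. \<sigma> i s" sequentially "\<lambda>_. s"])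
      show "\<forall>\<^sub>F i in sequentially. s - (1 / 2) ^ i \<le> \<sigma> i s" using \<sigma>(3)[OF s] by (simp add: algebra_simps)
    qed (use \<sigma>(2)[OF s] in auto)
    have "(D s \<longlongrightarrow> D s s) (at s within {0..})" using D_cont[OF s] s by (simp add: continuous_on_def)
    then have "(\<lambda>i. D s (\<sigma> i s)) \<longlonglongrightarrow> D s s"
      using D_cont[OF s] s \<sigma>l \<sigma>(1)[OF s] by (intro continuous_on_tendsto_compose[of "{0..}" "D s"]) auto
    \<comment> \<open>\<open>D\<close> is symmetric in its two times, so continuity of
      \<open>D s\<close> at \<open>s\<close> suffices although the reference time varies with
      \<open>i\<close>.\<close>
    then have "(\<lambda>i. D (\<sigma> i s) s) \<longlonglongrightarrow> 0" by (simp add: D_def abs_minus_commute)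
    moreover have "\<forall>\<^sub>F i in sequentially. e i s = D (\<sigma> i s) s"
      using eventually_gt_at_top[of "nat \<lceil>s\<rceil>"] by eventually_elim (simp add: e_def, linarith)
    ultimately show ?thesis by (simp add: tendsto_cong)
  qed
  have e_int: "integrable (lebesgue_on {0..}) (e i)" for i
    using e_meas b e_le
    by (intro Bochner_Integration.integrable_bound[OF integrable_mult_right[OF b, of 2] e_meas] AE_I2)
      (auto intro: order_trans[OF _ abs_ge_self])
  have "(\<lambda>i. \<integral> s. e i s \<partial>lebesgue_on {0..}) \<longlonglongrightarrow> (\<integral> s. 0 \<partial>lebesgue_on {0::real..})"
    by (rule integral_dominated_convergence[where w="\<lambda>s. 2 * b s"])
      (use e_meas b e_le e_lim in \<open>auto intro!: AE_I2\<close>)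
  then have lim: "(\<lambda>i. \<integral> s. e i s \<partial>lebesgue_on {0..}) \<longlonglongrightarrow> 0" by simp
  show ?thesis
  proof (rule L1_integrableI[where A=A and h=h and N="\<lambda>i. i * 2 ^ i", OF J])
    show "A i k \<in> lmeasurable" for i k
      unfolding A_def by (intro fmeasurableI) (auto simp: divide_right_mono)
    show "A i k \<subseteq> {0..}" for i k unfolding A_def by (auto intro: order_trans[rotated])
    show "integrable lebesgue (h i k)" for i k unfolding h_def by (intro g) auto
    show "integrable (lebesgue_on {0..})
        (\<lambda>s. \<integral> x. \<bar>g s x - (\<Sum>k<i * 2 ^ i. indicator (A i k) s * h i k x)\<bar> \<partial>lebesgue)" for i
      using e_int[of i] by (subst Bochner_Integration.integrable_cong[OF refl e_eq]) auto
    have "(\<integral> s. (\<integral> x. \<bar>g s x - (\<Sum>k<i * 2 ^ i. indicator (A i k) s * h i k x)\<bar> \<partial>lebesgue) \<partial>lebesgue_on {0..})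
        = (\<integral> s. e i s \<partial>lebesgue_on {0..})" for i
      by (intro Bochner_Integration.integral_cong refl e_eq) auto
    then show "(\<lambda>i. \<integral> s. (\<integral> x. \<bar>g s x - (\<Sum>k<i * 2 ^ i. indicator (A i k) s * h i k x)\<bar> \<partial>lebesgue)
        \<partial>lebesgue_on {0..}) \<longlonglongrightarrow> 0"
      using lim by (simp only:)
  qed (use g in auto)
qed

section \<open>Weights, expansions and duality\<close>

lemma integral_lebesgue_on:
  fixes P :: "'a::euclidean_space \<Rightarrow> real"
  assumes "J \<in> sets lebesgue"
  shows "integrable (lebesgue_on J) P \<longleftrightarrow> integrable lebesgue (\<lambda>s. indicator J s * P s)"
    "integral\<^sup>L (lebesgue_on J) P = (\<integral> s. indicator J s * P s \<partial>lebesgue)"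
  using assms by (simp_all add: integrable_restrict_space integral_restrict_space)

lemma abs_integral_le_integral:
  fixes P b :: "'a \<Rightarrow> real"
  assumes "integrable M b" "\<And>s. s \<in> space M \<Longrightarrow> \<bar>P s\<bar> \<le> b s"
  shows "\<bar>\<integral> s. P s \<partial>M\<bar> \<le> (\<integral> s. b s \<partial>M)"
  using assms by (intro order_trans[OF integral_abs_bound] integral_mono')
    (auto intro: order_trans[OF abs_ge_zero])

lemma abs_integral_mult_le:
  fixes v g :: "'a \<Rightarrow> real"
  assumes "integrable M (\<lambda>x. b x * \<bar>g x\<bar>)" "\<And>x. \<bar>v x\<bar> \<le> b x"
  shows "\<bar>\<integral> x. v x * g x \<partial>M\<bar> \<le> (\<integral> x. b x * \<bar>g x\<bar> \<partial>M)"
  using assms by (intro abs_integral_le_integral) (auto simp: abs_mult intro: mult_right_mono)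

lemma powr_integrable_on_atLeast:
  fixes \<gamma> :: real
  assumes "\<gamma> > 1"
  shows "integrable (lebesgue_on {0..}) (\<lambda>s. (1 + s) powr - \<gamma>)"
proof -
  define G where "G = (\<lambda>s::real. (1 + s) powr (1 - \<gamma>) / (1 - \<gamma>))"
  have m: "(\<lambda>s::real. (1 + s) powr - \<gamma>) \<in> borel_measurable borel" by measurable
  have "(\<integral>\<^sup>+ s. ennreal ((1 + s) powr - \<gamma>) * indicator {0..} s \<partial>lborel) = ennreal (0 - G 0)"
  proof (rule nn_integral_FTC_atLeast[OF m])
    show "(G has_real_derivative (1 + s) powr - \<gamma>) (at s)" if "0 \<le> s" for s
    proof -
      have "((\<lambda>s. (1 + s) powr (1 - \<gamma>)) has_real_derivative (1 - \<gamma>) * (1 + s) powr - \<gamma>) (at s)"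
        using that by (auto intro!: derivative_eq_intros)
      from DERIV_cdivide[OF this, of "1 - \<gamma>"] show ?thesis using assms by (simp add: G_def)
    qed
    have "((\<lambda>s::real. (1 + s) powr (1 - \<gamma>)) \<longlongrightarrow> 0) at_top"
      using assms
      by (intro tendsto_neg_powr filterlim_tendsto_add_at_top[OF tendsto_const filterlim_ident]) auto
    from tendsto_divide[OF this tendsto_const[of "1 - \<gamma>"]] assms
    show "(G \<longlongrightarrow> 0) at_top" by (simp add: G_def)
  qed auto
  then have "integrable lborel (\<lambda>s. indicator {0..} s * (1 + s) powr - \<gamma>)"
    by (intro integrableI_nonneg) (auto simp: ennreal_mult' mult.commute ennreal_indicator)
  then have "integrable lebesgue (\<lambda>s. indicator {0..} s * (1 + s) powr - \<gamma>)"
    by (subst integrable_completion) auto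
  then show ?thesis by (simp add: integral_lebesgue_on)
qed

text \<open>The weight is truncated so that the moments of a solution are finite a priori.\<close>

definition weight :: "nat \<Rightarrow> real \<Rightarrow> 'a::real_normed_vector \<Rightarrow> real" where
  "weight k R x = (min (norm x) R) ^ k"

lemma weight_nonneg: "0 \<le> R \<Longrightarrow> 0 \<le> weight k R x"
  by (simp add: weight_def)

lemma weight_le: "0 \<le> R \<Longrightarrow> weight k R x \<le> R ^ k" "0 \<le> R \<Longrightarrow> weight k R x \<le> norm x ^ k"
  by (auto simp: weight_def intro!: power_mono)

lemma abs_weight_le: "0 \<le> R \<Longrightarrow> \<bar>weight k R x\<bar> \<le> R ^ k"
  using weight_le(1)[of R k x] weight_nonneg[of R k x] by simp

lemma borel_measurable_weight [measurable]:
  "weight k R \<in> borel_measurable (borel :: 'a::{real_normed_vector, second_countable_topology} measure)"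
  unfolding weight_def[abs_def] by measurable

section \<open>Growth of weights under the heat flow\<close>

text \<open>Truncation respects the triangle inequality in the form min(|x|, R) \<le> min(|y|, R) +
  |x - y|, and (a + b)^k \<le> 2 (a^k + b^k) for k \<le> 2.\<close>

lemma weight_triangle:
  assumes "0 \<le> R" "k \<le> 2"
  shows "weight k R x \<le> 2 * (weight k R y + norm (x - y) ^ k)"
proof -
  define a b where "a = min (norm y) R" "b = norm (x - y)"
  have ab: "0 \<le> a" "0 \<le> b" using assms by (auto simp: a_b_def)
  have "norm x \<le> norm y + norm (x - y)" using norm_triangle_sub[of x y] by simp
  then have "min (norm x) R \<le> a + b" unfolding a_b_def
    using norm_ge_zero[of "x - y"] by linarith
  then have "weight k R x \<le> (a + b) ^ k"
    unfolding weight_def using assms by (intro power_mono) auto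
  also have "\<dots> \<le> 2 * (a ^ k + b ^ k)"
  proof -
    consider "k = 0" | "k = 1" | "k = 2" using assms by linarith
    then show ?thesis
    proof cases
      case 3
      have "0 \<le> (a - b)\<^sup>2" by simp
      then show ?thesis using 3 by (simp add: power2_eq_square algebra_simps)
    qed (use ab in auto)
  qed
  finally show ?thesis by (simp add: weight_def a_b_def)
qed

lemma norm_power_gauss_le:
  fixes z :: "real ^ 'n" assumes "\<tau> > 0" "k \<le> 2"
  shows "norm z ^ k * gauss \<tau> z \<le> sqrt \<tau> ^ k * (exp 19 * 2 powr (real CARD('n) / 2)) * gauss (2 * \<tau>) z"
proof -
  have "norm z ^ k = sqrt \<tau> ^ k * (norm z / sqrt \<tau>) ^ k" using assms by (simp add: power_divide)
  also have "\<dots> \<le> sqrt \<tau> ^ k * (1 + norm z / sqrt \<tau>) ^ k"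
    using assms by (intro mult_left_mono power_mono) auto
  finally have "norm z ^ k * gauss \<tau> z \<le> sqrt \<tau> ^ k * ((1 + norm z / sqrt \<tau>) ^ k * gauss \<tau> z)"
    by (metis gauss_nonneg mult.assoc mult_right_mono)
  also have "\<dots> \<le> sqrt \<tau> ^ k * (exp 19 * 2 powr (real CARD('n) / 2) * gauss (2 * \<tau>) z)"
    using assms by (intro mult_left_mono polynomial_gauss_le) auto
  finally show ?thesis by (simp add: mult.assoc)
qed

text \<open>The dual form of the growth of moments: diffusion over time \<open>\<tau>\<close> adds a
  multiple of \<open>sqrt \<tau> ^ k\<close> to the weight. The added term does not involve
  \<open>R\<close>, so the truncation can be removed later.\<close>

lemma abs_heat_weight_le:
  fixes w :: "real ^ 'n \<Rightarrow> real"
  assumes k: "k \<le> 2" and R: "0 \<le> R" and \<tau>: "0 \<le> \<tau>" and w: "w \<in> borel_measurable lebesgue"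
    and wW: "\<And>x. \<bar>w x\<bar> \<le> weight k R x"
  shows "\<bar>heat \<tau> w y\<bar> \<le> 2 * weight k R y + 2 * (exp 19 * 2 powr (real CARD('n) / 2)) * sqrt \<tau> ^ k"
proof (cases "\<tau> = 0")
  case True
  have "\<bar>w y\<bar> \<le> 2 * weight k R y" using wW[of y] weight_nonneg[OF R, of k y] by linarith
  also have "\<dots> \<le> 2 * weight k R y + 2 * (exp 19 * 2 powr (real CARD('n) / 2)) * sqrt \<tau> ^ k"
    using \<tau> by simp
  finally show ?thesis using True by simp
next
  case False
  with \<tau> have t: "\<tau> > 0" by simp
  define D where "D = exp 19 * 2 powr (real CARD('n) / 2)"
  note g1 = integrable_gauss_shift[OF t, of y]
  have g2: "integrable lebesgue (\<lambda>x. gauss (2 * \<tau>) (x - y))" "(\<integral> x. gauss (2 * \<tau>) (x - y) \<partial>lebesgue) = 1"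
    using t by (intro integrable_gauss_shift; simp)+
  have "\<bar>heat \<tau> w y\<bar> = \<bar>\<integral> x. gauss \<tau> (x - y) * w x \<partial>lebesgue\<bar>"
    using t by (simp add: heat_def gauss_minus_commute[of \<tau> y])
  also have "\<dots> \<le> (\<integral> x. 2 * weight k R y * gauss \<tau> (x - y) + 2 * D * sqrt \<tau> ^ k * gauss (2 * \<tau>) (x - y) \<partial>lebesgue)"
  proof (rule abs_integral_le_integral)
    fix x :: "real ^ 'n"
    have "\<bar>gauss \<tau> (x - y) * w x\<bar> \<le> gauss \<tau> (x - y) * (2 * (weight k R y + norm (x - y) ^ k))"
      unfolding abs_mult using order_trans[OF wW weight_triangle[OF R k]] by (intro mult_mono) auto
    also have "\<dots> = 2 * weight k R y * gauss \<tau> (x - y) + 2 * (norm (x - y) ^ k * gauss \<tau> (x - y))"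
      by (simp add: algebra_simps)
    also have "\<dots> \<le> 2 * weight k R y * gauss \<tau> (x - y) + 2 * (sqrt \<tau> ^ k * D * gauss (2 * \<tau>) (x - y))"
      using norm_power_gauss_le[OF t k, of "x - y"] by (simp add: D_def)
    finally show "\<bar>gauss \<tau> (x - y) * w x\<bar>
        \<le> 2 * weight k R y * gauss \<tau> (x - y) + 2 * D * sqrt \<tau> ^ k * gauss (2 * \<tau>) (x - y)"
      by (simp add: mult_ac)
  qed (use g1 g2 in auto)
  also have "\<dots> = 2 * weight k R y + 2 * D * sqrt \<tau> ^ k"
    using g1 g2 by simp
  finally show ?thesis by (simp add: D_def)
qed

text \<open>Fatou's lemma removes the truncation because \<open>B\<close> is the same for every
  \<open>R\<close>; at a fixed point the weight equals \<open>norm x ^ k\<close> as soon as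
  \<open>R\<close> exceeds \<open>norm x\<close>.\<close>

lemma integrable_norm_power:
  fixes g :: "real ^ 'n \<Rightarrow> real"
  assumes g: "integrable lebesgue g"
    and B: "\<And>R. 0 < R \<Longrightarrow> (\<integral> x. weight k R x * \<bar>g x\<bar> \<partial>lebesgue) \<le> B"
  shows "integrable lebesgue (\<lambda>x. norm x ^ k * g x)"
proof (rule integrableI_bounded)
  have m [measurable]: "g \<in> borel_measurable lebesgue"
    "(weight k R :: real ^ 'n \<Rightarrow> real) \<in> borel_measurable lebesgue" for R
    using g by (auto intro: borel_measurable_lebesgueI)
  show "(\<lambda>x. norm x ^ k * g x) \<in> borel_measurable lebesgue"
    by (intro borel_measurable_times m(1) borel_measurable_lebesgueI[of "\<lambda>x. norm x ^ k"]) measurable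
  have int: "integrable lebesgue (\<lambda>x. weight k R x * \<bar>g x\<bar>)" if "0 \<le> R" for R
    using integrable_bounded_mult[OF integrable_abs[OF g] m(2) abs_weight_le[OF that]] .
  have "(\<integral>\<^sup>+ x. ennreal (norm (norm x ^ k * g x)) \<partial>lebesgue)
      = (\<integral>\<^sup>+ x. liminf (\<lambda>i. ennreal (weight k (real (Suc i)) x * \<bar>g x\<bar>)) \<partial>lebesgue)"
  proof (intro nn_integral_cong)
    fix x :: "real ^ 'n"
    have "\<forall>\<^sub>F i in sequentially. ennreal (weight k (real (Suc i)) x * \<bar>g x\<bar>) = ennreal (norm (norm x ^ k * g x))"
      using eventually_gt_at_top[of "nat \<lceil>norm x\<rceil>"]
      by eventually_elim (auto simp: weight_def min_def abs_mult, linarith+)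
    then have "(\<lambda>i. ennreal (weight k (real (Suc i)) x * \<bar>g x\<bar>)) \<longlonglongrightarrow> ennreal (norm (norm x ^ k * g x))"
      by (rule tendsto_eventually)
    then show "ennreal (norm (norm x ^ k * g x)) = liminf (\<lambda>i. ennreal (weight k (real (Suc i)) x * \<bar>g x\<bar>))"
      by (intro lim_imp_Liminf[symmetric]) simp_all
  qed
  also have "\<dots> \<le> liminf (\<lambda>i. \<integral>\<^sup>+ x. ennreal (weight k (real (Suc i)) x * \<bar>g x\<bar>) \<partial>lebesgue)"
    using m by (intro nn_integral_liminf) auto
  also have "\<dots> \<le> limsup (\<lambda>i. \<integral>\<^sup>+ x. ennreal (weight k (real (Suc i)) x * \<bar>g x\<bar>) \<partial>lebesgue)"
    by (intro Liminf_le_Limsup) auto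
  also have "\<dots> \<le> ennreal B"
  proof (intro Limsup_bounded always_eventually allI)
    fix i
    have "(\<integral>\<^sup>+ x. ennreal (weight k (real (Suc i)) x * \<bar>g x\<bar>) \<partial>lebesgue)
        = ennreal (\<integral> x. weight k (real (Suc i)) x * \<bar>g x\<bar> \<partial>lebesgue)"
      using int[of "real (Suc i)"] by (intro nn_integral_eq_integral) (auto simp: weight_nonneg)
    also have "\<dots> \<le> ennreal B" by (intro ennreal_leI B) simp
    finally show "(\<integral>\<^sup>+ x. ennreal (weight k (real (Suc i)) x * \<bar>g x\<bar>) \<partial>lebesgue) \<le> ennreal B" .
  qed
  also have "\<dots> < \<infinity>" by simp
  finally show "(\<integral>\<^sup>+ x. ennreal (norm (norm x ^ k * g x)) \<partial>lebesgue) < \<infinity>" .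
qed

section \<open>Kernel estimates integrated against functions\<close>

text \<open>The majorant keeps the heat flow of \<open>\<bar>w\<bar>\<close> at time
  \<open>2 * t\<close> instead of a number: it is at most \<open>1\<close> when
  \<open>\<bar>w\<bar> \<le> 1\<close>, and at most a multiple of t^(-n/2) times the L^1 norm of
  \<open>w\<close>. The two remainder estimates use one of these bounds each.\<close>

lemma heat_time_diff_le:
  "\<exists>C>0. \<forall>t>0. \<forall>s\<in>{0..t / 2}. \<forall>w :: real ^ 'n \<Rightarrow> real. \<forall>B. \<forall>y.
     w \<in> borel_measurable lebesgue \<longrightarrow> (\<forall>x. \<bar>w x\<bar> \<le> B) \<longrightarrow>
     \<bar>heat (t - s) w y - heat t w y\<bar> \<le> C * (s / t) * heat (2 * t) (\<lambda>x. \<bar>w x\<bar>) y"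
proof -
  obtain C where C: "C > 0" "\<And>t s x. t > 0 \<Longrightarrow> s \<in> {0..t / 2} \<Longrightarrow>
      \<bar>gauss (t - s) x - gauss t (x :: real ^ 'n)\<bar> \<le> C * (s / t) * gauss (2 * t) x"
    using gauss_time_diff_le by blast
  have "\<bar>heat (t - s) w y - heat t w y\<bar> \<le> C * (s / t) * heat (2 * t) (\<lambda>x. \<bar>w x\<bar>) y"
    if t: "t > 0" and s: "s \<in> {0..t / 2}" and w: "w \<in> borel_measurable lebesgue" "\<And>x. \<bar>w x\<bar> \<le> B"
    for t s B y and w :: "real ^ 'n \<Rightarrow> real"
  proof -
    have ts: "t - s > 0" using t s by auto
    have w': "(\<lambda>x. \<bar>w x\<bar>) \<in> borel_measurable lebesgue" "\<And>x. \<bar>\<bar>w x\<bar>\<bar> \<le> B" using w by auto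
    have i: "integrable lebesgue (\<lambda>x. gauss (2 * t) (y - x) * \<bar>w x\<bar>)"
      using t by (intro gauss_mult_integrable_bounded[OF _ w']) simp
    have "\<bar>heat (t - s) w y - heat t w y\<bar> = \<bar>\<integral> x. (gauss (t - s) (y - x) - gauss t (y - x)) * w x \<partial>lebesgue\<bar>"
      using t ts gauss_mult_integrable_bounded[OF t w, of y] gauss_mult_integrable_bounded[OF ts w, of y]
      by (simp add: heat_def left_diff_distrib)
    also have "\<dots> \<le> (\<integral> x. C * (s / t) * (gauss (2 * t) (y - x) * \<bar>w x\<bar>) \<partial>lebesgue)"
    proof (rule abs_integral_le_integral)
      fix x
      show "\<bar>(gauss (t - s) (y - x) - gauss t (y - x)) * w x\<bar> \<le> C * (s / t) * (gauss (2 * t) (y - x) * \<bar>w x\<bar>)"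
        using mult_right_mono[OF C(2)[OF t s, of "y - x"], of "\<bar>w x\<bar>"] by (simp add: abs_mult mult_ac)
    qed (use i in auto)
    also have "\<dots> = C * (s / t) * heat (2 * t) (\<lambda>x. \<bar>w x\<bar>) y"
      using t by (simp add: heat_def)
    finally show ?thesis .
  qed
  with C(1) show ?thesis by blast
qed

text \<open>The Taylor estimate is integrated in \<open>y\<close> against \<open>\<psi>\<close>; its
  linear term yields the first moments because \<open>x \<bullet> y\<close> is a sum over
  coordinates. The majorant remains a function of \<open>x\<close> so that both its integral and its
  supremum can be taken.\<close>

lemma heat_expansion_le:
  fixes \<psi> :: "real ^ 'n \<Rightarrow> real"
  assumes k: "k = 1 \<or> k = 2" and \<psi>: "integrable lebesgue \<psi>" "integrable lebesgue (\<lambda>y. norm y ^ k * \<psi> y)"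
    and \<psi>j: "\<And>j. integrable lebesgue (\<lambda>y. y $ j * \<psi> y)"
  shows "\<exists>C>0. \<forall>t>0. \<forall>x.
    \<bar>heat t \<psi> x - (\<integral> y. \<psi> y \<partial>lebesgue) * gauss t x
       - (if k = 2 then (\<Sum>j\<in>UNIV. (\<integral> y. y $ j * \<psi> y \<partial>lebesgue) * (x $ j / (2 * t) * gauss t x)) else 0)\<bar>
    \<le> C / sqrt t ^ k * (gauss (2 * t) x + heat t (\<lambda>y. norm y ^ k * \<bar>\<psi> y\<bar>) x)"
proof -
  obtain C where C: "C > 0" "\<And>t x y. t > 0 \<Longrightarrow>
      \<bar>gauss t (x - y) - gauss t x - (if k = 2 then (x \<bullet> y) / (2 * t) * gauss t x else 0)\<bar>
       \<le> C * (norm y / sqrt t) ^ k * (gauss (2 * t) x + gauss t (x - y :: real ^ 'n))"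
    using gauss_taylor_le[OF k] by blast
  define m where "m = (\<integral> y. norm y ^ k * \<bar>\<psi> y\<bar> \<partial>lebesgue)"
  have \<psi>k: "integrable lebesgue (\<lambda>y. norm y ^ k * \<bar>\<psi> y\<bar>)"
    using integrable_abs[OF \<psi>(2)] by (simp add: abs_mult)
  have m0: "0 \<le> m" by (simp add: m_def)
  have "\<bar>heat t \<psi> x - (\<integral> y. \<psi> y \<partial>lebesgue) * gauss t x
       - (if k = 2 then (\<Sum>j\<in>UNIV. (\<integral> y. y $ j * \<psi> y \<partial>lebesgue) * (x $ j / (2 * t) * gauss t x)) else 0)\<bar>
    \<le> C * (1 + m) / sqrt t ^ k * (gauss (2 * t) x + heat t (\<lambda>y. norm y ^ k * \<bar>\<psi> y\<bar>) x)"
    if t: "t > 0" for t x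
  proof -
    define l where "l = (\<lambda>y. if k = 2 then (x \<bullet> y) / (2 * t) * gauss t x else 0)"
    have lsum: "l y * \<psi> y = (if k = 2 then (\<Sum>j\<in>UNIV. (x $ j / (2 * t) * gauss t x) * (y $ j * \<psi> y)) else 0)" for y
      by (simp add: l_def inner_vec_def sum_distrib_left sum_distrib_right sum_divide_distrib mult_ac)
    have li: "integrable lebesgue (\<lambda>y. l y * \<psi> y)"
      unfolding lsum using \<psi>j by (cases "k = 2") auto
    have lI: "(\<integral> y. l y * \<psi> y \<partial>lebesgue)
        = (if k = 2 then (\<Sum>j\<in>UNIV. (\<integral> y. y $ j * \<psi> y \<partial>lebesgue) * (x $ j / (2 * t) * gauss t x)) else 0)"
      unfolding lsum using \<psi>j by (cases "k = 2") (auto simp: mult.commute)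
    note g = gauss_mult_integrable[OF t \<psi>(1), of x]
    note gk = gauss_mult_integrable[OF t \<psi>k, of x]
    have "\<bar>heat t \<psi> x - (\<integral> y. \<psi> y \<partial>lebesgue) * gauss t x - (\<integral> y. l y * \<psi> y \<partial>lebesgue)\<bar>
        = \<bar>\<integral> y. gauss t (x - y) * \<psi> y - gauss t x * \<psi> y - l y * \<psi> y \<partial>lebesgue\<bar>"
      using t g li \<psi>(1) by (simp add: heat_def mult.commute)
    also have "\<dots> \<le> (\<integral> y. C / sqrt t ^ k * (gauss (2 * t) x * (norm y ^ k * \<bar>\<psi> y\<bar>)
        + gauss t (x - y) * (norm y ^ k * \<bar>\<psi> y\<bar>)) \<partial>lebesgue)"
    proof (rule abs_integral_le_integral)
      fix y :: "real ^ 'n"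
      have "\<bar>gauss t (x - y) * \<psi> y - gauss t x * \<psi> y - l y * \<psi> y\<bar>
          = \<bar>(gauss t (x - y) - gauss t x - l y) * \<psi> y\<bar>"
        by (simp add: algebra_simps)
      also have "\<dots> \<le> (C * (norm y / sqrt t) ^ k * (gauss (2 * t) x + gauss t (x - y))) * \<bar>\<psi> y\<bar>"
        unfolding abs_mult l_def by (intro mult_right_mono C(2) t) simp
      also have "\<dots> = C / sqrt t ^ k * (gauss (2 * t) x * (norm y ^ k * \<bar>\<psi> y\<bar>)
        + gauss t (x - y) * (norm y ^ k * \<bar>\<psi> y\<bar>))"
        by (simp add: power_divide algebra_simps add_divide_distrib)
      finally show "\<bar>gauss t (x - y) * \<psi> y - gauss t x * \<psi> y - l y * \<psi> y\<bar>
        \<le> C / sqrt t ^ k * (gauss (2 * t) x * (norm y ^ k * \<bar>\<psi> y\<bar>)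
        + gauss t (x - y) * (norm y ^ k * \<bar>\<psi> y\<bar>))" .
    qed (use gk \<psi>k in auto)
    also have "\<dots> = C / sqrt t ^ k * (gauss (2 * t) x * m + heat t (\<lambda>y. norm y ^ k * \<bar>\<psi> y\<bar>) x)"
      using t gk \<psi>k by (simp add: heat_def m_def)
    also have "\<dots> \<le> C / sqrt t ^ k * ((1 + m) * (gauss (2 * t) x + heat t (\<lambda>y. norm y ^ k * \<bar>\<psi> y\<bar>) x))"
    proof (intro mult_left_mono)
      have "0 \<le> heat t (\<lambda>y. norm y ^ k * \<bar>\<psi> y\<bar>) x" using t by (simp add: heat_def)
      then have "0 \<le> m * heat t (\<lambda>y. norm y ^ k * \<bar>\<psi> y\<bar>) x" using m0 by simp
      then show "gauss (2 * t) x * m + heat t (\<lambda>y. norm y ^ k * \<bar>\<psi> y\<bar>) x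
          \<le> (1 + m) * (gauss (2 * t) x + heat t (\<lambda>y. norm y ^ k * \<bar>\<psi> y\<bar>) x)"
        using gauss_nonneg[of "2 * t" x] by (simp add: algebra_simps)
    qed (use C t in auto)
    finally show ?thesis unfolding lI by (simp add: mult_ac)
  qed
  moreover have "C * (1 + m) > 0" using C(1) m0 by simp
  ultimately show ?thesis by blast
qed

section \<open>Duality for the Duhamel difference and for the essential supremum\<close>

text \<open>Pairing with \<open>w\<close> and moving the semigroup to \<open>w\<close> leaves one
  integral over all times: up to \<open>t\<close> the test function is
  \<open>heat (t - s) w - heat t w\<close>, after \<open>t\<close> only \<open>heat t w\<close>
  remains, up to sign.\<close>

lemma duhamel_diff_le:
  fixes F :: "real \<Rightarrow> real ^ 'n \<Rightarrow> real"
  assumes F: "\<And>s. 0 \<le> s \<Longrightarrow> integrable lebesgue (F s)" and t: "0 \<le> t"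
    and \<Psi>t: "has_L1_integral {0..t} (\<lambda>s. heat (t - s) (F s)) \<Psi>t"
    and \<Psi>: "has_L1_integral {0..} F \<Psi>"
    and w: "w \<in> borel_measurable lebesgue" "\<And>x. \<bar>w x\<bar> \<le> B"
    and b: "integrable (lebesgue_on {0..}) b"
    and b1: "\<And>s. 0 \<le> s \<Longrightarrow> s \<le> t \<Longrightarrow> \<bar>\<integral> x. (heat (t - s) w x - heat t w x) * F s x \<partial>lebesgue\<bar> \<le> b s"
    and b2: "\<And>s. t < s \<Longrightarrow> \<bar>\<integral> x. heat t w x * F s x \<partial>lebesgue\<bar> \<le> b s"
  shows "\<bar>\<integral> x. w x * (\<Psi>t x - heat t \<Psi> x) \<partial>lebesgue\<bar> \<le> (\<integral> s. b s \<partial>lebesgue_on {0..})"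
proof -
  have i: "integrable lebesgue \<Psi>t" "integrable lebesgue \<Psi>"
    using \<Psi>t \<Psi> by (auto simp: has_L1_integral_def Lspace_1_iff)
  have J: "{0..t} \<in> sets lebesgue" "{0::real..} \<in> sets lebesgue" by auto
  note hw = borel_measurable_heat[OF w(1)] and hB = abs_heat_le[of w B, OF w(2)]
  define P1 where "P1 = (\<lambda>s. \<integral> x. heat (t - s) w x * F s x \<partial>lebesgue)"
  define P2 where "P2 = (\<lambda>s. \<integral> x. heat t w x * F s x \<partial>lebesgue)"
  have P1: "(\<integral> x. w x * heat (t - s) (F s) x \<partial>lebesgue) = P1 s" if "s \<in> {0..t}" for s
    unfolding P1_def using F that w by (intro heat_pairing) auto
  have 1: "integrable lebesgue (\<lambda>s. indicator {0..t} s * P1 s)"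
    "(\<integral> s. indicator {0..t} s * P1 s \<partial>lebesgue) = (\<integral> x. w x * \<Psi>t x \<partial>lebesgue)"
  proof -
    note p = has_L1_integral_pairing[OF J(1) \<Psi>t _ w]
    have e: "(\<lambda>s. indicator {0..t} s * (\<integral> x. w x * heat (t - s) (F s) x \<partial>lebesgue)) = (\<lambda>s. indicator {0..t} s * P1 s)"
      using P1 by (auto simp: indicator_def)
    show "integrable lebesgue (\<lambda>s. indicator {0..t} s * P1 s)"
      using p(1) F unfolding integral_lebesgue_on[OF J(1)] e by simp
    show "(\<integral> s. indicator {0..t} s * P1 s \<partial>lebesgue) = (\<integral> x. w x * \<Psi>t x \<partial>lebesgue)"
      using p(2) F unfolding integral_lebesgue_on[OF J(1)] e by simp
  qed
  have 2: "integrable lebesgue (\<lambda>s. indicator {0..} s * P2 s)"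
    "(\<integral> s. indicator {0..} s * P2 s \<partial>lebesgue) = (\<integral> x. w x * heat t \<Psi> x \<partial>lebesgue)"
  proof -
    note p = has_L1_integral_pairing[OF J(2) \<Psi> _ hw hB, of t]
    show "integrable lebesgue (\<lambda>s. indicator {0..} s * P2 s)"
      using p(1) F unfolding integral_lebesgue_on[OF J(2)] P2_def by simp
    show "(\<integral> s. indicator {0..} s * P2 s \<partial>lebesgue) = (\<integral> x. w x * heat t \<Psi> x \<partial>lebesgue)"
      using p(2) F unfolding integral_lebesgue_on[OF J(2)] P2_def heat_pairing[OF i(2) w] by simp
  qed
  have "\<bar>\<integral> x. w x * (\<Psi>t x - heat t \<Psi> x) \<partial>lebesgue\<bar>
      = \<bar>\<integral> s. indicator {0..t} s * P1 s - indicator {0..} s * P2 s \<partial>lebesgue\<bar>"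
    using 1 2 integrable_bounded_mult[OF i(1) w] integrable_bounded_mult[OF integrable_heat[OF i(2)] w]
    by (simp add: right_diff_distrib)
  also have "\<dots> \<le> (\<integral> s. indicator {0..} s * b s \<partial>lebesgue)"
  proof (rule abs_integral_le_integral)
    show "integrable lebesgue (\<lambda>s. indicator {0..} s * b s)" using b by (simp add: integral_lebesgue_on)
    fix s
    have "P1 s - P2 s = (\<integral> x. (heat (t - s) w x - heat t w x) * F s x \<partial>lebesgue)" if "0 \<le> s"
      unfolding P1_def P2_def
      using integrable_bounded_mult[OF F[OF that] hw hB, of "t - s"] integrable_bounded_mult[OF F[OF that] hw hB, of t]
      by (simp add: left_diff_distrib)
    then show "\<bar>indicator {0..t} s * P1 s - indicator {0..} s * P2 s\<bar> \<le> indicator {0..} s * b s"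
      using b1[of s] b2[of s] t by (auto simp: indicator_def P2_def)
  qed
  finally show ?thesis by (simp add: integral_lebesgue_on)
qed

text \<open>The converse of Hoelder's inequality: test with the sign of \<open>D\<close> on the set
  where \<open>\<bar>D\<bar> > B\<close>. There \<open>w * D - B * \<bar>w\<bar>\<close> is
  positive, so an integral that is at most zero forces the set to be null. Integrability of the test
  function follows from \<open>\<bar>w\<bar> \<le> \<bar>D\<bar> / B\<close>.\<close>

lemma AE_abs_le_by_duality:
  fixes D :: "'a \<Rightarrow> real"
  assumes D: "integrable M D" and B: "0 < B"
    and dual: "\<And>w. integrable M w \<Longrightarrow> (\<And>x. \<bar>w x\<bar> \<le> 1) \<Longrightarrow>
      \<bar>\<integral> x. w x * D x \<partial>M\<bar> \<le> B * (\<integral> x. \<bar>w x\<bar> \<partial>M)"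
  shows "AE x in M. \<bar>D x\<bar> \<le> B"
proof -
  have [measurable]: "D \<in> borel_measurable M" using D by simp
  define w where "w = (\<lambda>x. if \<bar>D x\<bar> > B then sgn (D x) else 0)"
  have [measurable]: "w \<in> borel_measurable M" unfolding w_def by measurable
  have wi: "integrable M w"
  proof (rule Bochner_Integration.integrable_bound[of M "\<lambda>x. D x / B"])
    have "\<bar>w x\<bar> \<le> \<bar>D x\<bar> / B" for x
      using B by (cases "\<bar>D x\<bar> > B") (auto simp: w_def abs_sgn_eq pos_le_divide_eq)
    then show "AE x in M. norm (w x) \<le> norm (D x / B)" using B by simp
  qed (use D in auto)
  have w1: "\<bar>w x\<bar> \<le> 1" for x by (simp add: w_def sgn_if)
  define e where "e = (\<lambda>x. w x * D x - B * \<bar>w x\<bar>)"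
  have e0: "0 \<le> e x" for x using B by (auto simp: e_def w_def sgn_if)
  have wD: "integrable M (\<lambda>x. w x * D x)" using D w1 by (intro integrable_bounded_mult) auto
  have ei: "integrable M e" unfolding e_def using wi wD by auto
  have "(\<integral> x. e x \<partial>M) \<le> 0"
    unfolding e_def using wi wD dual[OF wi w1] by simp
  moreover have "0 \<le> (\<integral> x. e x \<partial>M)" using e0 by simp
  ultimately have "(\<integral> x. e x \<partial>M) = 0" by simp
  then have "AE x in M. e x = 0" using ei e0 by (subst (asm) integral_nonneg_eq_0_iff_AE) auto
  then show ?thesis
  proof eventually_elim
    fix x assume "e x = 0"
    with B show "\<bar>D x\<bar> \<le> B" by (auto simp: e_def w_def sgn_if split: if_splits)
  qed
qed

section \<open>Decaying solutions of the integral equation\<close>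

lemma powr_times_sqrt_power:
  fixes s \<beta> :: real
  assumes "0 \<le> s"
  shows "(1 + s) powr - \<beta> * sqrt (1 + s) ^ k = (1 + s) powr - (\<beta> - real k / 2)"
proof -
  have "sqrt (1 + s) ^ k = (1 + s) powr (real k / 2)"
    using assms by (simp add: powr_half_sqrt[symmetric] powr_realpow[symmetric] powr_powr)
  then show ?thesis by (simp add: powr_add[symmetric])
qed

text \<open>As \<open>s \<le> t\<close> and \<open>k \<le> 2\<close>, one has s/t \<le> (s/t)^(k/2),
  and s^(k/2) is then paid for by the decay in \<open>s\<close>. The factor \<open>2\<close> matches
  the majorant of the late times.\<close>

lemma time_weight_early:
  fixes s t :: real
  assumes "k \<le> 2" "0 \<le> s" "s \<le> t / 2" "0 < t"
  shows "(s / t) * (1 + s) powr - \<beta> \<le> 2 / sqrt t ^ k * (1 + s) powr - (\<beta> - real k / 2)"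
proof -
  define r where "r = s / t"
  have r: "0 \<le> r" "r \<le> 1" using assms by (auto simp: r_def field_simps)
  have "r = sqrt r ^ 2" using r by simp
  also have "\<dots> \<le> sqrt r ^ k" using assms r by (intro power_decreasing) auto
  also have "\<dots> = sqrt s ^ k / sqrt t ^ k" by (simp add: r_def real_sqrt_divide power_divide)
  also have "\<dots> \<le> sqrt (1 + s) ^ k / sqrt t ^ k"
    using assms by (intro divide_right_mono power_mono) auto
  also have "\<dots> \<le> 2 * (sqrt (1 + s) ^ k / sqrt t ^ k)"
  proof -
    have "0 \<le> sqrt (1 + s) ^ k / sqrt t ^ k" using assms by simp
    then show ?thesis by linarith
  qed
  finally have "(s / t) * (1 + s) powr - \<beta> \<le> 2 * (sqrt (1 + s) ^ k / sqrt t ^ k) * (1 + s) powr - \<beta>"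
    unfolding r_def by (rule mult_right_mono) simp
  also have "\<dots> = 2 / sqrt t ^ k * ((1 + s) powr - \<beta> * sqrt (1 + s) ^ k)" by simp
  finally show ?thesis using powr_times_sqrt_power[OF assms(2), of \<beta> k] by simp
qed

text \<open>From \<open>t / 2 \<le> s\<close> follows \<open>t \<le> 2 * (1 + s)\<close>, so t^(k/2)
  is at most \<open>sqrt 2 ^ k \<le> 2\<close> times (1 + s)^(k/2).\<close>

lemma time_weight_late:
  fixes s t :: real
  assumes "k \<le> 2" "t / 2 \<le> s" "0 < t"
  shows "(1 + s) powr - \<beta> \<le> 2 / sqrt t ^ k * (1 + s) powr - (\<beta> - real k / 2)"
proof -
  have s: "0 \<le> s" using assms by linarith
  have "sqrt 2 ^ k \<le> sqrt 2 ^ 2" using assms by (intro power_increasing) auto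
  then have 2: "sqrt 2 ^ k \<le> 2" by simp
  have "sqrt t ^ k = sqrt 2 ^ k * sqrt (t / 2) ^ k" by (simp add: power_mult_distrib[symmetric] real_sqrt_mult[symmetric])
  also have "\<dots> \<le> 2 * sqrt (1 + s) ^ k"
    using assms 2 by (intro mult_mono power_mono) auto
  finally have "1 \<le> 2 * sqrt (1 + s) ^ k / sqrt t ^ k" using assms by (simp add: field_simps)
  then have "1 * (1 + s) powr - \<beta> \<le> (2 * sqrt (1 + s) ^ k / sqrt t ^ k) * (1 + s) powr - \<beta>"
    by (rule mult_right_mono) simp
  also have "\<dots> = 2 / sqrt t ^ k * ((1 + s) powr - \<beta> * sqrt (1 + s) ^ k)" by simp
  finally show ?thesis using powr_times_sqrt_power[OF s, of \<beta> k] by simp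
qed

text \<open>\<open>E\<close> is the exponential of \<open>4 a0\<close> times the integral of \<open>(1 + s)\<^sup>-\<^sup>\<beta>\<close> over \<open>{0..t}\<close>; measuring
  moments relative to \<open>E\<close> makes the integral term of Duhamel's formula a contraction.\<close>

lemma gronwall_weight:
  fixes a0 \<beta> :: real
  assumes a0: "0 < a0" and \<beta>: "1 < \<beta>"
  obtains E M where "\<And>t. 0 \<le> t \<Longrightarrow> 1 \<le> E t" "\<And>t. 0 \<le> t \<Longrightarrow> E t \<le> (M :: real)"
    "\<And>t. 0 \<le> t \<Longrightarrow> integrable (lebesgue_on {0..t}) (\<lambda>s. 4 * (a0 * (1 + s) powr - \<beta> * E s))"
    "\<And>t. 0 \<le> t \<Longrightarrow> (\<integral> s. 4 * (a0 * (1 + s) powr - \<beta> * E s) \<partial>lebesgue_on {0..t}) \<le> E t"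
proof
  \<comment> \<open>With this constant the derivative of
    \<open>- c * (1 + s) powr (1 - \<beta>)\<close> is
    \<open>4 * a0 * (1 + s) powr - \<beta>\<close>. Of the factor \<open>4\<close>, one
    \<open>2\<close> is the coefficient of the weight in \<open>abs_heat_weight_le\<close>, the
    other makes the contraction constant \<open>1 / 2\<close>.\<close>
  define c where "c = 4 * a0 / (\<beta> - 1)"
  define E where "E = (\<lambda>s::real. exp (c - c * (1 + s) powr (1 - \<beta>)))"
  have c0: "0 < c" using a0 \<beta> by (simp add: c_def)
  show "1 \<le> E t" if "0 \<le> t" for t
  proof -
    have "(1 + t) powr (1 - \<beta>) \<le> 1" using that \<beta> powr_mono2'[of "1 - \<beta>" 1 "1 + t"] by simp
    then show ?thesis using c0 by (simp add: E_def mult_left_le)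
  qed
  show "E t \<le> exp c" for t using c0 by (simp add: E_def)
  define e where "e = (\<lambda>s. 4 * (a0 * (1 + s) powr - \<beta> * E s))"
  have cont: "continuous_on {0..t} e" for t
    unfolding e_def E_def by (intro continuous_intros) auto
  fix t :: real assume t: "0 \<le> t"
  show i: "integrable (lebesgue_on {0..t}) e" by (rule continuous_imp_integrable_real[OF cont])
  have "(e has_integral (E t - E 0)) {0..t}"
  proof (rule fundamental_theorem_of_calculus[OF t])
    fix s assume "s \<in> {0..t}"
    then have "(E has_real_derivative E s * (- (c * ((1 - \<beta>) * (1 + s) powr - \<beta>)))) (at s)"
      unfolding E_def by (auto intro!: derivative_eq_intros)
    moreover have "E s * (- (c * ((1 - \<beta>) * (1 + s) powr - \<beta>))) = e s"
      using \<beta> by (simp add: e_def c_def field_simps)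
    ultimately show "(E has_vector_derivative e s) (at s within {0..t})"
      by (simp add: has_real_derivative_iff_has_vector_derivative has_vector_derivative_at_within)
  qed
  then have "integral {0..t} e = E t - E 0" by (rule integral_unique)
  moreover have "integral\<^sup>L (lebesgue_on {0..t}) e = integral {0..t} e"
    using i by (intro lebesgue_integral_eq_integral) auto
  ultimately show "integral\<^sup>L (lebesgue_on {0..t}) e \<le> E t" by (simp add: E_def)
qed

section \<open>Duhamel's formula with a decaying source\<close>

text \<open>\<open>F s\<close> stands for \<open>f (u s)\<close>, and the nonlinearity is seen only
  through its decay and its continuity in time. \<open>F_le\<close> is relative to
  \<open>\<bar>u s x\<bar>\<close>, so that moments of \<open>F\<close> can be estimated by moments
  of \<open>u\<close>. The Duhamel term is some representative, since a Bochner integral is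
  determined only almost everywhere.\<close>

locale decaying_duhamel =
  fixes F u :: "real \<Rightarrow> real ^ 'n \<Rightarrow> real" and \<phi> :: "real ^ 'n \<Rightarrow> real"
    and k :: nat and \<beta> a0 Cu :: real
  assumes k: "k = 1 \<or> k = 2" and \<beta>: "\<beta> > 1 + real k / 2"
    and a0: "0 < a0" and Cu: "0 < Cu"
    and \<phi>: "integrable lebesgue \<phi>" "integrable lebesgue (\<lambda>x. norm x ^ k * \<phi> x)"
    and u_int: "\<And>s. 0 \<le> s \<Longrightarrow> integrable lebesgue (u s)"
    and u_L1: "\<And>s. 0 \<le> s \<Longrightarrow> (\<integral> x. \<bar>u s x\<bar> \<partial>lebesgue) \<le> Cu"
    and F_int: "\<And>s. 0 \<le> s \<Longrightarrow> integrable lebesgue (F s)"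
    and F_le: "\<And>s. 0 \<le> s \<Longrightarrow> AE x in lebesgue. \<bar>F s x\<bar> \<le> a0 * (1 + s) powr - \<beta> * \<bar>u s x\<bar>"
    and F_sup: "\<And>s. 0 \<le> s \<Longrightarrow>
      AE x in lebesgue. \<bar>F s x\<bar> \<le> a0 * (1 + s) powr - \<beta> * (1 + s) powr (- real CARD('n) / 2)"
    and F_cont: "\<And>t. 0 \<le> t \<Longrightarrow>
      ((\<lambda>s. \<integral> x. \<bar>F s x - F t x\<bar> \<partial>lebesgue) \<longlongrightarrow> 0) (at t within {0..})"
    and duhamel: "\<And>t. 0 \<le> t \<Longrightarrow> \<exists>\<Psi>t. has_L1_integral {0..t} (\<lambda>s. heat (t - s) (F s)) \<Psi>t \<and>
      (AE x in lebesgue. u t x = heat t \<phi> x + \<Psi>t x)"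
begin

lemma k2: "k \<le> 2" and \<beta>1: "\<beta> > 1"
  using k \<beta> by auto

abbreviation J\<gamma> :: real where
  "J\<gamma> \<equiv> \<integral> s. (1 + s) powr - (\<beta> - real k / 2) \<partial>lebesgue_on {0..}"

lemma integrable_time: "integrable (lebesgue_on {0..}) (\<lambda>s. (1 + s) powr - (\<beta> - real k / 2))"
  using \<beta> by (intro powr_integrable_on_atLeast) simp

text \<open>Later constants have to be positive; adding \<open>1\<close> provides this without
  evaluating the integral.\<close>

lemma J\<gamma>_pos: "0 < J\<gamma> + 1"
proof -
  have "0 \<le> J\<gamma>" by simp
  then show ?thesis by linarith
qed

text \<open>\<open>b\<close> is a variable majorant of the test function: a truncated weight,
  possibly with a constant added, in the moment estimates, and a constant in
  \<open>pairing_F_le\<close>. The bound \<open>B\<close> guarantees integrability and does not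
  appear in the result.\<close>

lemma pairing_F_weight_le:
  assumes s: "0 \<le> s" and v: "v \<in> borel_measurable lebesgue" "\<And>x. \<bar>v x\<bar> \<le> b x"
    and b: "b \<in> borel_measurable lebesgue" "\<And>x. b x \<le> B"
  shows "\<bar>\<integral> x. v x * F s x \<partial>lebesgue\<bar> \<le> a0 * (1 + s) powr - \<beta> * (\<integral> x. b x * \<bar>u s x\<bar> \<partial>lebesgue)"
proof -
  have b0: "0 \<le> b x" for x using v(2)[of x] by linarith
  then have bB: "\<bar>b x\<bar> \<le> B" for x using b(2) by simp
  have bF: "integrable lebesgue (\<lambda>x. b x * \<bar>F s x\<bar>)" "integrable lebesgue (\<lambda>x. b x * \<bar>u s x\<bar>)"
    using F_int[OF s] u_int[OF s] b(1) bB by (auto intro!: integrable_bounded_mult)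
  have "\<bar>\<integral> x. v x * F s x \<partial>lebesgue\<bar> \<le> (\<integral> x. b x * \<bar>F s x\<bar> \<partial>lebesgue)"
    using bF(1) v(2) by (rule abs_integral_mult_le)
  also have "\<dots> \<le> (\<integral> x. a0 * (1 + s) powr - \<beta> * (b x * \<bar>u s x\<bar>) \<partial>lebesgue)"
  proof (rule integral_mono_AE)
    show "AE x in lebesgue. b x * \<bar>F s x\<bar> \<le> a0 * (1 + s) powr - \<beta> * (b x * \<bar>u s x\<bar>)"
      using F_le[OF s] by eventually_elim (use b0 mult_left_mono in \<open>fastforce simp: mult_ac\<close>)
  qed (use bF in auto)
  finally show ?thesis by simp
qed

lemma pairing_F_le:
  assumes s: "0 \<le> s" and v: "v \<in> borel_measurable lebesgue" "\<And>x. \<bar>v x\<bar> \<le> Q"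
  shows "\<bar>\<integral> x. v x * F s x \<partial>lebesgue\<bar> \<le> a0 * Cu * Q * (1 + s) powr - \<beta>"
proof -
  have Q: "0 \<le> Q" using v(2)[of 0] by linarith
  have "\<bar>\<integral> x. v x * F s x \<partial>lebesgue\<bar> \<le> a0 * (1 + s) powr - \<beta> * (\<integral> x. Q * \<bar>u s x\<bar> \<partial>lebesgue)"
    using s v by (rule pairing_F_weight_le) auto
  also have "\<dots> \<le> a0 * (1 + s) powr - \<beta> * (Q * Cu)"
    using a0 Q u_L1[OF s] by (auto intro!: mult_left_mono)
  finally show ?thesis by (simp add: mult_ac)
qed

lemma pairing_F_sup_le:
  assumes s: "0 \<le> s" and v: "integrable lebesgue v" "\<And>x. \<bar>v x\<bar> \<le> B"
  shows "\<bar>\<integral> x. v x * F s x \<partial>lebesgue\<bar>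
    \<le> a0 * (1 + s) powr - \<beta> * (1 + s) powr (- real CARD('n) / 2) * (\<integral> x. \<bar>v x\<bar> \<partial>lebesgue)"
proof -
  define a where "a = a0 * (1 + s) powr - \<beta> * (1 + s) powr (- real CARD('n) / 2)"
  have vF: "integrable lebesgue (\<lambda>x. v x * F s x)"
    using integrable_bounded_mult[OF F_int[OF s] _ v(2)] v(1) by simp
  have "\<bar>\<integral> x. v x * F s x \<partial>lebesgue\<bar> \<le> (\<integral> x. \<bar>v x * F s x\<bar> \<partial>lebesgue)" by (rule integral_abs_bound)
  also have "\<dots> \<le> (\<integral> x. a * \<bar>v x\<bar> \<partial>lebesgue)"
  proof (rule integral_mono_AE)
    show "AE x in lebesgue. \<bar>v x * F s x\<bar> \<le> a * \<bar>v x\<bar>"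
      using F_sup[OF s] unfolding a_def[symmetric]
    proof eventually_elim
      fix x assume "\<bar>F s x\<bar> \<le> a"
      then show "\<bar>v x * F s x\<bar> \<le> a * \<bar>v x\<bar>"
        using mult_right_mono[of "\<bar>F s x\<bar>" a "\<bar>v x\<bar>"] by (simp add: abs_mult mult_ac)
    qed
  qed (use vF v in auto)
  finally show ?thesis by (simp add: a_def)
qed

lemma F_L1: "0 \<le> s \<Longrightarrow> (\<integral> x. \<bar>F s x\<bar> \<partial>lebesgue) \<le> a0 * Cu * (1 + s) powr - \<beta>"
proof -
  assume s: "0 \<le> s"
  have "(\<integral> x. \<bar>F s x\<bar> \<partial>lebesgue) = (\<integral> x. sgn (F s x) * F s x \<partial>lebesgue)"
    by (simp add: abs_sgn mult.commute)
  also have "\<dots> \<le> a0 * Cu * 1 * (1 + s) powr - \<beta>"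
    using F_int[OF s] by (intro order_trans[OF abs_ge_self pairing_F_le[OF s]]) (auto simp: sgn_if)
  finally show ?thesis by simp
qed

lemma L1_integrable_F: "L1_integrable {0..} F"
proof (rule L1_integrable_continuous[OF F_int F_cont])
  fix s s' :: real assume s: "0 \<le> s" "s \<le> s'" "s' \<le> s + 1"
  have "(\<integral> x. \<bar>F s x\<bar> \<partial>lebesgue) \<le> a0 * Cu * (1 + s) powr - \<beta>" by (rule F_L1[OF s(1)])
  \<comment> \<open>At most one unit of time separates \<open>s\<close> and \<open>s'\<close>, hence
    \<open>(1 + s') / 2 \<le> 1 + s\<close>; this is the origin of \<open>2 powr \<beta>\<close> in
    the majorant.\<close>
  also have "\<dots> \<le> a0 * Cu * ((1 + s') / 2) powr - \<beta>"
    using s a0 Cu \<beta>1 by (intro mult_left_mono powr_mono2') auto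
  also have "\<dots> = a0 * Cu * 2 powr \<beta> * (1 + s') powr - \<beta>"
    using s by (simp add: powr_divide powr_minus field_simps)
  finally show "(\<integral> x. \<bar>F s x\<bar> \<partial>lebesgue) \<le> a0 * Cu * 2 powr \<beta> * (1 + s') powr - \<beta>" .
next
  show "integrable (lebesgue_on {0..}) (\<lambda>s. a0 * Cu * 2 powr \<beta> * (1 + s) powr - \<beta>)"
    using powr_integrable_on_atLeast[OF \<beta>1] by simp
qed auto

section \<open>Moments of the solution and of the integrated source\<close>

text \<open>Gronwall's inequality in supremum form: \<open>S\<close> is the supremum over time of
  the truncated moment divided by \<open>sqrt (1 + t) ^ k * E t\<close>. Duhamel's formula yields
  \<open>S \<le> Q + S / 2\<close> with \<open>Q\<close> free of \<open>R\<close>, and since the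
  truncation makes \<open>S\<close> finite, \<open>S \<le> 2 * Q\<close>.\<close>

lemma solution_moment_le:
  obtains M where "0 < M" "\<And>R t. 0 < R \<Longrightarrow> 0 \<le> t \<Longrightarrow>
    (\<integral> x. weight k R x * \<bar>u t x\<bar> \<partial>lebesgue) \<le> M * sqrt (1 + t) ^ k"
proof -
  obtain E ME where E: "\<And>t. 0 \<le> t \<Longrightarrow> 1 \<le> E t" "\<And>t. 0 \<le> t \<Longrightarrow> E t \<le> ME"
    and Ei: "\<And>t. 0 \<le> t \<Longrightarrow> integrable (lebesgue_on {0..t}) (\<lambda>s. 4 * (a0 * (1 + s) powr - \<beta> * E s))"
    and EI: "\<And>t. 0 \<le> t \<Longrightarrow> (\<integral> s. 4 * (a0 * (1 + s) powr - \<beta> * E s) \<partial>lebesgue_on {0..t}) \<le> E t"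
    using gronwall_weight[OF a0 \<beta>1] by blast
  define D where "D = 2 * (exp 19 * 2 powr (real CARD('n) / 2))"
  have D0: "0 \<le> D" by (simp add: D_def)
  define n1 where "n1 = (\<integral> x. \<bar>\<phi> x\<bar> \<partial>lebesgue)"
  define nk where "nk = (\<integral> x. norm x ^ k * \<bar>\<phi> x\<bar> \<partial>lebesgue)"
  define I where "I = (\<integral> s. (1 + s) powr - \<beta> \<partial>lebesgue_on {0..})"
  have \<phi>k: "integrable lebesgue (\<lambda>x. norm x ^ k * \<bar>\<phi> x\<bar>)"
    using integrable_abs[OF \<phi>(2)] by (simp add: abs_mult)
  have pos: "0 \<le> n1" "0 \<le> nk" "0 \<le> I" by (auto simp: n1_def nk_def I_def)
  \<comment> \<open>The three summands come from the moment of the data, from the spreading of the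
    data by the heat flow, and from the spreading of the source.\<close>
  define Q where "Q = 2 * nk + D * n1 + D * Cu * a0 * I"
  have Q0: "0 \<le> Q" using pos D0 a0 Cu by (simp add: Q_def)
  have main: "(\<integral> x. weight k R x * \<bar>u t x\<bar> \<partial>lebesgue) \<le> 2 * Q * ME * sqrt (1 + t) ^ k"
    if R: "0 < R" and t: "0 \<le> t" for R t
  proof -
    define W :: "real ^ 'n \<Rightarrow> real" where "W = weight k R"
    have W: "W \<in> borel_measurable lebesgue" "\<And>x. 0 \<le> W x" "\<And>x. W x \<le> R ^ k" "\<And>x. \<bar>W x\<bar> \<le> R ^ k"
      "\<And>x. W x \<le> norm x ^ k"
      using R
      by (auto simp: W_def intro!: borel_measurable_lebesgueI weight_le weight_nonneg abs_weight_le)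
    define m where "m = (\<lambda>t. \<integral> x. W x * \<bar>u t x\<bar> \<partial>lebesgue)"
    have m0: "0 \<le> m s" for s unfolding m_def using W(2) by simp
    define q where "q = (\<lambda>t. sqrt (1 + t) ^ k)"
    have q1: "1 \<le> q s" if "0 \<le> s" for s using that by (simp add: q_def)
    have mb: "m s \<le> R ^ k * Cu" if "0 \<le> s" for s
    proof -
      have "m s \<le> R ^ k * (\<integral> x. \<bar>\<bar>u s x\<bar>\<bar> \<partial>lebesgue)" unfolding m_def
        by (rule order_trans[OF abs_ge_self integral_bounded_mult_le]) (use u_int[OF that] W in auto)
      also have "\<dots> \<le> R ^ k * Cu" using u_L1[OF that] R by simp
      finally show ?thesis .
    qed
    define S where "S = (SUP s\<in>{0..}. m s / (q s * E s))"
    have qE: "1 \<le> q s * E s" if "0 \<le> s" for s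
      using mult_mono[OF q1[OF that] E(1)[OF that]] q1[OF that] by simp
    \<comment> \<open>This is where truncation is needed: the bound \<open>R ^ k * Cu\<close>
      depends on \<open>R\<close>, but it serves only to make \<open>S\<close> a genuine
      supremum.\<close>
    have bdd: "bdd_above ((\<lambda>s. m s / (q s * E s)) ` {0..})"
    proof (rule bdd_aboveI2)
      fix s :: real assume "s \<in> {0..}"
      then have "m s / (q s * E s) \<le> m s / 1"
        using m0[of s] qE[of s] by (intro divide_left_mono) auto
      then show "m s / (q s * E s) \<le> R ^ k * Cu" using mb[of s] \<open>s \<in> {0..}\<close> by simp
    qed
    have mS: "m s \<le> S * (q s * E s)" if "0 \<le> s" for s
    proof -
      have "m s / (q s * E s) \<le> S" unfolding S_def using bdd that by (intro cSUP_upper) auto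
      then show ?thesis using qE[OF that] by (simp add: pos_divide_le_eq)
    qed
    have S0: "0 \<le> S"
      using mS[of 0] m0[of 0] qE[of 0] mult_neg_pos[of S "q 0 * E 0"] by linarith
    have step: "m t \<le> q t * (Q + S / 2 * E t)" if t: "0 \<le> t" for t
    proof -
      obtain \<Psi> where \<Psi>: "has_L1_integral {0..t} (\<lambda>s. heat (t - s) (F s)) \<Psi>"
        "AE x in lebesgue. u t x = heat t \<phi> x + \<Psi> x" using duhamel[OF t] by blast
      have \<Psi>i: "integrable lebesgue \<Psi>" using \<Psi>(1) by (simp add: has_L1_integral_def Lspace_1_iff)
      \<comment> \<open>Pairing with the weight times the sign of the solution recovers the weighted
        L^1 norm, and the semigroup can be moved to this bounded function.\<close>
      define w where "w = (\<lambda>x. W x * sgn (u t x))"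
      have w12: "w \<in> borel_measurable lebesgue" "\<bar>w x\<bar> \<le> W x" for x
        using W(1,2) u_int[OF t] by (auto simp: w_def abs_mult sgn_if)
      note w = w12 order_trans[OF w12(2) W(3)]
      have hw: "\<bar>heat \<tau> w y\<bar> \<le> 2 * W y + D * sqrt \<tau> ^ k" if "0 \<le> \<tau>" for \<tau> y
        unfolding W_def D_def using R that w(1) w(2)[unfolded W_def]
        by (intro abs_heat_weight_le[OF k2]) auto
      have "m t = (\<integral> x. w x * heat t \<phi> x + w x * \<Psi> x \<partial>lebesgue)"
        unfolding m_def
      proof (rule integral_cong_AE)
        show "AE x in lebesgue. W x * \<bar>u t x\<bar> = w x * heat t \<phi> x + w x * \<Psi> x"
          using \<Psi>(2) by eventually_elim (simp add: w_def abs_sgn algebra_simps)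
      qed (use W u_int[OF t] w \<Psi>i integrable_heat[OF \<phi>(1), of t] in auto)
      also have "\<dots> = (\<integral> x. w x * heat t \<phi> x \<partial>lebesgue) + (\<integral> x. w x * \<Psi> x \<partial>lebesgue)"
        using integrable_bounded_mult[OF integrable_heat[OF \<phi>(1)] w(1,3)] integrable_bounded_mult[OF \<Psi>i w(1,3)]
        by (rule Bochner_Integration.integral_add)
      also have "(\<integral> x. w x * heat t \<phi> x \<partial>lebesgue) \<le> q t * (2 * nk + D * n1)"
      proof -
        have tq: "sqrt t ^ k \<le> q t" unfolding q_def using t by (intro power_mono) auto
        have "(\<integral> x. w x * heat t \<phi> x \<partial>lebesgue) = (\<integral> x. heat t w x * \<phi> x \<partial>lebesgue)"
          by (rule heat_pairing[OF \<phi>(1) w(1,3)])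
        also have "\<dots> \<le> (\<integral> x. 2 * (norm x ^ k * \<bar>\<phi> x\<bar>) + D * sqrt t ^ k * \<bar>\<phi> x\<bar> \<partial>lebesgue)"
        proof (rule order_trans[OF abs_ge_self abs_integral_le_integral])
          fix x
          have "\<bar>heat t w x * \<phi> x\<bar> \<le> (2 * norm x ^ k + D * sqrt t ^ k) * \<bar>\<phi> x\<bar>"
            unfolding abs_mult using hw[OF t, of x] W(5)[of x] by (intro mult_right_mono) auto
          then show "\<bar>heat t w x * \<phi> x\<bar> \<le> 2 * (norm x ^ k * \<bar>\<phi> x\<bar>) + D * sqrt t ^ k * \<bar>\<phi> x\<bar>"
            by (simp add: algebra_simps)
        qed (use \<phi> \<phi>k in auto)
        also have "\<dots> = 2 * nk + sqrt t ^ k * (D * n1)" using \<phi> \<phi>k by (simp add: nk_def n1_def)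
        also have "\<dots> \<le> q t * (2 * nk) + q t * (D * n1)"
        proof (intro add_mono mult_right_mono)
          show "2 * nk \<le> q t * (2 * nk)" using mult_right_mono[OF q1[OF t], of "2 * nk"] pos by simp
        qed (use tq pos D0 in auto)
        finally show ?thesis by (simp add: algebra_simps)
      qed
      also have "(\<integral> x. w x * \<Psi> x \<partial>lebesgue) \<le> q t * (D * Cu * a0 * I + S / 2 * E t)"
      proof -
        have J: "{0..t} \<in> sets lebesgue" and J0: "{0::real..} \<in> sets lebesgue" by simp_all
        define a where "a = (\<lambda>s. a0 * (1 + s) powr - \<beta>)"
        have ai: "integrable (lebesgue_on {0..t}) a" "(\<integral> s. a s \<partial>lebesgue_on {0..t}) \<le> a0 * I"
        proof -
          have i0: "integrable (lebesgue_on {0..}) a"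
            unfolding a_def using powr_integrable_on_atLeast[OF \<beta>1] by simp
          then have i1: "integrable lebesgue (\<lambda>s. indicator {0..} s * a s)" by (simp add: integral_lebesgue_on)
          have "integrable lebesgue (\<lambda>s. indicator {0..t} s * (indicator {0..} s * a s))"
            by (rule integrable_bounded_mult[OF i1 borel_measurable_indicator, where B=1])
              (auto split: split_indicator)
          moreover have "(\<lambda>s. indicator {0..t} s * (indicator {0..} s * a s)) = (\<lambda>s. indicator {0..t} s * a s)"
            by (auto simp: indicator_def)
          ultimately have i2: "integrable lebesgue (\<lambda>s. indicator {0..t} s * a s)" by simp
          then show "integrable (lebesgue_on {0..t}) a" by (simp add: integral_lebesgue_on)
          have "(\<integral> s. a s \<partial>lebesgue_on {0..t}) \<le> (\<integral> s. a s \<partial>lebesgue_on {0..})"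
            using i1 i2 a0 unfolding integral_lebesgue_on(2)[OF J] integral_lebesgue_on(2)[OF J0]
            by (intro integral_mono) (auto simp: indicator_def a_def)
          then show "(\<integral> s. a s \<partial>lebesgue_on {0..t}) \<le> a0 * I" by (simp add: a_def I_def)
        qed
        have "(\<integral> x. w x * \<Psi> x \<partial>lebesgue) = (\<integral> s. (\<integral> x. w x * heat (t - s) (F s) x \<partial>lebesgue) \<partial>lebesgue_on {0..t})"
          using has_L1_integral_pairing(2)[OF J \<Psi>(1) _ w(1,3)] F_int by simp
        also have "\<dots> \<le> (\<integral> s. q t * (D * Cu * a s + S / 2 * (4 * (a s * E s))) \<partial>lebesgue_on {0..t})"
        proof (rule order_trans[OF abs_ge_self abs_integral_le_integral])
          show "integrable (lebesgue_on {0..t}) (\<lambda>s. q t * (D * Cu * a s + S / 2 * (4 * (a s * E s))))"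
            using Ei[OF t] ai(1) unfolding a_def
            by (intro integrable_mult_right Bochner_Integration.integrable_add) auto
          fix s assume "s \<in> space (lebesgue_on {0..t})"
          then have s: "0 \<le> s" "s \<le> t" by auto
          have a_s: "0 \<le> a s" using a0 by (simp add: a_def)
          have qs: "q s \<le> q t" "sqrt (t - s) ^ k \<le> q t"
            unfolding q_def using s by (auto intro!: power_mono)
          have "\<bar>\<integral> x. w x * heat (t - s) (F s) x \<partial>lebesgue\<bar> = \<bar>\<integral> x. heat (t - s) w x * F s x \<partial>lebesgue\<bar>"
            using F_int[OF s(1)] w by (subst heat_pairing) auto
          also have "\<dots> \<le> a s * (\<integral> x. (2 * W x + D * sqrt (t - s) ^ k) * \<bar>u s x\<bar> \<partial>lebesgue)"
            unfolding a_def using s w(1) W hw[of "t - s"]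
            by (intro pairing_F_weight_le[where B="2 * R ^ k + D * sqrt (t - s) ^ k"] borel_measurable_heat) auto
          also have "(\<integral> x. (2 * W x + D * sqrt (t - s) ^ k) * \<bar>u s x\<bar> \<partial>lebesgue)
              = 2 * m s + D * sqrt (t - s) ^ k * (\<integral> x. \<bar>u s x\<bar> \<partial>lebesgue)"
            unfolding m_def using integrable_bounded_mult[OF integrable_abs[OF u_int[OF s(1)]] W(1,4)] u_int[OF s(1)]
            by (simp add: distrib_right mult.assoc)
          \<comment> \<open>Here \<open>S\<close> re-enters; \<open>q s\<close> and
            \<open>sqrt (t - s) ^ k\<close> are both at most \<open>q t\<close>, which can be pulled
            out of the time integral.\<close>
          also have "a s * \<dots> \<le> a s * (2 * (S * (q t * E s)) + D * q t * Cu)"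
          proof (intro mult_left_mono add_mono mult_mono a_s)
            have "m s \<le> S * (q s * E s)" by (rule mS[OF s(1)])
            also have "\<dots> \<le> S * (q t * E s)"
              using S0 qs E(1)[OF s(1)] by (intro mult_left_mono mult_right_mono) auto
            finally show "m s \<le> S * (q t * E s)" .
          qed (use qs D0 u_L1[OF s(1)] s q1[OF t] in auto)
          also have "\<dots> = q t * (D * Cu * a s + S / 2 * (4 * (a s * E s)))" by (simp add: algebra_simps)
          finally show "\<bar>\<integral> x. w x * heat (t - s) (F s) x \<partial>lebesgue\<bar>
            \<le> q t * (D * Cu * a s + S / 2 * (4 * (a s * E s)))" .
        qed
        also have "\<dots> = q t * (D * Cu * (\<integral> s. a s \<partial>lebesgue_on {0..t})
            + S / 2 * (\<integral> s. 4 * (a s * E s) \<partial>lebesgue_on {0..t}))"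
        proof -
          have i1: "integrable (lebesgue_on {0..t}) (\<lambda>s. D * Cu * a s)" using ai(1) by simp
          have i2: "integrable (lebesgue_on {0..t}) (\<lambda>s. S / 2 * (4 * (a s * E s)))"
            using Ei[OF t] unfolding a_def by (rule integrable_mult_right)
          show ?thesis
            by (simp only: integral_mult_right_zero Bochner_Integration.integral_add[OF i1 i2])
        qed
        \<comment> \<open>The weighted time integral of \<open>E\<close> is at most
          \<open>E t\<close>; this produces the contracting term \<open>S / 2 * E t\<close>.\<close>
        also have "\<dots> \<le> q t * (D * Cu * (a0 * I) + S / 2 * E t)"
          using ai(2) EI[OF t] S0 D0 Cu q1[OF t] unfolding a_def
          by (intro mult_left_mono add_mono) auto
        finally show ?thesis by (simp add: mult_ac)
      qed
      finally show ?thesis by (simp add: Q_def algebra_simps)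
    qed
    \<comment> \<open>Since \<open>E s \<ge> 1\<close>, the inhomogeneous part \<open>Q\<close> is
      at most \<open>Q * E s\<close>, so division by \<open>q s * E s\<close> leaves a bound
      independent of \<open>s\<close>.\<close>
    have "S \<le> Q + S / 2"
      unfolding S_def
    proof (rule cSUP_least)
      fix s :: real assume "s \<in> {0..}"
      then have s: "0 \<le> s" by simp
      have "m s \<le> q s * (Q + S / 2 * E s)" by (rule step[OF s])
      also have "\<dots> \<le> q s * (Q * E s + S / 2 * E s)"
        using E(1)[OF s] Q0 q1[OF s] by (auto intro!: mult_left_mono simp: mult_le_cancel_left1)
      also have "\<dots> = (Q + S / 2) * (q s * E s)" by (simp add: algebra_simps)
      finally show "m s / (q s * E s) \<le> Q + (SUP s\<in>{0..}. m s / (q s * E s)) / 2"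
        unfolding S_def[symmetric] using qE[OF s] by (simp add: pos_divide_le_eq)
    qed simp
    then have S: "S \<le> 2 * Q" by simp
    have "m t \<le> S * (q t * E t)" by (rule mS[OF t])
    also have "\<dots> \<le> 2 * Q * (q t * ME)"
      using S S0 Q0 q1[OF t] E(1,2)[OF t] by (intro mult_mono) auto
    finally show ?thesis by (simp add: m_def q_def W_def mult_ac)
  qed
  have ME1: "1 \<le> ME" using E(1,2)[of 0] by simp
  show thesis
  proof (rule that[of "2 * Q * ME + 1"])
    show "0 < 2 * Q * ME + 1" using Q0 ME1 by (intro add_nonneg_pos) auto
    fix R t :: real assume "0 < R" "0 \<le> t"
    have "(\<integral> x. weight k R x * \<bar>u t x\<bar> \<partial>lebesgue) \<le> 2 * Q * ME * sqrt (1 + t) ^ k"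
      by (rule main) fact+
    also have "\<dots> \<le> (2 * Q * ME + 1) * sqrt (1 + t) ^ k"
      using \<open>0 \<le> t\<close> by (intro mult_right_mono) auto
    finally show "(\<integral> x. weight k R x * \<bar>u t x\<bar> \<partial>lebesgue) \<le> (2 * Q * ME + 1) * sqrt (1 + t) ^ k" .
  qed
qed

end

lemma scaled_powr_le:
  fixes t c :: real
  assumes "0 < t" "1 \<le> c"
  shows "(c * t) powr (- real n / 2) \<le> t powr (- real n / 2)"
  using assms by (intro powr_mono2') (auto simp: mult_le_cancel_right1)

context decaying_duhamel
begin

text \<open>The moment of \<open>F s\<close> is at most a multiple of (1 + s)^(k/2 - \<beta>), whose
  time integral converges because \<beta> > 1 + k/2; the bound is independent of
  \<open>R\<close>.\<close>

lemma integrable_integral_F_moment: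
  assumes \<Psi>: "has_L1_integral {0..} F \<Psi>"
  shows "integrable lebesgue (\<lambda>x. norm x ^ k * \<Psi> x)"
proof -
  have \<Psi>i: "integrable lebesgue \<Psi>" using \<Psi> by (simp add: has_L1_integral_def Lspace_1_iff)
  obtain M where M: "0 < M" "\<And>R t. 0 < R \<Longrightarrow> 0 \<le> t \<Longrightarrow>
    (\<integral> x. weight k R x * \<bar>u t x\<bar> \<partial>lebesgue) \<le> M * sqrt (1 + t) ^ k"
    using solution_moment_le by blast
  show ?thesis
  proof (rule integrable_norm_power[OF \<Psi>i])
    fix R :: real assume R: "0 < R"
    have m: "(weight k R :: real ^ 'n \<Rightarrow> real) \<in> borel_measurable lebesgue"
      by (intro borel_measurable_lebesgueI) measurable
    define w where "w = (\<lambda>x. weight k R x * sgn (\<Psi> x))"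
    have w12: "w \<in> borel_measurable lebesgue" "\<bar>w x\<bar> \<le> weight k R x" for x
      using m \<Psi>i weight_nonneg[of R k x] R by (auto simp: w_def abs_mult sgn_if)
    have w3: "\<bar>w x\<bar> \<le> R ^ k" for x
      by (rule order_trans[OF w12(2) weight_le(1)]) (use R in simp)
    have "(\<integral> x. weight k R x * \<bar>\<Psi> x\<bar> \<partial>lebesgue) = (\<integral> x. w x * \<Psi> x \<partial>lebesgue)"
      by (simp add: w_def abs_sgn mult_ac)
    also have "\<dots> = (\<integral> s. (\<integral> x. w x * F s x \<partial>lebesgue) \<partial>lebesgue_on {0..})"
      using has_L1_integral_pairing(2)[OF _ \<Psi> _ w12(1) w3] F_int by simp
    also have "\<dots> \<le> (\<integral> s. a0 * M * (1 + s) powr - (\<beta> - real k / 2) \<partial>lebesgue_on {0..})"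
    proof (rule order_trans[OF abs_ge_self abs_integral_le_integral])
      show "integrable (lebesgue_on {0..}) (\<lambda>s. a0 * M * (1 + s) powr - (\<beta> - real k / 2))"
        using integrable_time by (rule integrable_mult_right)
      fix s :: real assume "s \<in> space (lebesgue_on {0..})"
      then have s: "0 \<le> s" by simp
      have "\<bar>\<integral> x. w x * F s x \<partial>lebesgue\<bar> \<le> a0 * (1 + s) powr - \<beta> * (\<integral> x. weight k R x * \<bar>u s x\<bar> \<partial>lebesgue)"
        using s w12 m weight_le(1)[of R k] R by (intro pairing_F_weight_le[where B="R ^ k"]) auto
      also have "\<dots> \<le> a0 * (1 + s) powr - \<beta> * (M * sqrt (1 + s) ^ k)"
        using M(2)[OF R s] a0 by (intro mult_left_mono) auto
      also have "\<dots> = a0 * M * ((1 + s) powr - \<beta> * sqrt (1 + s) ^ k)" by simp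
      also have "\<dots> = a0 * M * (1 + s) powr - (\<beta> - real k / 2)"
        unfolding powr_times_sqrt_power[OF s] ..
      finally show "\<bar>\<integral> x. w x * F s x \<partial>lebesgue\<bar> \<le> a0 * M * (1 + s) powr - (\<beta> - real k / 2)" .
    qed
    finally show "(\<integral> x. weight k R x * \<bar>\<Psi> x\<bar> \<partial>lebesgue)
      \<le> (\<integral> s. a0 * M * (1 + s) powr - (\<beta> - real k / 2) \<partial>lebesgue_on {0..})" .
  qed
qed

section \<open>Estimates of the Duhamel remainder\<close>

text \<open>The two time weight lemmas bring the three ranges of \<open>s\<close> under one
  integrable majorant. \<open>Q\<close> carries the size of the test function, so the L^1 and the
  supremum estimate differ only in the choice of \<open>Q\<close>.\<close>

lemma duhamel_pairing_le:
  assumes t: "0 < t"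
    and \<Psi>t: "has_L1_integral {0..t} (\<lambda>s. heat (t - s) (F s)) \<Psi>t"
    and \<Psi>: "has_L1_integral {0..} F \<Psi>"
    and w: "w \<in> borel_measurable lebesgue" "\<And>x. \<bar>w x\<bar> \<le> B" and Q: "0 \<le> Q"
    and early: "\<And>s. 0 \<le> s \<Longrightarrow> s \<le> t / 2 \<Longrightarrow>
      \<bar>\<integral> x. (heat (t - s) w x - heat t w x) * F s x \<partial>lebesgue\<bar> \<le> Q * (s / t * (1 + s) powr - \<beta>)"
    and late: "\<And>s. t / 2 \<le> s \<Longrightarrow> s \<le> t \<Longrightarrow>
      \<bar>\<integral> x. (heat (t - s) w x - heat t w x) * F s x \<partial>lebesgue\<bar> \<le> Q * (1 + s) powr - \<beta>"
    and tail: "\<And>s. t < s \<Longrightarrow> \<bar>\<integral> x. heat t w x * F s x \<partial>lebesgue\<bar> \<le> Q * (1 + s) powr - \<beta>"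
  shows "\<bar>\<integral> x. w x * (\<Psi>t x - heat t \<Psi> x) \<partial>lebesgue\<bar> \<le> 2 * Q * J\<gamma> / sqrt t ^ k"
proof -
  define b where "b = (\<lambda>s. Q * (2 / sqrt t ^ k * (1 + s) powr - (\<beta> - real k / 2)))"
  have b: "integrable (lebesgue_on {0..}) b"
    unfolding b_def using integrable_time by (intro integrable_mult_right)
  have e: "Q * (s / t * (1 + s) powr - \<beta>) \<le> b s" if "0 \<le> s" "s \<le> t / 2" for s
    unfolding b_def using that t k2 Q by (intro mult_left_mono time_weight_early) auto
  have l: "Q * (1 + s) powr - \<beta> \<le> b s" if "t / 2 \<le> s" for s
    unfolding b_def using that t k2 Q by (intro mult_left_mono time_weight_late) auto
  have "\<bar>\<integral> x. w x * (\<Psi>t x - heat t \<Psi> x) \<partial>lebesgue\<bar> \<le> (\<integral> s. b s \<partial>lebesgue_on {0..})"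
  proof (rule duhamel_diff_le[OF F_int _ \<Psi>t \<Psi> w b])
    fix s assume s: "0 \<le> s" "s \<le> t"
    show "\<bar>\<integral> x. (heat (t - s) w x - heat t w x) * F s x \<partial>lebesgue\<bar> \<le> b s"
    proof (cases "s \<le> t / 2")
      case True
      from order_trans[OF early[OF s(1) True] e[OF s(1) True]] show ?thesis .
    next
      case False
      then have "t / 2 \<le> s" by simp
      from order_trans[OF late[OF this s(2)] l[OF this]] show ?thesis .
    qed
  next
    fix s assume s: "t < s"
    then have "t / 2 \<le> s" using t by simp
    from order_trans[OF tail[OF s] l[OF this]]
    show "\<bar>\<integral> x. heat t w x * F s x \<partial>lebesgue\<bar> \<le> b s" .
  qed (use t in auto)
  also have "\<dots> = 2 * Q * J\<gamma> / sqrt t ^ k" by (simp add: b_def)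
  finally show ?thesis .
qed

text \<open>Tested with the sign of the remainder, early times use the regularity of the kernel and
  the bound \<open>1\<close> for the heat flow of \<open>\<bar>w\<bar>\<close>; all other times use
  only the bound \<open>1\<close> for \<open>heat t w\<close> and the decay of \<open>F\<close> in
  L^1.\<close>

lemma duhamel_remainder_L1:
  assumes \<Psi>: "has_L1_integral {0..} F \<Psi>"
  shows "\<exists>C>0. \<forall>t>0. \<forall>\<Psi>t. has_L1_integral {0..t} (\<lambda>s. heat (t - s) (F s)) \<Psi>t \<longrightarrow>
    (\<integral> x. \<bar>\<Psi>t x - heat t \<Psi> x\<bar> \<partial>lebesgue) \<le> C / sqrt t ^ k"
proof -
  obtain C where C: "C > 0" "\<And>t s w B y. t > 0 \<Longrightarrow> s \<in> {0..t / 2} \<Longrightarrow>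
     (w :: real ^ 'n \<Rightarrow> real) \<in> borel_measurable lebesgue \<Longrightarrow> (\<forall>x. \<bar>w x\<bar> \<le> B) \<Longrightarrow>
     \<bar>heat (t - s) w y - heat t w y\<bar> \<le> C * (s / t) * heat (2 * t) (\<lambda>x. \<bar>w x\<bar>) y"
    using heat_time_diff_le[where 'n='n] by blast
  \<comment> \<open>\<open>C\<close> serves the early times; \<open>2\<close> bounds the difference
    of two heat flows of \<open>w\<close> at late times, and a fortiori the single one in the
    tail.\<close>
  define Q where "Q = a0 * Cu * (C + 2)"
  have Q: "0 < Q" using a0 Cu C by (simp add: Q_def)
  have "(\<integral> x. \<bar>\<Psi>t x - heat t \<Psi> x\<bar> \<partial>lebesgue) \<le> 2 * Q * (J\<gamma> + 1) / sqrt t ^ k"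
    if t: "0 < t" and \<Psi>t: "has_L1_integral {0..t} (\<lambda>s. heat (t - s) (F s)) \<Psi>t" for t \<Psi>t
  proof -
    have i: "integrable lebesgue \<Psi>t" "integrable lebesgue \<Psi>"
      using \<Psi>t \<Psi> by (auto simp: has_L1_integral_def Lspace_1_iff)
    define w where "w = (\<lambda>x. sgn (\<Psi>t x - heat t \<Psi> x))"
    have [measurable]: "\<Psi>t \<in> borel_measurable lebesgue" "heat t \<Psi> \<in> borel_measurable lebesgue"
      using i borel_measurable_integrable[OF integrable_heat[OF i(2)]] by auto
    have wm: "w \<in> borel_measurable lebesgue" unfolding w_def sgn_if by measurable
    have w1: "\<bar>w x\<bar> \<le> 1" for x by (simp add: w_def sgn_if)
    note w = wm w1
    note hm = borel_measurable_heat[OF w(1)] and h1 = abs_heat_le[of w 1, OF w(2)]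
    have h2: "\<bar>heat \<tau> w x - heat \<sigma> w x\<bar> \<le> 2" for \<tau> \<sigma> x
      using h1[of \<tau> x] h1[of \<sigma> x] by linarith
    have Q2: "a0 * Cu * c * (1 + s) powr - \<beta> \<le> Q * (1 + s) powr - \<beta>" if "c \<le> 2" for c s :: real
      unfolding Q_def using a0 Cu C(1) that by (intro mult_right_mono mult_left_mono) auto
    have "(\<integral> x. \<bar>\<Psi>t x - heat t \<Psi> x\<bar> \<partial>lebesgue) = (\<integral> x. w x * (\<Psi>t x - heat t \<Psi> x) \<partial>lebesgue)"
      unfolding w_def by (intro Bochner_Integration.integral_cong) (auto simp: abs_sgn mult.commute)
    also have "\<dots> \<le> 2 * Q * J\<gamma> / sqrt t ^ k"
    proof (rule order_trans[OF abs_ge_self duhamel_pairing_le[OF t \<Psi>t \<Psi> w]])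
      fix s assume s: "0 \<le> s" "s \<le> t / 2"
      have "\<bar>\<integral> x. (heat (t - s) w x - heat t w x) * F s x \<partial>lebesgue\<bar>
          \<le> a0 * Cu * (C * (s / t)) * (1 + s) powr - \<beta>"
      proof (rule pairing_F_le[OF s(1)])
        fix x
        have "\<bar>heat (t - s) w x - heat t w x\<bar> \<le> C * (s / t) * heat (2 * t) (\<lambda>x. \<bar>w x\<bar>) x"
          using s t w by (intro C(2)[where B=1]) auto
        also have "\<dots> \<le> C * (s / t) * 1"
          using abs_heat_le[of "\<lambda>x. \<bar>w x\<bar>" 1 "2 * t" x] w(2) C(1) s t
          by (intro mult_left_mono) auto
        finally show "\<bar>heat (t - s) w x - heat t w x\<bar> \<le> C * (s / t)" by simp
      qed (use hm in auto)
      also have "\<dots> = a0 * Cu * C * (s / t * (1 + s) powr - \<beta>)" by simp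
      also have "\<dots> \<le> Q * (s / t * (1 + s) powr - \<beta>)"
        unfolding Q_def using a0 Cu s t by (intro mult_right_mono mult_left_mono) auto
      finally show "\<bar>\<integral> x. (heat (t - s) w x - heat t w x) * F s x \<partial>lebesgue\<bar>
        \<le> Q * (s / t * (1 + s) powr - \<beta>)" .
    next
      fix s assume s: "t / 2 \<le> s" "s \<le> t"
      show "\<bar>\<integral> x. (heat (t - s) w x - heat t w x) * F s x \<partial>lebesgue\<bar> \<le> Q * (1 + s) powr - \<beta>"
        using s t hm h2 by (intro order_trans[OF pairing_F_le Q2[of 2]]) auto
    next
      fix s assume s: "t < s"
      show "\<bar>\<integral> x. heat t w x * F s x \<partial>lebesgue\<bar> \<le> Q * (1 + s) powr - \<beta>"
        using s t hm h1 by (intro order_trans[OF pairing_F_le Q2[of 1]]) auto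
    qed (use Q in auto)
    also have "\<dots> \<le> 2 * Q * (J\<gamma> + 1) / sqrt t ^ k"
      using Q t by (intro divide_right_mono mult_left_mono) auto
    finally show ?thesis .
  qed
  moreover have "0 < 2 * Q * (J\<gamma> + 1)" using Q by (intro mult_pos_pos J\<gamma>_pos) auto
  ultimately show ?thesis by blast
qed

text \<open>The factor t^(-n/2) has two sources. At early times it is the smoothing of the kernel at
  time \<open>2 * t\<close>, applied to the test function; for \<open>s \<ge> t / 2\<close>, where
  \<open>t - s\<close> may vanish and smoothing is lost, it is the additional decay of
  \<open>F\<close> in the supremum norm.\<close>

lemma duhamel_remainder_sup:
  assumes \<Psi>: "has_L1_integral {0..} F \<Psi>"
  shows "\<exists>C>0. \<forall>t>0. \<forall>\<Psi>t. has_L1_integral {0..t} (\<lambda>s. heat (t - s) (F s)) \<Psi>t \<longrightarrow>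
    (AE x in lebesgue. \<bar>\<Psi>t x - heat t \<Psi> x\<bar> \<le> C * t powr (- real CARD('n) / 2) / sqrt t ^ k)"
proof -
  obtain C where C: "C > 0" "\<And>t s w B y. t > 0 \<Longrightarrow> s \<in> {0..t / 2} \<Longrightarrow>
     (w :: real ^ 'n \<Rightarrow> real) \<in> borel_measurable lebesgue \<Longrightarrow> (\<forall>x. \<bar>w x\<bar> \<le> B) \<Longrightarrow>
     \<bar>heat (t - s) w y - heat t w y\<bar> \<le> C * (s / t) * heat (2 * t) (\<lambda>x. \<bar>w x\<bar>) y"
    using heat_time_diff_le[where 'n='n] by blast
  define N where "N = real CARD('n) / 2"
  \<comment> \<open>\<open>Cu * C\<close> serves the early times. At late times \<open>2\<close>
    comes from the L^1 norm of a difference of two heat flows, and \<open>2 powr N\<close> from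
    replacing \<open>1 + s\<close> by \<open>t / 2\<close>.\<close>
  define P where "P = a0 * (Cu * C + 2 * 2 powr N)"
  have P: "0 < P" using a0 Cu C by (simp add: P_def add_pos_pos)
  have "AE x in lebesgue. \<bar>\<Psi>t x - heat t \<Psi> x\<bar> \<le> (2 * P * (J\<gamma> + 1)) * t powr - N / sqrt t ^ k"
    if t: "0 < t" and \<Psi>t: "has_L1_integral {0..t} (\<lambda>s. heat (t - s) (F s)) \<Psi>t" for t \<Psi>t
  proof (rule AE_abs_le_by_duality)
    have i: "integrable lebesgue \<Psi>t" "integrable lebesgue \<Psi>"
      using \<Psi>t \<Psi> by (auto simp: has_L1_integral_def Lspace_1_iff)
    then show "integrable lebesgue (\<lambda>x. \<Psi>t x - heat t \<Psi> x)" by simp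
    show "0 < 2 * P * (J\<gamma> + 1) * t powr - N / sqrt t ^ k"
      using P t by (intro divide_pos_pos mult_pos_pos J\<gamma>_pos) auto
    fix w :: "real ^ 'n \<Rightarrow> real" assume wi: "integrable lebesgue w" and w1: "\<And>x. \<bar>w x\<bar> \<le> 1"
    define V where "V = (\<integral> x. \<bar>w x\<bar> \<partial>lebesgue)"
    have V: "0 \<le> V" by (simp add: V_def)
    have w: "w \<in> borel_measurable lebesgue" using wi by simp
    define Q where "Q = P * t powr - N * V"
    have Q: "0 \<le> Q" using P V by (simp add: Q_def)
    note hi = integrable_heat[OF wi] and h1 = abs_heat_le[of w 1, OF w1]
    have hm: "heat \<tau> w \<in> borel_measurable lebesgue" for \<tau> using w by (rule borel_measurable_heat)
    have h2: "\<bar>heat \<tau> w x - heat \<sigma> w x\<bar> \<le> 2" for \<tau> \<sigma> x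
      using h1[of \<tau> x] h1[of \<sigma> x] by linarith
    have hV: "(\<integral> x. \<bar>heat \<tau> w x\<bar> \<partial>lebesgue) \<le> V" for \<tau>
      unfolding V_def by (rule integral_abs_heat_le[OF wi])
    have hV2: "(\<integral> x. \<bar>heat \<tau> w x - heat \<sigma> w x\<bar> \<partial>lebesgue) \<le> 2 * V" for \<tau> \<sigma>
    proof -
      have "(\<integral> x. \<bar>heat \<tau> w x - heat \<sigma> w x\<bar> \<partial>lebesgue) \<le> (\<integral> x. \<bar>heat \<tau> w x\<bar> + \<bar>heat \<sigma> w x\<bar> \<partial>lebesgue)"
        using hi by (intro integral_mono) auto
      also have "\<dots> \<le> 2 * V" using hi hV[of \<tau>] hV[of \<sigma>] by simp
      finally show ?thesis .
    qed
    have late: "a0 * (1 + s) powr - \<beta> * (1 + s) powr (- real CARD('n) / 2) * v \<le> Q * (1 + s) powr - \<beta>"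
      if s: "t / 2 \<le> s" and v: "0 \<le> v" "v \<le> 2 * V" for s v
    proof -
      have "(1 + s) powr - N \<le> (t / 2) powr - N"
        using s t by (intro powr_mono2') (auto simp: N_def)
      also have "\<dots> = 2 powr N * t powr - N" using t by (simp add: powr_divide powr_minus field_simps)
      finally have "a0 * (1 + s) powr - \<beta> * ((1 + s) powr - N * v)
          \<le> a0 * (1 + s) powr - \<beta> * ((2 powr N * t powr - N) * (2 * V))"
        using a0 v by (intro mult_left_mono mult_mono) auto
      also have "\<dots> = a0 * (2 * 2 powr N) * (t powr - N * V * (1 + s) powr - \<beta>)" by (simp add: mult_ac)
      also have "\<dots> \<le> P * (t powr - N * V * (1 + s) powr - \<beta>)"
        unfolding P_def using a0 Cu C(1) V by (intro mult_right_mono mult_left_mono) auto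
      finally show ?thesis by (simp add: N_def Q_def mult_ac)
    qed
    have "\<bar>\<integral> x. w x * (\<Psi>t x - heat t \<Psi> x) \<partial>lebesgue\<bar> \<le> 2 * Q * J\<gamma> / sqrt t ^ k"
    proof (rule duhamel_pairing_le[OF t \<Psi>t \<Psi> w w1 Q])
      fix s assume s: "0 \<le> s" "s \<le> t / 2"
      have "\<bar>\<integral> x. (heat (t - s) w x - heat t w x) * F s x \<partial>lebesgue\<bar>
          \<le> a0 * Cu * (C * (s / t) * (t powr - N * V)) * (1 + s) powr - \<beta>"
      proof (rule pairing_F_le[OF s(1)])
        fix x
        have "heat (2 * t) (\<lambda>x. \<bar>w x\<bar>) x \<le> (4 * pi * (2 * t)) powr (- real CARD('n) / 2) * (\<integral> x. \<bar>\<bar>w x\<bar>\<bar> \<partial>lebesgue)"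
          using t wi by (intro order_trans[OF abs_ge_self abs_heat_le_integral]) auto
        also have "\<dots> \<le> t powr (- real CARD('n) / 2) * V"
          using scaled_powr_le[OF t, of "4 * pi * 2" "CARD('n)"] pi_ge_two V
          by (auto simp: V_def mult_ac intro!: mult_left_mono)
        finally have g: "heat (2 * t) (\<lambda>x. \<bar>w x\<bar>) x \<le> t powr - N * V" by (simp add: N_def)
        have "\<bar>heat (t - s) w x - heat t w x\<bar> \<le> C * (s / t) * heat (2 * t) (\<lambda>x. \<bar>w x\<bar>) x"
          using s t w w1 by (intro C(2)[where B=1]) auto
        also have "\<dots> \<le> C * (s / t) * (t powr - N * V)"
          using C(1) s t by (intro mult_left_mono g) auto
        finally show "\<bar>heat (t - s) w x - heat t w x\<bar> \<le> C * (s / t) * (t powr - N * V)" .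
      qed (use hm in auto)
      also have "\<dots> = a0 * (Cu * C) * (t powr - N * V * (s / t * (1 + s) powr - \<beta>))" by simp
      also have "\<dots> \<le> P * (t powr - N * V * (s / t * (1 + s) powr - \<beta>))"
        unfolding P_def using a0 V s t by (intro mult_right_mono mult_left_mono) auto
      finally show "\<bar>\<integral> x. (heat (t - s) w x - heat t w x) * F s x \<partial>lebesgue\<bar>
        \<le> Q * (s / t * (1 + s) powr - \<beta>)" by (simp add: Q_def mult_ac)
    next
      fix s assume s: "t / 2 \<le> s" "s \<le> t"
      show "\<bar>\<integral> x. (heat (t - s) w x - heat t w x) * F s x \<partial>lebesgue\<bar> \<le> Q * (1 + s) powr - \<beta>"
        using s t hi h2 hV2 by (intro order_trans[OF pairing_F_sup_le late]) auto
    next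
      fix s assume s: "t < s"
      show "\<bar>\<integral> x. heat t w x * F s x \<partial>lebesgue\<bar> \<le> Q * (1 + s) powr - \<beta>"
        using s t hi h1 order_trans[OF hV, of "2 * V"] V
        by (intro order_trans[OF pairing_F_sup_le late]) auto
    qed
    also have "\<dots> \<le> 2 * Q * (J\<gamma> + 1) / sqrt t ^ k"
      using Q t by (intro divide_right_mono mult_left_mono) auto
    also have "\<dots> = 2 * P * (J\<gamma> + 1) * t powr - N / sqrt t ^ k * (\<integral> x. \<bar>w x\<bar> \<partial>lebesgue)"
      by (simp add: Q_def V_def)
    finally show "\<bar>\<integral> x. w x * (\<Psi>t x - heat t \<Psi> x) \<partial>lebesgue\<bar>
      \<le> 2 * P * (J\<gamma> + 1) * t powr - N / sqrt t ^ k * (\<integral> x. \<bar>w x\<bar> \<partial>lebesgue)" .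
  qed
  moreover have "0 < 2 * P * (J\<gamma> + 1)" using P by (intro mult_pos_pos J\<gamma>_pos) auto
  ultimately show ?thesis unfolding N_def minus_divide_left by blast
qed

section \<open>Expansion of the solution\<close>

text \<open>\<open>x $ j / (2 * t) * gauss t x\<close> is minus the \<open>j\<close>-th partial
  derivative of the kernel. This undilated form suits the Taylor estimate; the dilations are matched
  with it at the end.\<close>

definition remainder :: "(real ^ 'n \<Rightarrow> real) \<Rightarrow> real \<Rightarrow> real ^ 'n \<Rightarrow> real" where
  "remainder \<psi> t x = u t x - (\<integral> y. \<psi> y \<partial>lebesgue) * gauss t x
     - (if k = 2 then (\<Sum>j\<in>UNIV. (\<integral> y. y $ j * \<psi> y \<partial>lebesgue) * (x $ j / (2 * t) * gauss t x)) else 0)"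

text \<open>Up to a null set the remainder is \<open>D + H\<close>: \<open>D\<close> compares the
  Duhamel term with \<open>heat t \<Psi>\<close>, and \<open>H\<close> is the expansion error of
  \<open>heat t \<psi>\<close>. The term \<open>heat t \<phi>\<close> is common to
  \<open>u t\<close> and \<open>heat t \<psi>\<close>.\<close>

lemma asymptotics:
  assumes \<Psi>: "has_L1_integral {0..} F \<Psi>" and \<psi>: "\<psi> = (\<lambda>x. \<phi> x + \<Psi> x)"
  shows "integrable lebesgue \<psi>" "\<And>j. integrable lebesgue (\<lambda>y. y $ j * \<psi> y)"
    "\<exists>C>0. \<forall>t>0. integrable lebesgue (remainder \<psi> t) \<and>
      (\<integral> x. \<bar>remainder \<psi> t x\<bar> \<partial>lebesgue) \<le> C / sqrt t ^ k \<and>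
      (AE x in lebesgue. \<bar>remainder \<psi> t x\<bar> \<le> C * t powr (- real CARD('n) / 2) / sqrt t ^ k)"
proof -
  have \<Psi>i: "integrable lebesgue \<Psi>" using \<Psi> by (simp add: has_L1_integral_def Lspace_1_iff)
  show \<psi>i: "integrable lebesgue \<psi>" unfolding \<psi> using \<phi>(1) \<Psi>i by simp
  have \<psi>k: "integrable lebesgue (\<lambda>x. norm x ^ k * \<psi> x)"
    unfolding \<psi> using \<phi>(2) integrable_integral_F_moment[OF \<Psi>] by (simp add: distrib_left)
  then have \<psi>k': "integrable lebesgue (\<lambda>x. norm x ^ k * \<bar>\<psi> x\<bar>)"
    using integrable_abs[OF \<psi>k] by (simp add: abs_mult)
  have comp: "(\<lambda>y :: real ^ 'n. y $ j) \<in> borel_measurable lebesgue" for j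
    by (intro borel_measurable_lebesgueI borel_measurable_continuous_onI continuous_intros)
  show \<psi>j: "integrable lebesgue (\<lambda>y. y $ j * \<psi> y)" for j
  proof (rule Bochner_Integration.integrable_bound[of lebesgue "\<lambda>x. \<bar>\<psi> x\<bar> + norm x ^ k * \<bar>\<psi> x\<bar>"])
    show "AE x in lebesgue. norm (x $ j * \<psi> x) \<le> norm (\<bar>\<psi> x\<bar> + norm x ^ k * \<bar>\<psi> x\<bar>)"
    proof (rule AE_I2)
      fix x :: "real ^ 'n"
      \<comment> \<open>First moments are controlled by the moments of order \<open>0\<close> and
        \<open>k\<close>, for either value of \<open>k\<close>.\<close>
      have "norm x \<le> 1 + norm x ^ k"
      proof (cases "norm x \<le> 1")
        case False
        then have "norm x ^ 1 \<le> norm x ^ k" using k by (intro power_increasing) auto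
        then show ?thesis by simp
      qed (simp add: add_increasing2)
      then have "\<bar>x $ j\<bar> * \<bar>\<psi> x\<bar> \<le> (1 + norm x ^ k) * \<bar>\<psi> x\<bar>"
        using component_le_norm_cart[of x j] by (intro mult_right_mono) auto
      then show "norm (x $ j * \<psi> x) \<le> norm (\<bar>\<psi> x\<bar> + norm x ^ k * \<bar>\<psi> x\<bar>)"
        by (simp add: abs_mult distrib_right)
    qed
  qed (use \<psi>i \<psi>k' comp in auto)
  define c0 where "c0 = (\<integral> y. \<psi> y \<partial>lebesgue)"
  define l where "l = (\<lambda>t x. if k = 2 then (\<Sum>j\<in>UNIV. (\<integral> y. y $ j * \<psi> y \<partial>lebesgue) * (x $ j / (2 * t) * gauss t x)) else 0)"
  define m where "m = (\<integral> y. norm y ^ k * \<bar>\<psi> y\<bar> \<partial>lebesgue)"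
  have m0: "0 \<le> m" by (simp add: m_def)
  define H where "H = (\<lambda>t x. heat t \<psi> x - c0 * gauss t x - l t x)"
  define G where "G = (\<lambda>t x. gauss (2 * t) x + heat t (\<lambda>y. norm y ^ k * \<bar>\<psi> y\<bar>) x)"
  obtain C1 where C1: "C1 > 0" "\<And>t x. t > 0 \<Longrightarrow> \<bar>H t x\<bar> \<le> C1 / sqrt t ^ k * G t x"
    using heat_expansion_le[OF k \<psi>i \<psi>k \<psi>j] unfolding H_def G_def l_def c0_def by blast
  obtain C2 where C2: "C2 > 0" "\<And>t \<Psi>t. t > 0 \<Longrightarrow> has_L1_integral {0..t} (\<lambda>s. heat (t - s) (F s)) \<Psi>t \<Longrightarrow>
    (\<integral> x. \<bar>\<Psi>t x - heat t \<Psi> x\<bar> \<partial>lebesgue) \<le> C2 / sqrt t ^ k"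
    using duhamel_remainder_L1[OF \<Psi>] by blast
  obtain C3 where C3: "C3 > 0" "\<And>t \<Psi>t. t > 0 \<Longrightarrow> has_L1_integral {0..t} (\<lambda>s. heat (t - s) (F s)) \<Psi>t \<Longrightarrow>
    AE x in lebesgue. \<bar>\<Psi>t x - heat t \<Psi> x\<bar> \<le> C3 * t powr (- real CARD('n) / 2) / sqrt t ^ k"
    using duhamel_remainder_sup[OF \<Psi>] by blast
  define C where "C = C1 * (1 + m) + C2 + C3"
  have C: "C > 0" using C1 C2 C3 m0 by (simp add: C_def add_pos_pos)
  have "integrable lebesgue (remainder \<psi> t) \<and>
      (\<integral> x. \<bar>remainder \<psi> t x\<bar> \<partial>lebesgue) \<le> C / sqrt t ^ k \<and>
      (AE x in lebesgue. \<bar>remainder \<psi> t x\<bar> \<le> C * t powr (- real CARD('n) / 2) / sqrt t ^ k)"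
    if t: "t > 0" for t
  proof -
    obtain \<Psi>t where \<Psi>t: "has_L1_integral {0..t} (\<lambda>s. heat (t - s) (F s)) \<Psi>t"
      "AE x in lebesgue. u t x = heat t \<phi> x + \<Psi>t x" using duhamel[of t] t by auto
    have \<Psi>ti: "integrable lebesgue \<Psi>t" using \<Psi>t(1) by (simp add: has_L1_integral_def Lspace_1_iff)
    define D where "D = (\<lambda>x. \<Psi>t x - heat t \<Psi> x)"
    have Di: "integrable lebesgue D" unfolding D_def using \<Psi>ti \<Psi>i by simp
    have gm: "(gauss t :: real ^ 'n \<Rightarrow> real) \<in> borel_measurable lebesgue" by (intro borel_measurable_lebesgueI) measurable
    have lm: "l t \<in> borel_measurable lebesgue"
    proof (cases "k = 2")
      case True
      show ?thesis
        unfolding l_def if_P[OF True]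
        by (intro borel_measurable_sum borel_measurable_times borel_measurable_divide comp gm
            borel_measurable_const)
    qed (simp add: l_def)
    have Hm: "H t \<in> borel_measurable lebesgue"
      unfolding H_def
      by (intro borel_measurable_diff borel_measurable_times borel_measurable_const gm lm
          borel_measurable_integrable[OF integrable_heat[OF \<psi>i]])
    have g2: "integrable lebesgue (gauss (2 * t) :: real ^ 'n \<Rightarrow> real)" "(\<integral> x. gauss (2 * t) (x :: real ^ 'n) \<partial>lebesgue) = 1"
      using integrable_gauss_shift[of "2 * t" 0] t by simp_all
    have Gi: "integrable lebesgue (G t)"
      unfolding G_def using g2 integrable_heat[OF \<psi>k', of t] by simp
    have G0: "0 \<le> G t x" for x unfolding G_def using t by (simp add: heat_def)
    have GI: "(\<integral> x. G t x \<partial>lebesgue) \<le> 1 + m"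
    proof -
      have "(\<integral> x. heat t (\<lambda>y. norm y ^ k * \<bar>\<psi> y\<bar>) x \<partial>lebesgue) \<le> (\<integral> x. \<bar>heat t (\<lambda>y. norm y ^ k * \<bar>\<psi> y\<bar>) x\<bar> \<partial>lebesgue)"
        using integrable_heat[OF \<psi>k', of t] by (intro integral_mono) auto
      also have "\<dots> \<le> m" using integral_abs_heat_le[OF \<psi>k', of t] by (simp add: m_def)
      finally show ?thesis unfolding G_def using g2 integrable_heat[OF \<psi>k', of t] by simp
    qed
    have Gsup: "G t x \<le> (1 + m) * t powr (- real CARD('n) / 2)" for x
    proof -
      have "gauss (2 * t) x \<le> (4 * pi * 2 * t) powr (- real CARD('n) / 2)"
        using gauss_le[of "2 * t" x] t by (simp add: mult_ac)
      also have "\<dots> \<le> t powr (- real CARD('n) / 2)"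
        using t pi_ge_two by (intro scaled_powr_le) auto
      finally have 1: "gauss (2 * t) x \<le> t powr (- real CARD('n) / 2)" .
      have "heat t (\<lambda>y. norm y ^ k * \<bar>\<psi> y\<bar>) x \<le> (4 * pi * t) powr (- real CARD('n) / 2) * m"
        using abs_heat_le_integral[OF t \<psi>k', of x] by (simp add: m_def)
      also have "\<dots> \<le> t powr (- real CARD('n) / 2) * m"
        using t pi_ge_two m0 by (intro mult_right_mono scaled_powr_le) auto
      finally show ?thesis using 1 by (simp add: G_def algebra_simps)
    qed
    have Hi: "integrable lebesgue (H t)"
    proof (rule Bochner_Integration.integrable_bound[of lebesgue "\<lambda>x. C1 / sqrt t ^ k * G t x"])
      show "AE x in lebesgue. norm (H t x) \<le> norm (C1 / sqrt t ^ k * G t x)"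
        unfolding real_norm_def by (intro AE_I2 order_trans[OF C1(2)[OF t] abs_ge_self])
    qed (use Gi Hm in auto)
    have HI: "(\<integral> x. \<bar>H t x\<bar> \<partial>lebesgue) \<le> C1 * (1 + m) / sqrt t ^ k"
    proof -
      have "(\<integral> x. \<bar>H t x\<bar> \<partial>lebesgue) \<le> (\<integral> x. C1 / sqrt t ^ k * G t x \<partial>lebesgue)"
        using Hi Gi C1(2)[OF t] by (intro integral_mono) auto
      also have "\<dots> = C1 / sqrt t ^ k * (\<integral> x. G t x \<partial>lebesgue)" by simp
      also have "\<dots> \<le> C1 / sqrt t ^ k * (1 + m)" using GI C1(1) t by (intro mult_left_mono) auto
      finally show ?thesis by simp
    qed
    have Hsup: "\<bar>H t x\<bar> \<le> C1 * (1 + m) * t powr (- real CARD('n) / 2) / sqrt t ^ k" for x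
    proof -
      have "\<bar>H t x\<bar> \<le> C1 / sqrt t ^ k * G t x" by (rule C1(2)[OF t])
      also have "\<dots> \<le> C1 / sqrt t ^ k * ((1 + m) * t powr (- real CARD('n) / 2))"
        using Gsup[of x] C1(1) t by (intro mult_left_mono) auto
      finally show ?thesis by (simp add: mult_ac)
    qed
    have heat_add: "heat t \<psi> x = heat t \<phi> x + heat t \<Psi> x" for x
      unfolding \<psi> using t gauss_mult_integrable[OF t \<phi>(1), of x] gauss_mult_integrable[OF t \<Psi>i, of x]
      by (simp add: heat_def distrib_left)
    have rem: "AE x in lebesgue. remainder \<psi> t x = D x + H t x"
      using \<Psi>t(2)
      by eventually_elim (simp add: remainder_def D_def H_def heat_add c0_def l_def)
    have rm: "remainder \<psi> t \<in> borel_measurable lebesgue"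
      unfolding remainder_def[abs_def] c0_def[symmetric] using u_int[of t] t gm lm[unfolded l_def] by auto
    have DH: "integrable lebesgue (\<lambda>x. D x + H t x)" using Di Hi by simp
    have ri: "integrable lebesgue (remainder \<psi> t)"
      by (rule integrable_cong_AE_imp[OF DH rm]) (use rem in \<open>auto elim: eventually_mono\<close>)
    have "(\<integral> x. \<bar>remainder \<psi> t x\<bar> \<partial>lebesgue) = (\<integral> x. \<bar>D x + H t x\<bar> \<partial>lebesgue)"
    proof (rule integral_cong_AE)
      show "AE x in lebesgue. \<bar>remainder \<psi> t x\<bar> = \<bar>D x + H t x\<bar>"
        using rem by eventually_elim simp
    qed (use ri DH in auto)
    also have "\<dots> \<le> (\<integral> x. \<bar>D x\<bar> + \<bar>H t x\<bar> \<partial>lebesgue)"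
      using Di Hi by (intro integral_mono) auto
    also have "\<dots> \<le> C2 / sqrt t ^ k + C1 * (1 + m) / sqrt t ^ k"
      using Di Hi HI C2(2)[OF t \<Psi>t(1)] by (simp add: D_def)
    also have "\<dots> \<le> C / sqrt t ^ k"
      unfolding C_def add_divide_distrib[symmetric] using C3(1) t by (intro divide_right_mono) auto
    finally have rI: "(\<integral> x. \<bar>remainder \<psi> t x\<bar> \<partial>lebesgue) \<le> C / sqrt t ^ k" .
    have "AE x in lebesgue. \<bar>remainder \<psi> t x\<bar> \<le> C * t powr (- real CARD('n) / 2) / sqrt t ^ k"
      using rem C3(2)[OF t \<Psi>t(1)]
    proof eventually_elim
      fix x assume e: "remainder \<psi> t x = D x + H t x"
        and d: "\<bar>\<Psi>t x - heat t \<Psi> x\<bar> \<le> C3 * t powr (- real CARD('n) / 2) / sqrt t ^ k"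
      have "\<bar>remainder \<psi> t x\<bar> \<le> C3 * t powr (- real CARD('n) / 2) / sqrt t ^ k
          + C1 * (1 + m) * t powr (- real CARD('n) / 2) / sqrt t ^ k"
        unfolding e using d Hsup[of x] by (simp add: D_def)
      also have "\<dots> = (C3 + C1 * (1 + m)) * t powr (- real CARD('n) / 2) / sqrt t ^ k"
        by (simp add: algebra_simps add_divide_distrib)
      also have "\<dots> \<le> C * t powr (- real CARD('n) / 2) / sqrt t ^ k"
        unfolding C_def using C2(1) t by (intro divide_right_mono mult_right_mono) auto
      finally show "\<bar>remainder \<psi> t x\<bar> \<le> C * t powr (- real CARD('n) / 2) / sqrt t ^ k" .
    qed
    with ri rI show ?thesis by blast
  qed
  with C show "\<exists>C>0. \<forall>t>0. integrable lebesgue (remainder \<psi> t) \<and>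
      (\<integral> x. \<bar>remainder \<psi> t x\<bar> \<partial>lebesgue) \<le> C / sqrt t ^ k \<and>
      (AE x in lebesgue. \<bar>remainder \<psi> t x\<bar> \<le> C * t powr (- real CARD('n) / 2) / sqrt t ^ k)"
    by blast
qed

end

section \<open>The asymptotic expansion\<close>

lemma dilation_gauss:
  fixes x :: "real ^ 'n"
  assumes "t > 0"
  shows "dilation t (gauss 1) x = gauss t x"
    "dilation t (\<lambda>x. x $ j * gauss 1 x) x = t powr (- 1 / 2) * (x $ j * gauss t x)"
proof -
  have s: "t powr (- 1 / 2) = 1 / sqrt t"
    using assms by (simp add: powr_minus_divide powr_half_sqrt)
  show 1: "dilation t (gauss 1) x = gauss t x"
    using assms unfolding dilation_def gauss_def s
    by (simp add: powr_mult power_divide mult_ac)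
  have "dilation t (\<lambda>x. x $ j * gauss 1 x) x = t powr (- 1 / 2) * (x $ j * dilation t (gauss 1) x)"
    by (simp add: dilation_def mult_ac)
  then show "dilation t (\<lambda>x. x $ j * gauss 1 x) x = t powr (- 1 / 2) * (x $ j * gauss t x)"
    unfolding 1 .
qed

lemma ennreal_mult_le_imp_le_divide:
  assumes "ennreal a * x \<le> ennreal b" "0 < a"
  shows "x \<le> ennreal (b / a)"
proof -
  have "ennreal (1 / a) * (ennreal a * x) \<le> ennreal (1 / a) * ennreal b"
    using assms(1) by (rule mult_left_mono) simp
  moreover have "ennreal (1 / a) * (ennreal a * x) = x"
    using assms(2) by (simp add: mult.assoc[symmetric] ennreal_mult'[symmetric])
  moreover have "ennreal (1 / a) * ennreal b = ennreal (b / a)"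
    using assms(2) by (simp add: ennreal_mult'[symmetric])
  ultimately show ?thesis by simp
qed

text \<open>The multi-index concentrated at coordinate \<open>j\<close> gives the pure moments, and
  |x|^k is at most the sum of the |x_j|^k: for \<open>k = 1\<close> by the triangle inequality, for
  \<open>k = 2\<close> with equality.\<close>

lemma L1_moment_integrable:
  fixes \<phi> :: "real ^ 'n \<Rightarrow> real"
  assumes \<phi>: "\<phi> \<in> L1_moment k" and k: "k = 1 \<or> k = 2"
  shows "integrable lebesgue \<phi>" "integrable lebesgue (\<lambda>x. norm x ^ k * \<phi> x)"
proof -
  show i: "integrable lebesgue \<phi>" using \<phi> by (simp add: L1_moment_def Lspace_1_iff)
  have j: "integrable lebesgue (\<lambda>x. (x $ j) ^ k * \<phi> x)" for j
  proof -
    define \<alpha> where "\<alpha> = (\<lambda>i. if i = j then k else 0)"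
    have "(\<Sum>i\<in>UNIV. \<alpha> i) \<le> k" by (simp add: \<alpha>_def)
    then have "integrable lebesgue (\<lambda>x. (\<Prod>i\<in>UNIV. (x $ i) ^ \<alpha> i) * \<phi> x)"
      using \<phi> unfolding L1_moment_def Lspace_1_iff by blast
    moreover have "(\<Prod>i\<in>UNIV. (x $ i) ^ \<alpha> i) = (x $ j) ^ k" for x :: "real ^ 'n"
    proof -
      have "(\<Prod>i\<in>UNIV. (x $ i) ^ \<alpha> i) = (\<Prod>i\<in>UNIV. if i = j then (x $ j) ^ k else 1)"
        by (intro prod.cong) (auto simp: \<alpha>_def)
      then show ?thesis by simp
    qed
    ultimately show ?thesis by simp
  qed
  have le: "norm x ^ k \<le> (\<Sum>j\<in>UNIV. \<bar>x $ j\<bar> ^ k)" for x :: "real ^ 'n"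
    using k
  proof
    assume "k = 1"
    then show ?thesis using norm_le_l1_cart[of x] by simp
  next
    assume "k = 2"
    have "(norm x)\<^sup>2 = (\<Sum>j\<in>UNIV. (x $ j)\<^sup>2)"
      by (simp add: power2_norm_eq_inner inner_vec_def) (simp add: power2_eq_square)
    then show ?thesis using \<open>k = 2\<close> by simp
  qed
  show "integrable lebesgue (\<lambda>x. norm x ^ k * \<phi> x)"
  proof (rule Bochner_Integration.integrable_bound)
    show "integrable lebesgue (\<lambda>x. \<Sum>j\<in>UNIV. \<bar>(x $ j) ^ k * \<phi> x\<bar>)"
      using j by (intro Bochner_Integration.integrable_sum integrable_abs)
    have "(\<lambda>x :: real ^ 'n. norm x ^ k) \<in> borel_measurable lebesgue"
      by (rule borel_measurable_lebesgueI) measurable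
    then show "(\<lambda>x. norm x ^ k * \<phi> x) \<in> borel_measurable lebesgue" using i by simp
    show "AE x in lebesgue. norm (norm x ^ k * \<phi> x) \<le> norm (\<Sum>j\<in>UNIV. \<bar>(x $ j) ^ k * \<phi> x\<bar>)"
    proof (rule AE_I2)
      fix x :: "real ^ 'n"
      have "norm x ^ k * \<bar>\<phi> x\<bar> \<le> (\<Sum>j\<in>UNIV. \<bar>x $ j\<bar> ^ k) * \<bar>\<phi> x\<bar>"
        using le[of x] by (rule mult_right_mono) simp
      also have "\<dots> = (\<Sum>j\<in>UNIV. \<bar>(x $ j) ^ k * \<phi> x\<bar>)"
        by (simp add: sum_distrib_right abs_mult power_abs)
      finally show "norm (norm x ^ k * \<phi> x) \<le> norm (\<Sum>j\<in>UNIV. \<bar>(x $ j) ^ k * \<phi> x\<bar>)"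
        by (simp add: abs_mult sum_nonneg)
    qed
  qed
qed

text \<open>For fixed \<open>\<eta>\<close> the growth bound tends to \<open>0\<close> as
  \<open>\<xi>\<close> tends to \<open>\<eta>\<close>; \<open>0 < r\<close> covers
  \<open>\<eta> = 0\<close>. Continuity is what makes \<open>f (u s x)\<close> measurable in
  \<open>x\<close>.\<close>

lemma continuous_on_growth:
  fixes f :: "real \<Rightarrow> real"
  assumes f: "\<And>\<xi> \<eta>. \<bar>f \<xi> - f \<eta>\<bar> \<le> K * (\<bar>\<xi>\<bar> powr r + \<bar>\<eta>\<bar> powr r) * \<bar>\<xi> - \<eta>\<bar>" and r: "0 < r"
  shows "continuous_on UNIV f"
  unfolding continuous_on_def
proof
  fix \<eta> :: real
  have "((\<lambda>\<xi>. K * (\<bar>\<xi>\<bar> powr r + \<bar>\<eta>\<bar> powr r) * \<bar>\<xi> - \<eta>\<bar>) \<longlongrightarrow>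
      K * (\<bar>\<eta>\<bar> powr r + \<bar>\<eta>\<bar> powr r) * \<bar>\<eta> - \<eta>\<bar>) (at \<eta>)"
    using r by (intro tendsto_intros tendsto_powr') auto
  then have "((\<lambda>\<xi>. f \<xi> - f \<eta>) \<longlongrightarrow> 0) (at \<eta>)"
    using f by (intro Lim_null_comparison[of "\<lambda>\<xi>. f \<xi> - f \<eta>"
      "\<lambda>\<xi>. K * (\<bar>\<xi>\<bar> powr r + \<bar>\<eta>\<bar> powr r) * \<bar>\<xi> - \<eta>\<bar>"]) auto
  then show "(f \<longlongrightarrow> f \<eta>) (at \<eta>)" by (simp add: LIM_zero_iff)
qed

lemma has_L1_integral_L1_integral: "L1_integrable J g \<Longrightarrow> has_L1_integral J g (L1_integral J g)"
  unfolding L1_integrable_def L1_integral_def by (rule someI_ex[of "has_L1_integral J g"])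

text \<open>The integrability claims in front give the coefficients their meaning:
  \<open>L1_integral\<close> and the Lebesgue integral also return a value, arbitrary or zero, when
  the integral does not exist.\<close>

theorem theorem1p4:
  fixes f :: "real \<Rightarrow> real" and K p \<epsilon>\<^sub>0 :: real and m :: nat
    and \<phi> \<phi>\<^sub>1 :: "real ^ 'n \<Rightarrow> real" and u :: "real \<Rightarrow> real ^ 'n \<Rightarrow> real"
    and c\<^sub>0 :: real and c :: "'n \<Rightarrow> real"
  assumes m: "m \<in> {0, 1}"
    and p: "p > 1 + (3 + real m) / real CARD('n)"
    and f0: "f 0 = 0"
    and K: "K > 0"
    and f_growth: "\<And>\<xi> \<eta>. \<bar>f \<xi> - f \<eta>\<bar> \<le> K * (\<bar>\<xi>\<bar> powr (p - 1) + \<bar>\<eta>\<bar> powr (p - 1)) * \<bar>\<xi> - \<eta>\<bar>"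
    and \<epsilon>\<^sub>0_pos: "\<epsilon>\<^sub>0 > 0"
    and \<epsilon>\<^sub>0: "\<And>\<psi> :: real ^ 'n \<Rightarrow> real.
      \<psi> \<in> Lspace 1 \<inter> Lspace \<infinity> \<Longrightarrow> Lnorm 1 \<psi> + Lnorm \<infinity> \<psi> \<le> ennreal \<epsilon>\<^sub>0 \<Longrightarrow>
      \<exists>v. global_solution f \<psi> v \<and>
          (\<forall>w. global_solution f \<psi> w \<longrightarrow> (\<forall>t\<ge>0. AE x in lebesgue. w t x = v t x)) \<and>
          (SUP q\<in>{1..}. SUP t\<in>{0..}.
             ennreal ((1 + t) powr (real CARD('n) / 2 * (1 - enn2real (1 / q)))) * Lnorm q (v t)) < \<infinity>"
    and \<phi>: "\<phi> \<in> L1_moment (m + 1) \<inter> Lspace \<infinity>"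
    and \<phi>_small: "Lnorm 1 \<phi> + Lnorm \<infinity> \<phi> \<le> ennreal \<epsilon>\<^sub>0"
    and u: "global_solution f \<phi> u"
    and \<phi>\<^sub>1: "\<phi>\<^sub>1 = (\<lambda>x. \<phi> x + L1_integral {0..} (\<lambda>s x. f (u s x)) x)"
    and c\<^sub>0: "c\<^sub>0 = (\<integral> y. \<phi>\<^sub>1 y \<partial>lebesgue)"
    and c: "\<And>j. c j = (\<integral> y. y $ j * \<phi>\<^sub>1 y \<partial>lebesgue)"
  shows "L1_integrable {0..} (\<lambda>s x. f (u s x)) \<and>
    integrable lebesgue \<phi>\<^sub>1 \<and> (\<forall>j. integrable lebesgue (\<lambda>y. y $ j * \<phi>\<^sub>1 y)) \<and>
    (\<forall>q\<ge>1. \<exists>C>0. \<forall>t>1.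
      (m = 0 \<longrightarrow>
        ennreal (t powr (real CARD('n) / 2 * (1 - enn2real (1 / q)))) *
          Lnorm q (\<lambda>x. u t x - c\<^sub>0 * dilation t (gauss 1) x)
        \<le> ennreal (C * t powr (- 1 / 2))) \<and>
      (m = 1 \<longrightarrow>
        ennreal (t powr (real CARD('n) / 2 * (1 - enn2real (1 / q)))) *
          Lnorm q (\<lambda>x. u t x - c\<^sub>0 * dilation t (gauss 1) x
                     - 1 / 2 * t powr (- 1 / 2) *
                         (\<Sum>j\<in>UNIV. c j * dilation t (\<lambda>x. x $ j * gauss 1 x) x))
        \<le> ennreal (C * t powr (- 1))))"
proof -
  define n where "n = real CARD('n)"
  define k where "k = m + 1"
  define \<beta> where "\<beta> = n / 2 * (p - 1)"
  have n0: "0 < n" by (simp add: n_def)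
  have k12: "k = 1 \<or> k = 2" using m by (auto simp: k_def)
  have "(3 + real m) / n < p - 1" using p by (simp add: n_def)
  then have "3 + real m < (p - 1) * n" using n0 by (simp add: pos_divide_less_eq)
  \<comment> \<open>Multiplied by \<open>n / 2\<close>, the hypothesis on \<open>p\<close> reads
    \<beta> > (3 + m) / 2, which is 1 + k / 2 for \<open>k = m + 1\<close>.\<close>
  then have \<beta>: "\<beta> > 1 + real k / 2" by (simp add: \<beta>_def k_def field_simps)
  have p1: "0 < p - 1" using \<beta> n0 by (simp add: \<beta>_def zero_less_mult_iff) (smt (verit) divide_nonneg_nonneg of_nat_0_le_iff mult_nonneg_nonpos)
  \<comment> \<open>The small data hypothesis applies to \<open>\<phi>\<close>; uniqueness
    identifies \<open>u\<close> with the decaying solution \<open>v\<close> at each time up to a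
    null set.\<close>
  have "\<phi> \<in> Lspace 1 \<inter> Lspace \<infinity>" using \<phi> by (auto simp: L1_moment_def)
  from \<epsilon>\<^sub>0[OF this \<phi>_small] obtain v where v: "global_solution f \<phi> v"
    "\<And>t. 0 \<le> t \<Longrightarrow> AE x in lebesgue. u t x = v t x"
    "(SUP q\<in>{1..}. SUP t\<in>{0..}.
       ennreal ((1 + t) powr (real CARD('n) / 2 * (1 - enn2real (1 / q)))) * Lnorm q (v t)) < \<infinity>"
    using u by blast
  define S where "S = (SUP q\<in>{1..}. SUP t\<in>{0..}.
       ennreal ((1 + t) powr (real CARD('n) / 2 * (1 - enn2real (1 / q)))) * Lnorm q (v t))"
  define Cu where "Cu = enn2real S + 1"
  have Cu: "1 \<le> Cu" by (simp add: Cu_def)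
  have SCu: "S \<le> ennreal Cu"
    using v(3) unfolding S_def[symmetric] Cu_def
    by (cases S) (auto simp: ennreal_le_iff)
  have decay: "ennreal ((1 + t) powr (n / 2 * (1 - enn2real (1 / q)))) * Lnorm q (v t) \<le> ennreal Cu"
    if "1 \<le> q" "0 \<le> t" for q t
  proof -
    let ?X = "\<lambda>q t. ennreal ((1 + t) powr (n / 2 * (1 - enn2real (1 / q)))) * Lnorm q (v t)"
    have "?X q t \<le> (SUP t\<in>{0..}. ?X q t)" by (rule SUP_upper) (use that in simp)
    also have "\<dots> \<le> (SUP q\<in>{1..}. SUP t\<in>{0..}. ?X q t)"
      by (rule SUP_upper[where f="\<lambda>q. SUP t\<in>{0..}. ?X q t"]) (use that in simp)
    also have "\<dots> = S" unfolding S_def n_def ..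
    finally show ?thesis using SCu by (rule order_trans)
  qed
  have int_u: "integrable lebesgue (u t)" if "0 \<le> t" for t
    using u that by (auto simp: global_solution_def space_X_def bounded_continuous_in_def Lspace_1_iff)
  have int_v: "integrable lebesgue (v t)" if "0 \<le> t" for t
    using v(1) that by (auto simp: global_solution_def space_X_def bounded_continuous_in_def Lspace_1_iff)
  have u_L1: "(\<integral> x. \<bar>u t x\<bar> \<partial>lebesgue) \<le> Cu" if t: "0 \<le> t" for t
  proof -
    have "(\<integral> x. \<bar>u t x\<bar> \<partial>lebesgue) = (\<integral> x. \<bar>v t x\<bar> \<partial>lebesgue)"
    proof (rule integral_cong_AE)
      show "AE x in lebesgue. \<bar>u t x\<bar> = \<bar>v t x\<bar>" using v(2)[OF t] by eventually_elim simp
    qed (use int_u[OF t] int_v[OF t] in auto)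
    moreover have "ennreal (\<integral> x. \<bar>v t x\<bar> \<partial>lebesgue) \<le> ennreal Cu"
      using decay[of 1 t] t Lnorm_1_integrable[OF int_v[OF t]] by simp
    ultimately show ?thesis using Cu by simp
  qed
  have u_sup: "AE x in lebesgue. \<bar>u t x\<bar> \<le> Cu * (1 + t) powr (- n / 2)" if t: "0 \<le> t" for t
  proof -
    have "ennreal ((1 + t) powr (n / 2)) * Lnorm \<infinity> (v t) \<le> ennreal Cu"
      using decay[of \<infinity> t] t by simp
    then have "Lnorm \<infinity> (v t) \<le> ennreal (Cu / (1 + t) powr (n / 2))"
      by (rule ennreal_mult_le_imp_le_divide) (use t in simp)
    then have "AE x in lebesgue. \<bar>v t x\<bar> \<le> Cu / (1 + t) powr (n / 2)"
      by (rule Lnorm_top_leD(2)) (use Cu in simp)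
    moreover have "Cu / (1 + t) powr (n / 2) = Cu * (1 + t) powr (- n / 2)"
      unfolding minus_divide_left[symmetric] powr_minus by (rule divide_inverse)
    ultimately show ?thesis using v(2)[OF t] by (auto elim: eventually_elim2)
  qed
  have fm: "f \<in> borel_measurable borel"
    by (rule borel_measurable_continuous_onI[OF continuous_on_growth[OF f_growth p1]])
  define F where "F = (\<lambda>s x. f (u s x))"
  \<comment> \<open>The last factor \<open>Cu\<close> lets the same constant serve in
    \<open>F_sup\<close>, where \<open>\<bar>u s x\<bar>\<close> is replaced by its bound; as
    \<open>Cu \<ge> 1\<close> it only weakens \<open>F_le\<close>.\<close>
  define a0 where "a0 = K * Cu powr (p - 1) * Cu"
  have Kp: "0 < K * Cu powr (p - 1)" using K Cu by simp
  have a0: "0 < a0" using Kp Cu by (simp add: a0_def)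
  have Fm: "F s \<in> borel_measurable lebesgue" if "0 \<le> s" for s
    unfolding F_def using measurable_compose[OF borel_measurable_integrable[OF int_u[OF that]] fm] .
  have F_le': "AE x in lebesgue. \<bar>F s x\<bar> \<le> K * Cu powr (p - 1) * (1 + s) powr - \<beta> * \<bar>u s x\<bar>"
    if s: "0 \<le> s" for s
    using u_sup[OF s]
  proof eventually_elim
    fix x assume "\<bar>u s x\<bar> \<le> Cu * (1 + s) powr (- n / 2)"
    then have "\<bar>u s x\<bar> powr (p - 1) \<le> (Cu * (1 + s) powr (- n / 2)) powr (p - 1)"
      using p1 by (intro powr_mono2) auto
    also have "\<dots> = Cu powr (p - 1) * (1 + s) powr - \<beta>"
      using Cu s by (simp add: powr_mult powr_powr \<beta>_def)
    finally have *: "\<bar>u s x\<bar> powr (p - 1) \<le> Cu powr (p - 1) * (1 + s) powr - \<beta>" .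
    have "\<bar>F s x\<bar> \<le> K * \<bar>u s x\<bar> powr (p - 1) * \<bar>u s x\<bar>"
      using f_growth[of "u s x" 0] f0 by (simp add: F_def)
    also have "\<dots> \<le> K * (Cu powr (p - 1) * (1 + s) powr - \<beta>) * \<bar>u s x\<bar>"
      using * K by (intro mult_right_mono mult_left_mono) auto
    finally show "\<bar>F s x\<bar> \<le> K * Cu powr (p - 1) * (1 + s) powr - \<beta> * \<bar>u s x\<bar>" by (simp add: mult_ac)
  qed
  have F_le: "AE x in lebesgue. \<bar>F s x\<bar> \<le> a0 * (1 + s) powr - \<beta> * \<bar>u s x\<bar>" if s: "0 \<le> s" for s
    using F_le'[OF s]
  proof eventually_elim
    fix x assume le: "\<bar>F s x\<bar> \<le> K * Cu powr (p - 1) * (1 + s) powr - \<beta> * \<bar>u s x\<bar>"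
    have "K * Cu powr (p - 1) * 1 \<le> a0" unfolding a0_def using Kp Cu by (intro mult_left_mono) auto
    then have "K * Cu powr (p - 1) * ((1 + s) powr - \<beta> * \<bar>u s x\<bar>) \<le> a0 * ((1 + s) powr - \<beta> * \<bar>u s x\<bar>)"
      by (intro mult_right_mono) auto
    with le show "\<bar>F s x\<bar> \<le> a0 * (1 + s) powr - \<beta> * \<bar>u s x\<bar>" by (simp add: mult_ac)
  qed
  have F_sup: "AE x in lebesgue. \<bar>F s x\<bar> \<le> a0 * (1 + s) powr - \<beta> * (1 + s) powr (- n / 2)"
    if s: "0 \<le> s" for s
    using F_le'[OF s] u_sup[OF s]
  proof eventually_elim
    fix x assume le: "\<bar>F s x\<bar> \<le> K * Cu powr (p - 1) * (1 + s) powr - \<beta> * \<bar>u s x\<bar>"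
      and ux: "\<bar>u s x\<bar> \<le> Cu * (1 + s) powr (- n / 2)"
    have "K * Cu powr (p - 1) * (1 + s) powr - \<beta> * \<bar>u s x\<bar>
        \<le> K * Cu powr (p - 1) * (1 + s) powr - \<beta> * (Cu * (1 + s) powr (- n / 2))"
      using ux Kp by (intro mult_left_mono) auto
    with le show "\<bar>F s x\<bar> \<le> a0 * (1 + s) powr - \<beta> * (1 + s) powr (- n / 2)"
      by (simp add: a0_def mult_ac)
  qed
  have F_int: "integrable lebesgue (F s)" if s: "0 \<le> s" for s
  proof (rule Bochner_Integration.integrable_bound[of lebesgue "\<lambda>x. a0 * (1 + s) powr - \<beta> * \<bar>u s x\<bar>"])
    show "AE x in lebesgue. norm (F s x) \<le> norm (a0 * (1 + s) powr - \<beta> * \<bar>u s x\<bar>)"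
      using F_le[OF s] by eventually_elim (auto intro: order_trans[OF _ abs_ge_self])
  qed (use int_u[OF s] Fm[OF s] in auto)
  have F_cont: "((\<lambda>s. \<integral> x. \<bar>F s x - F t x\<bar> \<partial>lebesgue) \<longlongrightarrow> 0) (at t within {0..})" if t: "0 \<le> t" for t
  proof -
    \<comment> \<open>Almost all values of \<open>u\<close> lie in a fixed bounded interval, on
      which \<open>f\<close> is Lipschitz with constant \<open>L\<close>; continuity of
      \<open>u\<close> in L^1 therefore passes to \<open>F\<close>.\<close>
    define L where "L = 2 * (K * Cu powr (p - 1))"
    have "((\<lambda>s. Lnorm 1 (\<lambda>x. u s x - u t x)) \<longlongrightarrow> 0) (at t within {0..})"
      using u t by (auto simp: global_solution_def space_X_def bounded_continuous_in_def)
    moreover have "\<forall>\<^sub>F s in at t within {0..}.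
        Lnorm 1 (\<lambda>x. u s x - u t x) = ennreal (\<integral> x. \<bar>u s x - u t x\<bar> \<partial>lebesgue)"
      unfolding eventually_at_filter
      by (intro always_eventually allI impI Lnorm_1_integrable Bochner_Integration.integrable_diff int_u) (use t in auto)
    ultimately have "((\<lambda>s. ennreal (\<integral> x. \<bar>u s x - u t x\<bar> \<partial>lebesgue)) \<longlongrightarrow> ennreal 0) (at t within {0..})"
      by (simp add: tendsto_cong)
    then have ut: "((\<lambda>s. \<integral> x. \<bar>u s x - u t x\<bar> \<partial>lebesgue) \<longlongrightarrow> 0) (at t within {0..})"
      by (subst (asm) tendsto_ennreal_iff) auto
    have u_bdd: "AE x in lebesgue. \<bar>u s x\<bar> powr (p - 1) \<le> Cu powr (p - 1)" if s: "0 \<le> s" for s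
      using u_sup[OF s]
    proof eventually_elim
      fix x assume le: "\<bar>u s x\<bar> \<le> Cu * (1 + s) powr (- n / 2)"
      have "(1 + s) powr (- n / 2) \<le> 1" using s n0 powr_mono2'[of "- n / 2" 1 "1 + s"] by simp
      then have "Cu * (1 + s) powr (- n / 2) \<le> Cu * 1" using Cu by (intro mult_left_mono) auto
      with le show "\<bar>u s x\<bar> powr (p - 1) \<le> Cu powr (p - 1)" using p1 by (intro powr_mono2) auto
    qed
    have "(\<integral> x. \<bar>F s x - F t x\<bar> \<partial>lebesgue) \<le> L * (\<integral> x. \<bar>u s x - u t x\<bar> \<partial>lebesgue)" if s: "0 \<le> s" for s
    proof -
      have "(\<integral> x. \<bar>F s x - F t x\<bar> \<partial>lebesgue) \<le> (\<integral> x. L * \<bar>u s x - u t x\<bar> \<partial>lebesgue)"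
      proof (rule integral_mono_AE)
        show "AE x in lebesgue. \<bar>F s x - F t x\<bar> \<le> L * \<bar>u s x - u t x\<bar>"
          using u_bdd[OF s] u_bdd[OF t]
        proof eventually_elim
          fix x assume 1: "\<bar>u s x\<bar> powr (p - 1) \<le> Cu powr (p - 1)" "\<bar>u t x\<bar> powr (p - 1) \<le> Cu powr (p - 1)"
          have "\<bar>F s x - F t x\<bar> \<le> K * (\<bar>u s x\<bar> powr (p - 1) + \<bar>u t x\<bar> powr (p - 1)) * \<bar>u s x - u t x\<bar>"
            unfolding F_def by (rule f_growth)
          also have "\<dots> \<le> K * (Cu powr (p - 1) + Cu powr (p - 1)) * \<bar>u s x - u t x\<bar>"
            using 1 K by (intro mult_right_mono mult_left_mono add_mono) auto
          finally show "\<bar>F s x - F t x\<bar> \<le> L * \<bar>u s x - u t x\<bar>" by (simp add: L_def mult_ac)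
        qed
      qed (use F_int[OF s] F_int[OF t] int_u[OF s] int_u[OF t] in auto)
      then show ?thesis by simp
    qed
    then have "\<forall>\<^sub>F s in at t within {0..}.
        norm (\<integral> x. \<bar>F s x - F t x\<bar> \<partial>lebesgue) \<le> L * (\<integral> x. \<bar>u s x - u t x\<bar> \<partial>lebesgue)"
      unfolding eventually_at_filter by (intro always_eventually) auto
    then show ?thesis by (rule Lim_null_comparison[OF _ tendsto_mult_right_zero[OF ut]])
  qed
  interpret decaying_duhamel F u \<phi> k \<beta> a0 Cu
  proof
    show "integrable lebesgue \<phi>" "integrable lebesgue (\<lambda>x. norm x ^ k * \<phi> x)"
      using L1_moment_integrable[of \<phi> k] \<phi> k12 by (auto simp: k_def)
    show "\<exists>\<Psi>t. has_L1_integral {0..t} (\<lambda>s. heat (t - s) (F s)) \<Psi>t \<and>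
        (AE x in lebesgue. u t x = heat t \<phi> x + \<Psi>t x)" if "0 \<le> t" for t
      using u that has_L1_integral_L1_integral unfolding global_solution_def F_def by blast
  qed (use k12 \<beta> a0 Cu int_u u_L1 F_int F_le F_sup F_cont in \<open>auto simp: n_def\<close>)
  have \<Psi>: "has_L1_integral {0..} F (L1_integral {0..} F)"
    by (rule has_L1_integral_L1_integral[OF L1_integrable_F])
  have \<phi>\<^sub>1': "\<phi>\<^sub>1 = (\<lambda>x. \<phi> x + L1_integral {0..} F x)" unfolding \<phi>\<^sub>1 F_def ..
  note asym = asymptotics[OF \<Psi> \<phi>\<^sub>1']
  obtain C where C: "0 < C" "\<And>t. 0 < t \<Longrightarrow> integrable lebesgue (remainder \<phi>\<^sub>1 t)"
    "\<And>t. 0 < t \<Longrightarrow> (\<integral> x. \<bar>remainder \<phi>\<^sub>1 t x\<bar> \<partial>lebesgue) \<le> C / sqrt t ^ k"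
    "\<And>t. 0 < t \<Longrightarrow> AE x in lebesgue. \<bar>remainder \<phi>\<^sub>1 t x\<bar> \<le> C * t powr (- real CARD('n) / 2) / sqrt t ^ k"
    using asym(3) by blast
  have rate: "ennreal (t powr (real CARD('n) / 2 * (1 - enn2real (1 / q)))) * Lnorm q (remainder \<phi>\<^sub>1 t)
      \<le> ennreal (C / sqrt t ^ k)" if q: "1 \<le> q" and t: "0 < t" for q t
  proof -
    \<comment> \<open>With \<theta> = 1/q the powers of \<open>A\<close> recombine to
      \<open>A\<close>, and the supremum bound \<open>B\<close> contributes
      \<open>t powr (- (n / 2 * (1 - \<theta>)))\<close>, the inverse of the weight in the
      claim.\<close>
    define \<theta> where "\<theta> = enn2real (1 / q)"
    define A where "A = C / sqrt t ^ k"
    define B where "B = A * t powr (- n / 2)"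
    have A: "0 < A" using C(1) t by (simp add: A_def)
    have B: "0 < B" using A t by (simp add: B_def)
    have "Lnorm q (remainder \<phi>\<^sub>1 t) \<le> ennreal (A powr \<theta> * B powr (1 - \<theta>))"
      unfolding \<theta>_def using C(3,4)[OF t] A B
      by (intro Lnorm_interpolation[OF q C(2)[OF t]]) (auto simp: A_def B_def n_def)
    also have "A powr \<theta> * B powr (1 - \<theta>) = (A powr \<theta> * A powr (1 - \<theta>)) * t powr (- (n / 2 * (1 - \<theta>)))"
      using A t by (simp add: B_def powr_mult powr_powr)
    also have "A powr \<theta> * A powr (1 - \<theta>) = A" using A by (simp add: powr_add[symmetric])
    finally have "ennreal (t powr (n / 2 * (1 - \<theta>))) * Lnorm q (remainder \<phi>\<^sub>1 t)
        \<le> ennreal (t powr (n / 2 * (1 - \<theta>))) * ennreal (A * t powr (- (n / 2 * (1 - \<theta>))))"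
      by (rule mult_left_mono) simp
    also have "\<dots> = ennreal A" using A t by (simp add: ennreal_mult'[symmetric] powr_minus)
    finally show ?thesis by (simp add: A_def n_def \<theta>_def)
  qed
  have rem0: "remainder \<phi>\<^sub>1 t = (\<lambda>x. u t x - c\<^sub>0 * dilation t (gauss 1) x)" if "m = 0" "0 < t" for t
    unfolding remainder_def[abs_def] using that by (simp add: k_def c\<^sub>0 dilation_gauss)
  have rem1: "remainder \<phi>\<^sub>1 t = (\<lambda>x. u t x - c\<^sub>0 * dilation t (gauss 1) x
      - 1 / 2 * t powr (- 1 / 2) * (\<Sum>j\<in>UNIV. c j * dilation t (\<lambda>x. x $ j * gauss 1 x) x))"
    if "m = 1" "0 < t" for t
  proof
    fix x
    \<comment> \<open>One factor \<open>t powr (- 1 / 2)\<close> is explicit in the claim, the other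
      comes from dilating \<open>x $ j * gauss 1 x\<close>; together they give the
      \<open>1 / t\<close> in \<open>remainder\<close>.\<close>
    have tt: "t powr (- 1 / 2) * t powr (- 1 / 2) = 1 / t"
      using that(2) by (simp add: powr_add[symmetric] powr_minus_divide)
    have "1 / 2 * t powr (- 1 / 2) * (\<Sum>j\<in>UNIV. c j * dilation t (\<lambda>x. x $ j * gauss 1 x) x)
        = (\<Sum>j\<in>UNIV. c j * ((t powr (- 1 / 2) * t powr (- 1 / 2)) * (x $ j / 2 * gauss t x)))"
      unfolding dilation_gauss(2)[OF that(2)] sum_distrib_left by (intro sum.cong) auto
    also have "\<dots> = (\<Sum>j\<in>UNIV. c j * (x $ j / (2 * t) * gauss t x))" unfolding tt by (simp add: mult.commute)
    finally show "remainder \<phi>\<^sub>1 t x = u t x - c\<^sub>0 * dilation t (gauss 1) x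
      - 1 / 2 * t powr (- 1 / 2) * (\<Sum>j\<in>UNIV. c j * dilation t (\<lambda>x. x $ j * gauss 1 x) x)"
      unfolding remainder_def using that by (simp add: k_def c\<^sub>0 c dilation_gauss(1))
  qed
  have t0: "C / sqrt t ^ k = C * t powr (- 1 / 2)" if "m = 0" "0 < t" for t
    using that by (simp add: k_def powr_minus_divide powr_half_sqrt)
  have t1: "C / sqrt t ^ k = C * t powr (- 1)" if "m = 1" "0 < t" for t
    using that by (simp add: k_def powr_minus_divide power2_eq_square)
  have "\<forall>q\<ge>1. \<exists>C>0. \<forall>t>1.
      (m = 0 \<longrightarrow>
        ennreal (t powr (real CARD('n) / 2 * (1 - enn2real (1 / q)))) *
          Lnorm q (\<lambda>x. u t x - c\<^sub>0 * dilation t (gauss 1) x)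
        \<le> ennreal (C * t powr (- 1 / 2))) \<and>
      (m = 1 \<longrightarrow>
        ennreal (t powr (real CARD('n) / 2 * (1 - enn2real (1 / q)))) *
          Lnorm q (\<lambda>x. u t x - c\<^sub>0 * dilation t (gauss 1) x
                     - 1 / 2 * t powr (- 1 / 2) *
                         (\<Sum>j\<in>UNIV. c j * dilation t (\<lambda>x. x $ j * gauss 1 x) x))
        \<le> ennreal (C * t powr (- 1)))"
  \<comment> \<open>One constant serves all exponents \<open>q\<close>, because interpolation
    between two bounds with the same \<open>C\<close> returns \<open>C\<close>.\<close>
  proof (intro allI impI exI[of _ C] conjI C(1))
    fix q :: ennreal and t :: real assume q: "1 \<le> q" and "1 < t"
    then have t: "0 < t" by simp
    show "ennreal (t powr (real CARD('n) / 2 * (1 - enn2real (1 / q)))) *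
          Lnorm q (\<lambda>x. u t x - c\<^sub>0 * dilation t (gauss 1) x)
        \<le> ennreal (C * t powr (- 1 / 2))" if "m = 0"
      using rate[OF q t] unfolding rem0[OF that t] t0[OF that t] .
    show "ennreal (t powr (real CARD('n) / 2 * (1 - enn2real (1 / q)))) *
          Lnorm q (\<lambda>x. u t x - c\<^sub>0 * dilation t (gauss 1) x
                     - 1 / 2 * t powr (- 1 / 2) *
                         (\<Sum>j\<in>UNIV. c j * dilation t (\<lambda>x. x $ j * gauss 1 x) x))
        \<le> ennreal (C * t powr (- 1))" if "m = 1"
      using rate[OF q t] unfolding rem1[OF that t] t1[OF that t] .
  qed
  with L1_integrable_F asym(1,2) show ?thesis unfolding F_def by blast
qed

end
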